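(* (1) For a C*-algebra $A$ with character density $\chi(A)\le\aleph_1$, $A$ is AF if and only if $A$ is LF. (2) For every cardinal $\kappa>\aleph_1$ there exists an LF algebra with character density $\kappa$ which is not AF.
   Context: For a C*-algebra $A$, $\varepsilon>0$ and subsets $\mathcal F,\mathcal G\subseteq A$, write $\mathcal F\subseteq_\varepsilon\mathcal G$ if every $x\in\mathcal F$ is within norm distance $<\varepsilon$ of some element of $\mathcal G$. A C*-algebra $A$ is AF (approximately finite-dimensional) if it has a directed family of finite-dimensional C*-subalgebras with dense union; it is LF (locally finite-dimensional) if for every finite $\mathcal F\subseteq A$ and every $\varepsilon>0$ there is a finite-dimensional C*-subalgebra $D\subseteq A$ with $\mathcal F\subseteq_\varepsilon D$. The character density $\chi(A)$ is the smallest cardinality of a dense subset of $A$; $\aleph_1$ is the smallest uncountable cardinal. *)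

theory Defs
  imports Complex_Main
begin

record 'a cstar_struct =
  carrier :: "'a set"
  zer :: 'a
  add :: "'a \<Rightarrow> 'a \<Rightarrow> 'a"
  smul :: "complex \<Rightarrow> 'a \<Rightarrow> 'a"
  mul :: "'a \<Rightarrow> 'a \<Rightarrow> 'a"
  star :: "'a \<Rightarrow> 'a"
  nrm :: "'a \<Rightarrow> real"

definition cdist :: "'a cstar_struct \<Rightarrow> 'a \<Rightarrow> 'a \<Rightarrow> real" where
  "cdist A x y = nrm A (add A x (smul A (-1) y))"

definition cstar_algebra :: "'a cstar_struct \<Rightarrow> bool" where
  "cstar_algebra A \<longleftrightarrow>
     zer A \<in> carrier A \<and>
     (\<forall>x\<in>carrier A. \<forall>y\<in>carrier A. add A x y \<in> carrier A \<and> mul A x y \<in> carrier A) \<and>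
     (\<forall>c. \<forall>x\<in>carrier A. smul A c x \<in> carrier A) \<and>
     (\<forall>x\<in>carrier A. star A x \<in> carrier A) \<and>
     \<comment> \<open>complex vector space\<close>
     (\<forall>x\<in>carrier A. \<forall>y\<in>carrier A. \<forall>z\<in>carrier A. add A (add A x y) z = add A x (add A y z)) \<and>
     (\<forall>x\<in>carrier A. \<forall>y\<in>carrier A. add A x y = add A y x) \<and>
     (\<forall>x\<in>carrier A. add A (zer A) x = x) \<and>
     (\<forall>x\<in>carrier A. add A x (smul A (-1) x) = zer A) \<and>
     (\<forall>x\<in>carrier A. smul A 1 x = x) \<and>
     (\<forall>a b. \<forall>x\<in>carrier A. smul A a (smul A b x) = smul A (a * b) x) \<and>
     (\<forall>a b. \<forall>x\<in>carrier A. smul A (a + b) x = add A (smul A a x) (smul A b x)) \<and>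
     (\<forall>a. \<forall>x\<in>carrier A. \<forall>y\<in>carrier A. smul A a (add A x y) = add A (smul A a x) (smul A a y)) \<and>
     \<comment> \<open>associative algebra\<close>
     (\<forall>x\<in>carrier A. \<forall>y\<in>carrier A. \<forall>z\<in>carrier A. mul A (mul A x y) z = mul A x (mul A y z)) \<and>
     (\<forall>x\<in>carrier A. \<forall>y\<in>carrier A. \<forall>z\<in>carrier A. mul A (add A x y) z = add A (mul A x z) (mul A y z)) \<and>
     (\<forall>x\<in>carrier A. \<forall>y\<in>carrier A. \<forall>z\<in>carrier A. mul A x (add A y z) = add A (mul A x y) (mul A x z)) \<and>
     (\<forall>a. \<forall>x\<in>carrier A. \<forall>y\<in>carrier A. mul A (smul A a x) y = smul A a (mul A x y)) \<and>
     (\<forall>a. \<forall>x\<in>carrier A. \<forall>y\<in>carrier A. mul A x (smul A a y) = smul A a (mul A x y)) \<and>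
     \<comment> \<open>involution\<close>
     (\<forall>x\<in>carrier A. star A (star A x) = x) \<and>
     (\<forall>x\<in>carrier A. \<forall>y\<in>carrier A. star A (add A x y) = add A (star A x) (star A y)) \<and>
     (\<forall>a. \<forall>x\<in>carrier A. star A (smul A a x) = smul A (cnj a) (star A x)) \<and>
     (\<forall>x\<in>carrier A. \<forall>y\<in>carrier A. star A (mul A x y) = mul A (star A y) (star A x)) \<and>
     \<comment> \<open>norm, submultiplicativity, C*-identity\<close>
     (\<forall>x\<in>carrier A. nrm A x = 0 \<longleftrightarrow> x = zer A) \<and>
     (\<forall>x\<in>carrier A. \<forall>y\<in>carrier A. nrm A (add A x y) \<le> nrm A x + nrm A y) \<and>
     (\<forall>a. \<forall>x\<in>carrier A. nrm A (smul A a x) = cmod a * nrm A x) \<and>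
     (\<forall>x\<in>carrier A. \<forall>y\<in>carrier A. nrm A (mul A x y) \<le> nrm A x * nrm A y) \<and>
     (\<forall>x\<in>carrier A. nrm A (mul A (star A x) x) = (nrm A x)\<^sup>2) \<and>
     \<comment> \<open>completeness\<close>
     (\<forall>f :: nat \<Rightarrow> 'a. (\<forall>n. f n \<in> carrier A) \<longrightarrow>
          (\<forall>e>0. \<exists>N. \<forall>m\<ge>N. \<forall>n\<ge>N. cdist A (f m) (f n) < e) \<longrightarrow>
          (\<exists>x\<in>carrier A. \<forall>e>0. \<exists>N. \<forall>n\<ge>N. cdist A (f n) x < e))"

inductive_set lin_span :: "'a cstar_struct \<Rightarrow> 'a set \<Rightarrow> 'a set" for A B where
  span_zero: "zer A \<in> lin_span A B"
| span_base: "x \<in> B \<Longrightarrow> x \<in> lin_span A B"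
| span_add: "x \<in> lin_span A B \<Longrightarrow> y \<in> lin_span A B \<Longrightarrow> add A x y \<in> lin_span A B"
| span_smul: "x \<in> lin_span A B \<Longrightarrow> smul A c x \<in> lin_span A B"

text \<open>Finite-dimensional C*-subalgebra (finite-dimensional *-subalgebras are automatically closed).\<close>

definition fd_subalgebra :: "'a cstar_struct \<Rightarrow> 'a set \<Rightarrow> bool" where
  "fd_subalgebra A D \<longleftrightarrow>
     D \<subseteq> carrier A \<and> zer A \<in> D \<and>
     (\<forall>x\<in>D. \<forall>y\<in>D. add A x y \<in> D \<and> mul A x y \<in> D) \<and>
     (\<forall>c. \<forall>x\<in>D. smul A c x \<in> D) \<and>
     (\<forall>x\<in>D. star A x \<in> D) \<and>
     (\<exists>B. finite B \<and> B \<subseteq> D \<and> D \<subseteq> lin_span A B)"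

definition approx_subset :: "'a cstar_struct \<Rightarrow> real \<Rightarrow> 'a set \<Rightarrow> 'a set \<Rightarrow> bool" where
  "approx_subset A e F G \<longleftrightarrow> (\<forall>x\<in>F. \<exists>y\<in>G. cdist A x y < e)"

definition dense_in :: "'a cstar_struct \<Rightarrow> 'a set \<Rightarrow> bool" where
  "dense_in A S \<longleftrightarrow> S \<subseteq> carrier A \<and> (\<forall>x\<in>carrier A. \<forall>e>0. \<exists>y\<in>S. cdist A x y < e)"

definition is_AF :: "'a cstar_struct \<Rightarrow> bool" where
  "is_AF A \<longleftrightarrow> (\<exists>\<D>. \<D> \<noteq> {} \<and> (\<forall>D\<in>\<D>. fd_subalgebra A D) \<and>
      (\<forall>D1\<in>\<D>. \<forall>D2\<in>\<D>. \<exists>D3\<in>\<D>. D1 \<union> D2 \<subseteq> D3) \<and>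
      dense_in A (\<Union>\<D>))"

definition is_LF :: "'a cstar_struct \<Rightarrow> bool" where
  "is_LF A \<longleftrightarrow> (\<forall>F e. finite F \<and> F \<subseteq> carrier A \<and> e > 0 \<longrightarrow>
      (\<exists>D. fd_subalgebra A D \<and> approx_subset A e F D))"

definition density_le :: "'a cstar_struct \<Rightarrow> 'b rel \<Rightarrow> bool" where
  "density_le A r \<longleftrightarrow> (\<exists>S. dense_in A S \<and> (card_of S, r) \<in> ordLeq)"

definition density_eq :: "'a cstar_struct \<Rightarrow> 'b rel \<Rightarrow> bool" where
  "density_eq A r \<longleftrightarrow> (\<exists>S. dense_in A S \<and> (card_of S, r) \<in> ordIso) \<and>
                      (\<forall>S. dense_in A S \<longrightarrow> (r, card_of S) \<in> ordLeq)"

abbreviation aleph1 :: "nat set rel" where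
  "aleph1 \<equiv> cardSuc natLeq"

end

theory Submission
  imports Defs "HOL-Analysis.Analysis" "HOL-Real_Asymp.Real_Asymp" "Jordan_Normal_Form.Schur_Decomposition"
begin

text \<open>
  LF implies AF in density at most aleph 1.  On a finite-dimensional algebra \<open>D\<close> let \<open>\<tau>\<close> be the trace of
  the left regular representation.  It is a faithful positive trace, and if \<open>S\<close> is an orthonormal basis for
  \<open>\<tau>(y\<^sup>* x)\<close>, then \<open>\<Sum>\<^sub>p p \<otimes> p\<^sup>*\<close> is a diagonal for \<open>D\<close>.  This replaces matrix units: averaging
  against the diagonal turns a linear map of \<open>D\<close> into \<open>F\<close> close to the inclusion into a unitary that
  conjugates \<open>D\<close> quadratically closer to \<open>F\<close>, so a Newton iteration conjugates \<open>D\<close> into \<open>F\<close> by a unitary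
  close to \<open>1\<close> that commutes with any given \<open>D\<^sub>0 \<subseteq> D \<inter> F\<close>.  Hence every increasing sequence of
  finite-dimensional subalgebras is dominated by one whose union is dense in a prescribed larger
  separable subalgebra, and a recursion of length \<open>\<omega>\<^sub>1\<close> with countable directed families yields a
  directed family with dense union.

  For \<open>\<kappa>\<close> above aleph 1, take projections \<open>p\<^sub>\<xi>\<close> for \<open>\<xi> < \<kappa>\<close> whose pairwise products are in \<open>c\<^sub>0\<close> such that any two of
  them generate an infinite-dimensional algebra.  Finitely many of them can be perturbed to generate
  something finite-dimensional, which gives LF.  If the algebra were AF, every \<open>p\<^sub>\<xi>\<close> would be perturbed
  once and for all, and each perturbation only involves countably many \<open>\<eta>\<close>; since \<open>\<kappa>\<close> is at least
  aleph 2, two of them do not see each other, a contradiction.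
\<close>

section \<open>Traces of complex matrices\<close>

text \<open>A small rotation makes an approximating subalgebra contain one given finite-dimensional
  algebra, but not all members of a directed family at once. For an increasing sequence this
  obstacle is overcome: the n-th rotation commutes with the n-th algebra and so spoils nothing
  achieved before, and the rotations compose to a convergent infinite product. Countable directed
  families have cofinal sequences, and well-orders of cardinality at most aleph 1, taken in their
  least type, have countable initial segments; hence the bound on the density. Exponentials and
  diagonals need a unit, which is adjoined with the plain sum norm. The perturbation theory
  therefore uses only a Banach algebra norm, an isometric involution, and the rule that
  \<open>adj x * x = 0\<close> forces \<open>x = 0\<close>. Unitaries are controlled by their
  distance to 1 and not by their norm. In the counterexample any two projections meet at infinitely
  many indices n, in planes where they project onto two lines. The lines become orthogonal as n
  grows, which gives LF, but their angles are all different, so one compresses the other to an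
  element with infinitely many eigenvalues.\<close>

definition mat_trace :: "complex mat \<Rightarrow> complex" where
  "mat_trace M = (\<Sum>i<dim_row M. M $$ (i, i))"

lemma mat_trace_mult_commute:
  assumes "A \<in> carrier_mat n n" "B \<in> carrier_mat n n"
  shows "mat_trace (A * B) = mat_trace (B * A)"
proof -
  have "mat_trace (A * B) = (\<Sum>i<n. \<Sum>j<n. A $$ (i, j) * B $$ (j, i))"
    using assms by (auto simp: mat_trace_def scalar_prod_def atLeast0LessThan)
  also have "\<dots> = (\<Sum>j<n. \<Sum>i<n. B $$ (j, i) * A $$ (i, j))"
    by (subst sum.swap) (simp add: mult.commute)
  also have "\<dots> = mat_trace (B * A)"
    using assms by (auto simp: mat_trace_def scalar_prod_def atLeast0LessThan)
  finally show ?thesis .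
qed

text \<open>Every further factor pushes the possibly nonzero entries one diagonal up, so at
  \<open>k = n\<close> none is left inside the matrix.\<close>

lemma strictly_upper_triangular_power:
  fixes B :: "complex mat"
  assumes B: "B \<in> carrier_mat n n" and z: "\<And>i j. i < n \<Longrightarrow> j \<le> i \<Longrightarrow> B $$ (i, j) = 0"
    and "i < n" "j < n" "j < i + k"
  shows "(B ^\<^sub>m k) $$ (i, j) = 0"
  using assms(3-)
proof (induction k arbitrary: i j)
  case 0
  then show ?case using B by auto
next
  case (Suc k)
  have P: "B ^\<^sub>m k \<in> carrier_mat n n" using B by simp
  have "(B ^\<^sub>m Suc k) $$ (i, j) = (\<Sum>l<n. (B ^\<^sub>m k) $$ (i, l) * B $$ (l, j))"
    using P B Suc.prems by (auto simp: scalar_prod_def atLeast0LessThan)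
  also have "\<dots> = 0"
  proof (rule sum.neutral, safe)
    fix l assume l: "l < n"
    show "(B ^\<^sub>m k) $$ (i, l) * B $$ (l, j) = 0"
    proof (cases "l < i + k")
      case True
      then show ?thesis using Suc.IH[of i l] Suc.prems l by simp
    next
      case False
      then show ?thesis using z[of l j] l Suc.prems by simp
    qed
  qed
  finally show ?case .
qed

text \<open>Schur triangularization \<open>M = P * B * Q\<close> puts the eigenvalues, with
  multiplicity, on the diagonal of B, where both traces are read off. The last clause, nilpotency of
  a strictly triangular matrix, will turn a vanishing sum of squared eigenvalues into the vanishing
  of a self-adjoint element.\<close>

lemma mat_trace_eigenvalues:
  fixes M :: "complex mat"
  assumes M: "M \<in> carrier_mat n n"
  obtains es where "length es = n" "\<And>e. e \<in> set es \<Longrightarrow> eigenvalue M e"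
    "mat_trace M = sum_list es" "mat_trace (M * M) = sum_list (map (\<lambda>e. e\<^sup>2) es)"
    "set es \<subseteq> {0} \<Longrightarrow> M ^\<^sub>m n = 0\<^sub>m n n"
proof -
  obtain es where cp: "char_poly M = (\<Prod>a\<leftarrow>es. [:- a, 1:])" and len: "length es = n"
    using char_poly_factorized[OF M] by blast
  obtain B P Q where "schur_decomposition M es = (B, P, Q)"
    by (cases "schur_decomposition M es") auto
  from schur_decomposition[OF M cp this]
  have sim: "similar_mat_wit M B P Q" and ut: "upper_triangular B" and dg: "diag_mat B = es"
    by auto
  from similar_mat_witD2[OF M sim] have PQ: "P * Q = 1\<^sub>m n" "Q * P = 1\<^sub>m n" and MB: "M = P * B * Q"
    and carr: "B \<in> carrier_mat n n" "P \<in> carrier_mat n n" "Q \<in> carrier_mat n n" by auto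
  have es: "es ! i = B $$ (i, i)" if "i < n" for i
    using that carr by (simp add: dg[symmetric] diag_mat_def)
  have B0: "B $$ (i, j) = 0" if "j < i" "i < n" for i j
    using upper_triangularD[OF ut that(1)] that carr by simp
  have conj: "mat_trace (P * X * Q) = mat_trace X" if X: "X \<in> carrier_mat n n" for X
  proof -
    have "mat_trace (P * X * Q) = mat_trace (Q * (P * X))"
      using X carr by (intro mat_trace_mult_commute[where n=n]) auto
    also have "Q * (P * X) = X"
      using X carr PQ by (metis assoc_mult_mat left_mult_one_mat)
    finally show ?thesis .
  qed
  have "mat_trace M = mat_trace B"
    unfolding MB using carr by (intro conj) auto
  also have "\<dots> = sum_list es"
    using len es carr by (simp add: mat_trace_def sum_list_sum_nth atLeast0LessThan)
  finally have t1: "mat_trace M = sum_list es" .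
  have MM: "M * M = P * (B * B) * Q"
  proof -
    have "M * M = P * B * (Q * P) * B * Q"
      unfolding MB using carr by (smt (verit) assoc_mult_mat mult_carrier_mat)
    also have "\<dots> = P * (B * B) * Q"
      using carr PQ by (smt (verit) assoc_mult_mat mult_carrier_mat right_mult_one_mat)
    finally show ?thesis .
  qed
  have "mat_trace (M * M) = mat_trace (B * B)"
    unfolding MM using carr by (intro conj) auto
  also have "\<dots> = (\<Sum>i<n. (B $$ (i, i))\<^sup>2)"
  proof -
    have "(B * B) $$ (i, i) = (B $$ (i, i))\<^sup>2" if "i < n" for i
    proof -
      have "(B * B) $$ (i, i) = (\<Sum>j<n. B $$ (i, j) * B $$ (j, i))"
        using that carr by (auto simp: scalar_prod_def atLeast0LessThan)
      also have "\<dots> = (\<Sum>j\<in>{i}. B $$ (i, j) * B $$ (j, i))"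
      proof (rule sum.mono_neutral_right)
        show "\<forall>j\<in>{..<n} - {i}. B $$ (i, j) * B $$ (j, i) = 0"
        proof
          fix j assume j: "j \<in> {..<n} - {i}"
          then consider "j < i" | "i < j" by fastforce
          then show "B $$ (i, j) * B $$ (j, i) = 0"
            using B0 j that by cases auto
        qed
      qed (use that in auto)
      finally show ?thesis by (simp add: power2_eq_square)
    qed
    then show ?thesis using carr by (simp add: mat_trace_def)
  qed
  also have "\<dots> = sum_list (map (\<lambda>e. e\<^sup>2) es)"
    using len es by (simp add: sum_list_sum_nth atLeast0LessThan)
  finally have t2: "mat_trace (M * M) = sum_list (map (\<lambda>e. e\<^sup>2) es)" .
  have ev: "eigenvalue M e" if "e \<in> set es" for e
    unfolding eigenvalue_root_char_poly[OF M] cp poly_prod_list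
    using that by (auto simp: prod_list_zero_iff)
  have nil: "M ^\<^sub>m n = 0\<^sub>m n n" if "set es \<subseteq> {0}"
  proof -
    have "B $$ (i, j) = 0" if "i < n" "j \<le> i" for i j
    proof (cases "i = j")
      case True
      then show ?thesis using es[OF that(1)] len that(1) \<open>set es \<subseteq> {0}\<close> nth_mem[of i es] by auto
    next
      case False
      then show ?thesis using B0 that by auto
    qed
    then have Bn: "B ^\<^sub>m n = 0\<^sub>m n n"
      using strictly_upper_triangular_power[OF carr(1), of _ _ n] carr(1)
      by (intro eq_matI) auto
    have "similar_mat_wit (M ^\<^sub>m n) (B ^\<^sub>m n) P Q"
      by (rule similar_mat_wit_pow[OF sim])
    then have "M ^\<^sub>m n = P * (B ^\<^sub>m n) * Q"
      by (auto simp: similar_mat_wit_def Let_def)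
    then show ?thesis using carr unfolding Bn by simp
  qed
  show thesis using that[OF len ev t1 t2 nil] .
qed

section \<open>Finite-dimensional star-subalgebras\<close>

no_notation vec_index (infixl "$" 100)
no_notation scalar_prod (infix "\<bullet>" 70)

text \<open>Banach star-algebras with isometric involution in which the C*-identity survives only as
  \<open>adj_mult_self_eq_0\<close>. The weakening admits the sum norm on a unitization, so that no
  C*-norm has to be constructed there.\<close>

class star_banach = real_normed_algebra_1 + banach +
  fixes scaleC :: "complex \<Rightarrow> 'a \<Rightarrow> 'a"  (infixr "*\<^sub>C" 75)
    and adj :: "'a \<Rightarrow> 'a"
  assumes scaleC_add_right: "c *\<^sub>C (x + y) = c *\<^sub>C x + c *\<^sub>C y"
    and scaleC_add_left: "(c + d) *\<^sub>C x = c *\<^sub>C x + d *\<^sub>C x"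
    and scaleC_scaleC: "c *\<^sub>C (d *\<^sub>C x) = (c * d) *\<^sub>C x"
    and scaleC_of_real: "of_real r *\<^sub>C x = r *\<^sub>R x"
    and mult_scaleC_left: "(c *\<^sub>C x) * y = c *\<^sub>C (x * y)"
    and mult_scaleC_right: "x * (c *\<^sub>C y) = c *\<^sub>C (x * y)"
    and norm_scaleC: "norm (c *\<^sub>C x) = cmod c * norm x"
    and adj_adj: "adj (adj x) = x"
    and adj_add: "adj (x + y) = adj x + adj y"
    and adj_mult: "adj (x * y) = adj y * adj x"
    and adj_scaleC: "adj (c *\<^sub>C x) = cnj c *\<^sub>C adj x"
    and norm_adj: "norm (adj x) = norm x"
    and adj_mult_self_eq_0: "adj x * x = 0 \<Longrightarrow> x = 0"

lemma scaleC_one: "1 *\<^sub>C x = (x :: 'a :: star_banach)"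
  using scaleC_of_real[of 1 x] by simp

global_interpretation cvs: vector_space "scaleC :: complex \<Rightarrow> 'a \<Rightarrow> 'a :: star_banach"
  by unfold_locales (auto simp: scaleC_add_right scaleC_add_left scaleC_scaleC scaleC_one)

lemmas star_simps = adj_adj adj_add adj_mult adj_scaleC mult_scaleC_left mult_scaleC_right

lemma adj_zero [simp]: "adj (0 :: 'a :: star_banach) = 0"
  using norm_adj[of "0 :: 'a"] by simp

lemma adj_one [simp]: "adj (1 :: 'a :: star_banach) = 1"
  by (metis adj_adj adj_mult mult.right_neutral mult.left_neutral)

lemma adj_minus: "adj (- x :: 'a :: star_banach) = - adj x"
  by (metis adj_add adj_zero add.right_inverse add_eq_0_iff)

lemma adj_diff: "adj (x - y :: 'a :: star_banach) = adj x - adj y"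
  using adj_add[of x "- y"] by (simp add: adj_minus)

lemma adj_scaleR: "adj (r *\<^sub>R x :: 'a :: star_banach) = r *\<^sub>R adj x"
  by (simp add: scaleC_of_real[symmetric] adj_scaleC)

lemma bounded_linear_adj: "bounded_linear (adj :: 'a \<Rightarrow> 'a :: star_banach)"
  by (rule bounded_linear_intro[where K=1]) (auto simp: adj_add adj_scaleR norm_adj)

lemma adj_sum: "adj (\<Sum>i\<in>I. f i :: 'a :: star_banach) = (\<Sum>i\<in>I. adj (f i))"
  by (induction I rule: infinite_finite_induct) (auto simp: adj_add)

text \<open>Halving the exponent reads a power as \<open>adj y * y\<close>, which needs an even
  exponent at each stage; hence n is first raised to \<open>2 ^ n\<close>.\<close>

lemma selfadjoint_power_eq_0:
  fixes r :: "'a :: star_banach"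
  assumes "adj r = r" "r ^ n = 0"
  shows "r = 0"
proof -
  have adjp: "adj (r ^ k) = r ^ k" for k
    by (induction k) (auto simp: adj_mult assms(1) power_commutes)
  have "r ^ (2 ^ k) = 0 \<Longrightarrow> r = 0" for k
  proof (induction k)
    case (Suc k)
    have "adj (r ^ (2 ^ k)) * r ^ (2 ^ k) = 0"
      using Suc.prems by (simp add: adjp power_add[symmetric] mult_2)
    then show ?case using Suc.IH adj_mult_self_eq_0 by blast
  qed simp
  moreover have "r ^ (2 ^ n) = r ^ n * r ^ (2 ^ n - n)"
    by (simp add: power_add[symmetric] less_imp_le)
  ultimately show ?thesis using assms(2) by simp
qed

text \<open>The element \<open>adj y * y\<close> stands in for the squared length of an eigenvector:
  r can act on it from either side, and it is nonzero by \<open>adj_mult_self_eq_0\<close>.\<close>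

lemma selfadjoint_eigenvalue_real:
  fixes r :: "'a :: star_banach"
  assumes "adj r = r" "r * y = c *\<^sub>C y" "y \<noteq> 0"
  shows "c \<in> \<real>"
proof -
  have "adj y * (r * y) = adj (r * y) * y"
    by (simp add: adj_mult assms(1) mult.assoc)
  then have "c *\<^sub>C (adj y * y) = cnj c *\<^sub>C (adj y * y)"
    by (simp add: assms(2) star_simps)
  then have "c = cnj c"
    using assms(3) adj_mult_self_eq_0[of y] by auto
  then show ?thesis by (simp add: Reals_cnj_iff)
qed

text \<open>All subalgebras share the unit of the ambient algebra, so the scalars lie in each of
  them and a diagonal can sum to 1.\<close>

definition star_subalgebra :: "'a :: star_banach set \<Rightarrow> bool" where
  "star_subalgebra D \<longleftrightarrow> cvs.subspace D \<and> 1 \<in> D \<and> (\<forall>x\<in>D. \<forall>y\<in>D. x * y \<in> D) \<and> (\<forall>x\<in>D. adj x \<in> D)"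

definition fd_star_subalgebra :: "'a :: star_banach set \<Rightarrow> bool" where
  "fd_star_subalgebra D \<longleftrightarrow> star_subalgebra D \<and> (\<exists>B. finite B \<and> D = cvs.span B)"

lemma star_subalgebraD:
  assumes "star_subalgebra D"
  shows "0 \<in> D" "1 \<in> D" "x \<in> D \<Longrightarrow> y \<in> D \<Longrightarrow> x + y \<in> D" "x \<in> D \<Longrightarrow> y \<in> D \<Longrightarrow> x - y \<in> D"
    "x \<in> D \<Longrightarrow> y \<in> D \<Longrightarrow> x * y \<in> D" "x \<in> D \<Longrightarrow> c *\<^sub>C x \<in> D" "x \<in> D \<Longrightarrow> r *\<^sub>R x \<in> D"
    "x \<in> D \<Longrightarrow> adj x \<in> D" "(\<And>i. i \<in> I \<Longrightarrow> f i \<in> D) \<Longrightarrow> (\<Sum>i\<in>I. f i) \<in> D"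
  using assms
  by (auto simp: star_subalgebra_def scaleC_of_real[symmetric] cvs.subspace_0 cvs.subspace_add
      cvs.subspace_diff cvs.subspace_scale intro: cvs.subspace_sum)

lemma fd_star_subalgebraD: "fd_star_subalgebra D \<Longrightarrow> star_subalgebra D"
  by (simp add: fd_star_subalgebra_def)

text \<open>The functional in this lemma is the trace of the left regular representation of \<open>D\<close>.\<close>

lemma regular_trace:
  fixes D :: "'a :: star_banach set"
  assumes D: "fd_star_subalgebra D"
  obtains \<tau> :: "'a \<Rightarrow> complex" and K :: real where
    "\<And>x y. x \<in> D \<Longrightarrow> y \<in> D \<Longrightarrow> \<tau> (x + y) = \<tau> x + \<tau> y"
    "\<And>c x. x \<in> D \<Longrightarrow> \<tau> (c *\<^sub>C x) = c * \<tau> x"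
    "\<And>x y. x \<in> D \<Longrightarrow> y \<in> D \<Longrightarrow> \<tau> (x * y) = \<tau> (y * x)"
    "\<And>x. x \<in> D \<Longrightarrow> cmod (\<tau> x) \<le> K * norm x"
    "\<And>r. r \<in> D \<Longrightarrow> adj r = r \<Longrightarrow> \<tau> (r * r) \<in> \<real> \<and> 0 \<le> Re (\<tau> (r * r)) \<and> (\<tau> (r * r) = 0 \<longrightarrow> r = 0)"
    "\<And>S \<omega> x. finite S \<Longrightarrow> S \<subseteq> D \<Longrightarrow> (\<And>a b p. p \<in> S \<Longrightarrow> a \<in> D \<Longrightarrow> b \<in> D \<Longrightarrow> \<omega> p (a + b) = \<omega> p a + \<omega> p b) \<Longrightarrow>
      (\<And>c a p. p \<in> S \<Longrightarrow> a \<in> D \<Longrightarrow> \<omega> p (c *\<^sub>C a) = c * \<omega> p a) \<Longrightarrow>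
      (\<And>a. a \<in> D \<Longrightarrow> a = (\<Sum>p\<in>S. \<omega> p a *\<^sub>C p)) \<Longrightarrow> x \<in> D \<Longrightarrow> \<tau> x = (\<Sum>p\<in>S. \<omega> p (x * p))"
proof -
  note DD = star_subalgebraD[OF fd_star_subalgebraD[OF D]]
  obtain B0 where B0: "finite B0" "D = cvs.span B0"
    using D by (auto simp: fd_star_subalgebra_def)
  obtain B where B: "B \<subseteq> B0" "cvs.independent B" "B0 \<subseteq> cvs.span B"
    using cvs.maximal_independent_subset[of B0] by blast
  have finB: "finite B" using B(1) B0(1) finite_subset by blast
  have span: "cvs.span B = D"
    using B B0 cvs.span_mono cvs.span_minimal cvs.subspace_span by (metis subset_antisym)
  have BD: "b \<in> D" if "b \<in> B" for b using that span cvs.span_base by blast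
  define rep where "rep = cvs.representation B"
  have rep_add: "rep (x + y) b = rep x b + rep y b" if "x \<in> D" "y \<in> D" for x y b
    using that cvs.representation_add[OF B(2)] by (simp add: rep_def span)
  have rep_scale: "rep (c *\<^sub>C x) b = c * rep x b" if "x \<in> D" for x b c
    using that cvs.representation_scale[OF B(2)] by (simp add: rep_def span)
  have rep_sum: "(\<Sum>b\<in>B. rep x b *\<^sub>C b) = x" if "x \<in> D" for x
    using cvs.sum_representation_eq[OF B(2) _ finB subset_refl] that by (simp add: rep_def span)
  have rep_zero: "rep 0 b = 0" for b by (simp add: rep_def cvs.representation_zero)
  have rep_lin: "rep (\<Sum>p\<in>S. f p *\<^sub>C g p) b = (\<Sum>p\<in>S. f p * rep (g p) b)"
    if "\<And>p. p \<in> S \<Longrightarrow> g p \<in> D" for f :: "'b \<Rightarrow> complex" and g S b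
    using that
    by (induction S rule: infinite_finite_induct)
       (auto simp: rep_add rep_scale rep_zero DD)
  have rep_unique: "rep (\<Sum>p\<in>B. f p *\<^sub>C p) b = f b" if "b \<in> B" for f b
  proof -
    have "rep (\<Sum>p\<in>B. f p *\<^sub>C p) b = (\<Sum>p\<in>B. f p * rep p b)"
      by (rule rep_lin) (rule BD)
    also have "\<dots> = (\<Sum>p\<in>B. if p = b then f p else 0)"
      using B(2) by (intro sum.cong) (auto simp: rep_def cvs.representation_basis)
    finally show ?thesis using that finB by simp
  qed
  define \<tau> where "\<tau> x = (\<Sum>b\<in>B. rep (x * b) b)" for x
  define n where "n = card B"
  obtain bs where bs: "set bs = B" "distinct bs" "length bs = n"
    using finite_distinct_list[OF finB] distinct_card n_def by metis
  have sum_bs: "(\<Sum>b\<in>B. f b) = (\<Sum>i<n. f (bs ! i))" for f :: "'a \<Rightarrow> 'z :: comm_monoid_add"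
    using sum.reindex_bij_betw[OF bij_betw_nth[OF bs(2) refl refl], of f] bs by simp
  have bsD: "bs ! i \<in> B" "bs ! i \<in> D" if "i < n" for i
    using that bs BD nth_mem by blast+
  define M where "M x = mat n n (\<lambda>(i, j). rep (x * bs ! j) (bs ! i))" for x
  have Mc: "M x \<in> carrier_mat n n" for x by (simp add: M_def)
  have Mtr: "mat_trace (M x) = \<tau> x" for x
    by (simp add: mat_trace_def M_def \<tau>_def sum_bs)
  have Mmult: "M (x * y) = M x * M y" if "x \<in> D" "y \<in> D" for x y
  proof (rule eq_matI)
    fix i j assume ij: "i < dim_row (M x * M y)" "j < dim_col (M x * M y)"
    then have ij: "i < n" "j < n" by (auto simp: M_def)
    have "x * y * bs ! j = x * (\<Sum>b\<in>B. rep (y * bs ! j) b *\<^sub>C b)"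
      using rep_sum[of "y * bs ! j"] that bsD ij DD by (simp add: mult.assoc)
    also have "\<dots> = (\<Sum>b\<in>B. rep (y * bs ! j) b *\<^sub>C (x * b))"
      by (simp add: sum_distrib_left mult_scaleC_right)
    finally have "rep (x * y * bs ! j) (bs ! i) = (\<Sum>b\<in>B. rep (y * bs ! j) b * rep (x * b) (bs ! i))"
      using that BD DD by (simp add: rep_lin)
    then show "M (x * y) $$ (i, j) = (M x * M y) $$ (i, j)"
      using ij by (simp add: M_def sum_bs scalar_prod_def atLeast0LessThan mult.commute)
  qed (auto simp: M_def)
  \<comment> \<open>An eigenvector of the matrix is the coordinate vector of some y in D on which x
    acts as a scalar. Eigenvalues can thus be studied in the ambient algebra: they are bounded by
    the norm of x, and real if x is self-adjoint.\<close>
  have eig: "\<exists>y\<in>D. y \<noteq> 0 \<and> x * y = e *\<^sub>C y" if "x \<in> D" and ev: "eigenvalue (M x) e" for x e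
  proof -
    obtain v where v: "v \<in> carrier_vec n" "v \<noteq> 0\<^sub>v n" "M x *\<^sub>v v = e \<cdot>\<^sub>v v"
      using ev Mc[of x] by (auto simp: eigenvalue_def eigenvector_def)
    define y where "y = (\<Sum>i<n. vec_index v i *\<^sub>C bs ! i)"
    have yD: "y \<in> D" unfolding y_def by (intro DD(9) DD(6) bsD(2)) simp
    have ycoord: "rep y (bs ! i) = vec_index v i" if "i < n" for i
    proof -
      have "y = (\<Sum>b\<in>B. vec_index v (the_inv_into {..<n} ((!) bs) b) *\<^sub>C b)"
        unfolding y_def sum_bs
        by (intro sum.cong refl arg_cong2[where f=scaleC] arg_cong[where f="vec_index v"] the_inv_into_f_f[symmetric])
           (use bs in \<open>auto simp: inj_on_def nth_eq_iff_index_eq\<close>)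
      then have "rep y (bs ! i) = vec_index v (the_inv_into {..<n} ((!) bs) (bs ! i))"
        using rep_unique bsD that by simp
      also have "the_inv_into {..<n} ((!) bs) (bs ! i) = i"
        using that bs by (intro the_inv_into_f_f) (auto simp: inj_on_def nth_eq_iff_index_eq)
      finally show ?thesis .
    qed
    have "y \<noteq> 0"
    proof
      assume "y = 0"
      then have "vec_index v i = 0" if "i < n" for i
        using ycoord[OF that] by (simp add: rep_def cvs.representation_zero)
      then have "v = 0\<^sub>v n" using v(1) by (intro eq_vecI) auto
      then show False using v(2) by simp
    qed
    moreover have "x * y = e *\<^sub>C y"
    proof -
      have "rep (x * y) (bs ! i) = e * vec_index v i" if i: "i < n" for i
      proof -
        have "x * y = (\<Sum>j<n. vec_index v j *\<^sub>C (x * bs ! j))"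
          by (simp add: y_def sum_distrib_left mult_scaleC_right)
        then have "rep (x * y) (bs ! i) = (\<Sum>j<n. vec_index v j * rep (x * bs ! j) (bs ! i))"
          using rep_lin[of "{..<n}" "\<lambda>j. x * bs ! j"] bsD DD \<open>x \<in> D\<close> by simp
        also have "\<dots> = vec_index (M x *\<^sub>v v) i"
          using i v(1) by (auto simp: M_def scalar_prod_def atLeast0LessThan mult.commute)
        finally show ?thesis using i v by simp
      qed
      then have "rep (x * y) b = rep (e *\<^sub>C y) b" if "b \<in> B" for b
        using that bs ycoord yD by (auto simp: in_set_conv_nth rep_scale)
      then show ?thesis
        using rep_sum[of "x * y"] rep_sum[of "e *\<^sub>C y"] yD \<open>x \<in> D\<close> DD
        by (metis (no_types, lifting) sum.cong)
    qed
    ultimately show ?thesis using yD by blast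
  qed
  show thesis
  proof (rule that[of \<tau> "real n"])
    show "\<tau> (x + y) = \<tau> x + \<tau> y" if "x \<in> D" "y \<in> D" for x y
      using that BD DD by (simp add: \<tau>_def distrib_right rep_add sum.distrib)
    show "\<tau> (c *\<^sub>C x) = c * \<tau> x" if "x \<in> D" for c x
      using that BD DD by (simp add: \<tau>_def mult_scaleC_left rep_scale sum_distrib_left)
    show "\<tau> (x * y) = \<tau> (y * x)" if "x \<in> D" "y \<in> D" for x y
      using mat_trace_mult_commute[OF Mc Mc, of x y] that by (simp add: Mtr[symmetric] Mmult)
    show "cmod (\<tau> x) \<le> real n * norm x" if x: "x \<in> D" for x
    proof -
      obtain es where es: "length es = n" "\<And>e. e \<in> set es \<Longrightarrow> eigenvalue (M x) e"
        "mat_trace (M x) = sum_list es"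
        using mat_trace_eigenvalues[OF Mc[of x]] by metis
      \<comment> \<open>There are n eigenvalues, each at most \<open>norm x\<close> in modulus; this
        is the origin of the constant n.\<close>
      have "cmod e \<le> norm x" if ein: "e \<in> set es" for e
      proof -
        obtain y where y: "y \<noteq> 0" "x * y = e *\<^sub>C y" using eig[OF x es(2)[OF ein]] by blast
        have "cmod e * norm y \<le> norm x * norm y"
          using norm_mult_ineq[of x y] by (simp add: y norm_scaleC)
        then show ?thesis using y(1) by simp
      qed
      then have "cmod (sum_list es) \<le> real (length es) * norm x"
      proof (induction es)
        case (Cons e es)
        have "cmod (sum_list (e # es)) \<le> cmod e + cmod (sum_list es)"
          by (simp add: norm_triangle_ineq)
        also have "\<dots> \<le> norm x + real (length es) * norm x"
          using Cons by (intro add_mono) auto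
        finally show ?case by (simp add: distrib_right)
      qed simp
      then show ?thesis using es Mtr by simp
    qed
    show "\<tau> (r * r) \<in> \<real> \<and> 0 \<le> Re (\<tau> (r * r)) \<and> (\<tau> (r * r) = 0 \<longrightarrow> r = 0)" if r: "r \<in> D" "adj r = r" for r
    proof -
      obtain es where es: "length es = n" "\<And>e. e \<in> set es \<Longrightarrow> eigenvalue (M r) e"
        "mat_trace (M r * M r) = sum_list (map (\<lambda>e. e\<^sup>2) es)"
        "set es \<subseteq> {0} \<Longrightarrow> M r ^\<^sub>m n = 0\<^sub>m n n"
        using mat_trace_eigenvalues[OF Mc[of r]] by metis
      have real: "e \<in> \<real>" if "e \<in> set es" for e
        using eig[OF r(1) es(2)[OF that]] selfadjoint_eigenvalue_real[OF r(2)] by blast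
      have \<tau>: "\<tau> (r * r) = sum_list (map (\<lambda>e. e\<^sup>2) es)"
        using es(3) r by (simp add: Mmult[symmetric] Mtr)
      have "sum_list (map (\<lambda>e. e\<^sup>2) es) = of_real (sum_list (map (\<lambda>e. (Re e)\<^sup>2) es))"
        using real by (induction es) (auto elim!: Reals_cases)
      then have \<tau>': "\<tau> (r * r) = of_real (sum_list (map (\<lambda>e. (Re e)\<^sup>2) es))" using \<tau> by simp
      \<comment> \<open>Real eigenvalues with vanishing sum of squares are all 0, so the matrix of r
        is nilpotent. Applying \<open>r ^ n\<close> to 1 gives \<open>r ^ n = 0\<close>, and
        self-adjointness gives \<open>r = 0\<close>.\<close>
      have "r = 0" if "\<tau> (r * r) = 0"
      proof -
        have "sum_list (map (\<lambda>e. (Re e)\<^sup>2) es) = 0" using \<tau>' that by simp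
        then have "\<forall>e\<in>set es. (Re e)\<^sup>2 = 0"
          by (subst (asm) sum_list_nonneg_eq_0_iff) auto
        then have "set es \<subseteq> {0}" using real by (auto simp: complex_eq_iff complex_is_Real_iff)
        then have nil: "M r ^\<^sub>m n = 0\<^sub>m n n" by (rule es(4))
        have rp: "r ^ k \<in> D" for k by (induction k) (auto simp: DD r)
        have M1: "M 1 = 1\<^sub>m n"
          using B(2) bsD bs
          by (intro eq_matI) (auto simp: M_def rep_def cvs.representation_basis nth_eq_iff_index_eq)
        have "M (r ^ k) = M r ^\<^sub>m k" for k
        proof (induction k)
          case 0
          then show ?case using M1 by (simp add: M_def)
        next
          case (Suc k)
          then show ?case using Mmult[OF rp[of k] r(1)] by (simp add: power_commutes)
        qed
        then have "M (r ^ n) = 0\<^sub>m n n" using nil by simp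
        moreover have "M (r ^ n) $$ (i, j) = rep (r ^ n * bs ! j) (bs ! i)" if "i < n" "j < n" for i j
          using that by (simp add: M_def)
        ultimately have z: "rep (r ^ n * bs ! j) (bs ! i) = 0" if "i < n" "j < n" for i j
          using that by simp
        have "r ^ n * bs ! j = 0" if "j < n" for j
        proof -
          have "(\<Sum>b\<in>B. rep (r ^ n * bs ! j) b *\<^sub>C b) = 0"
            unfolding sum_bs using z that by simp
          then show ?thesis using rep_sum[of "r ^ n * bs ! j"] rp bsD that DD by simp
        qed
        then have "r ^ n * b = 0" if "b \<in> B" for b
          using that bs by (auto simp: in_set_conv_nth)
        then have "r ^ n * (\<Sum>b\<in>B. rep 1 b *\<^sub>C b) = 0"
          by (simp add: sum_distrib_left mult_scaleC_right)
        then have "r ^ n = 0" using rep_sum[of 1] DD by simp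
        then show ?thesis using selfadjoint_power_eq_0 r(2) by blast
      qed
      moreover have "0 \<le> sum_list (map (\<lambda>e. (Re e)\<^sup>2) es)"
        by (rule sum_list_nonneg) auto
      ultimately show ?thesis by (simp add: \<tau>')
    qed
    \<comment> \<open>The trace of left multiplication is independent of the coordinates used:
      insert the expansion of each b in B and exchange the two sums.\<close>
    show "\<tau> x = (\<Sum>p\<in>S. \<omega> p (x * p))"
      if S: "finite S" "S \<subseteq> D" and \<omega>: "\<And>a b p. p \<in> S \<Longrightarrow> a \<in> D \<Longrightarrow> b \<in> D \<Longrightarrow> \<omega> p (a + b) = \<omega> p a + \<omega> p b"
        "\<And>c a p. p \<in> S \<Longrightarrow> a \<in> D \<Longrightarrow> \<omega> p (c *\<^sub>C a) = c * \<omega> p a"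
        "\<And>a. a \<in> D \<Longrightarrow> a = (\<Sum>p\<in>S. \<omega> p a *\<^sub>C p)" and x: "x \<in> D" for S \<omega> x
    proof -
      have \<omega>0: "\<omega> p 0 = 0" if "p \<in> S" for p
        using \<omega>(2)[OF that, of 0 0] DD(1) by simp
      have \<omega>_lin: "\<omega> p (\<Sum>b\<in>T. f b *\<^sub>C g b) = (\<Sum>b\<in>T. f b * \<omega> p (g b))"
        if "p \<in> S" "\<And>b. b \<in> T \<Longrightarrow> g b \<in> D" for p f and g :: "'a \<Rightarrow> 'a" and T
        using that by (induction T rule: infinite_finite_induct) (auto simp: \<omega> \<omega>0 DD)
      have "\<tau> x = (\<Sum>b\<in>B. rep (x * (\<Sum>p\<in>S. \<omega> p b *\<^sub>C p)) b)"
        unfolding \<tau>_def using \<omega>(3) BD by (intro sum.cong) auto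
      also have "\<dots> = (\<Sum>b\<in>B. \<Sum>p\<in>S. \<omega> p b * rep (x * p) b)"
        using S(2) x DD by (auto simp: sum_distrib_left mult_scaleC_right intro!: sum.cong rep_lin)
      also have "\<dots> = (\<Sum>p\<in>S. \<Sum>b\<in>B. rep (x * p) b * \<omega> p b)"
        by (subst sum.swap) (simp add: mult.commute)
      also have "\<dots> = (\<Sum>p\<in>S. \<omega> p (\<Sum>b\<in>B. rep (x * p) b *\<^sub>C b))"
        using BD by (intro sum.cong refl \<omega>_lin[symmetric]) auto
      also have "\<dots> = (\<Sum>p\<in>S. \<omega> p (x * p))"
        using S(2) x DD rep_sum by (intro sum.cong refl) (auto simp: subset_iff)
      finally show ?thesis .
    qed
  qed
qed

text \<open>Conditions \<open>p\<^sup>* a = \<Sum>\<^sub>q \<phi>\<^sub>p(a q) q\<^sup>*\<close> and \<open>a q = \<Sum>\<^sub>p \<phi>\<^sub>p(a q) p\<close> together say that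
  \<open>\<Sum>\<^sub>p a p \<otimes> p\<^sup>* = \<Sum>\<^sub>p p \<otimes> p\<^sup>* a\<close>, so that \<open>\<Sum>\<^sub>p p \<otimes> p\<^sup>*\<close> is a diagonal for \<open>D\<close> in the sense of
  amenability.\<close>

definition casimir_basis :: "'a :: star_banach set \<Rightarrow> 'a set \<Rightarrow> ('a \<Rightarrow> 'a \<Rightarrow> complex) \<Rightarrow> real \<Rightarrow> bool" where
  "casimir_basis D S \<phi> K \<longleftrightarrow> finite S \<and> S \<subseteq> D \<and> 0 \<le> K \<and>
     (\<forall>p\<in>S. \<forall>a\<in>D. \<forall>b\<in>D. \<phi> p (a + b) = \<phi> p a + \<phi> p b) \<and>
     (\<forall>p\<in>S. \<forall>a\<in>D. \<forall>c. \<phi> p (c *\<^sub>C a) = c * \<phi> p a) \<and>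
     (\<forall>p\<in>S. \<forall>a\<in>D. cmod (\<phi> p a) \<le> K * norm a) \<and>
     (\<forall>a\<in>D. a = (\<Sum>p\<in>S. \<phi> p a *\<^sub>C p)) \<and>
     (\<Sum>p\<in>S. p * adj p) = 1 \<and>
     (\<forall>p\<in>S. \<forall>a\<in>D. adj p * a = (\<Sum>q\<in>S. \<phi> p (a * q) *\<^sub>C adj q))"

lemma casimir_basisD:
  assumes "casimir_basis D S \<phi> K"
  shows "finite S" "S \<subseteq> D" "0 \<le> K"
    "p \<in> S \<Longrightarrow> a \<in> D \<Longrightarrow> b \<in> D \<Longrightarrow> \<phi> p (a + b) = \<phi> p a + \<phi> p b"
    "p \<in> S \<Longrightarrow> a \<in> D \<Longrightarrow> \<phi> p (c *\<^sub>C a) = c * \<phi> p a"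
    "p \<in> S \<Longrightarrow> a \<in> D \<Longrightarrow> cmod (\<phi> p a) \<le> K * norm a"
    "a \<in> D \<Longrightarrow> a = (\<Sum>p\<in>S. \<phi> p a *\<^sub>C p)"
    "(\<Sum>p\<in>S. p * adj p) = 1"
    "p \<in> S \<Longrightarrow> a \<in> D \<Longrightarrow> adj p * a = (\<Sum>q\<in>S. \<phi> p (a * q) *\<^sub>C adj q)"
  using assms unfolding casimir_basis_def by meson+

text \<open>The regular trace is the one that normalizes the diagonal. A trace of weight c on a
  block of n by n matrices makes the sum of the \<open>p * adj p\<close> equal to n / c there, and
  the regular trace has c = n. Without blocks the argument reads: for that sum e, \<tau>(x e) is the
  sum of the \<phi> p (x p), which is the trace \<tau>(x) of left multiplication by x, and
  faithfulness of \<tau> yields e = 1.\<close>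

lemma casimir_basis_exists:
  fixes D :: "'a :: star_banach set"
  assumes D: "fd_star_subalgebra D"
  obtains S \<phi> K where "casimir_basis D S \<phi> K"
proof -
  note DD = star_subalgebraD[OF fd_star_subalgebraD[OF D]]
  show thesis
  proof (rule regular_trace[OF D])
    fix \<tau> :: "'a \<Rightarrow> complex" and K0 :: real
    assume \<tau>_add: "\<And>x y. x \<in> D \<Longrightarrow> y \<in> D \<Longrightarrow> \<tau> (x + y) = \<tau> x + \<tau> y"
      and \<tau>_scale: "\<And>c x. x \<in> D \<Longrightarrow> \<tau> (c *\<^sub>C x) = c * \<tau> x"
      and \<tau>_comm: "\<And>x y. x \<in> D \<Longrightarrow> y \<in> D \<Longrightarrow> \<tau> (x * y) = \<tau> (y * x)"
      and \<tau>_bd: "\<And>x. x \<in> D \<Longrightarrow> cmod (\<tau> x) \<le> K0 * norm x"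
      and \<tau>_pos: "\<And>r. r \<in> D \<Longrightarrow> adj r = r \<Longrightarrow> \<tau> (r * r) \<in> \<real> \<and> 0 \<le> Re (\<tau> (r * r)) \<and> (\<tau> (r * r) = 0 \<longrightarrow> r = 0)"
      and \<tau>_tr: "\<And>S \<omega> x. finite S \<Longrightarrow> S \<subseteq> D \<Longrightarrow> (\<And>a b p. p \<in> S \<Longrightarrow> a \<in> D \<Longrightarrow> b \<in> D \<Longrightarrow> \<omega> p (a + b) = \<omega> p a + \<omega> p b) \<Longrightarrow>
        (\<And>c a p. p \<in> S \<Longrightarrow> a \<in> D \<Longrightarrow> \<omega> p (c *\<^sub>C a) = c * \<omega> p a) \<Longrightarrow>
        (\<And>a. a \<in> D \<Longrightarrow> a = (\<Sum>p\<in>S. \<omega> p a *\<^sub>C p)) \<Longrightarrow> x \<in> D \<Longrightarrow> \<tau> x = (\<Sum>p\<in>S. \<omega> p (x * p))"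
    have \<tau>_0: "\<tau> 0 = 0" using \<tau>_scale[of 0 0] DD(1) by simp
    have \<tau>_lin: "\<tau> (\<Sum>p\<in>S. f p *\<^sub>C g p) = (\<Sum>p\<in>S. f p * \<tau> (g p))"
      if "\<And>p. p \<in> S \<Longrightarrow> g p \<in> D" for f and g :: "'a \<Rightarrow> 'a" and S
      using that by (induction S rule: infinite_finite_induct) (auto simp: \<tau>_0 \<tau>_add \<tau>_scale DD)
    have \<tau>_minus: "\<tau> (x - y) = \<tau> x - \<tau> y" if "x \<in> D" "y \<in> D" for x y
      using \<tau>_add[of "x - y" y] that DD by simp
    define re where "re x = (1/2) *\<^sub>C (x + adj x)" for x :: 'a
    define im where "im x = (- \<i>/2) *\<^sub>C (x - adj x)" for x :: 'a
    have re_im: "re x \<in> D" "im x \<in> D" if "x \<in> D" for x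
      unfolding re_def im_def using that by (auto intro: DD(3,4,6,8) simp del: cvs.scale_minus_left)
    have re_im_adj: "adj (re x) = re x" "adj (im x) = im x" for x
      by (simp_all add: re_def im_def star_simps adj_diff add.commute cvs.scale_right_diff_distrib)
    have decomp: "x = re x + \<i> *\<^sub>C im x" "adj x = re x - \<i> *\<^sub>C im x" for x
    proof -
      have 1: "(1/2) *\<^sub>C y + (1/2) *\<^sub>C y = y" for y :: 'a
        by (simp flip: scaleC_add_left add: scaleC_one)
      show "x = re x + \<i> *\<^sub>C im x" "adj x = re x - \<i> *\<^sub>C im x"
        using 1[of x] 1[of "adj x"]
        by (simp_all add: re_def im_def scaleC_scaleC scaleC_add_right cvs.scale_right_diff_distrib)
    qed
    \<comment> \<open>Only squares of self-adjoint elements are known to have real trace; r is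
      reached through the square of \<open>r + 1\<close>.\<close>
    have \<tau>_real: "\<tau> r \<in> \<real>" if "r \<in> D" "adj r = r" for r
    proof -
      have "\<tau> ((r + 1) * (r + 1)) = \<tau> (r * r) + 2 * \<tau> r + \<tau> (1 * 1)"
        using that DD by (simp add: distrib_left distrib_right \<tau>_add)
      then have "\<tau> r = (\<tau> ((r + 1) * (r + 1)) - \<tau> (r * r) - \<tau> (1 * 1)) / 2" by simp
      moreover have "\<tau> ((r + 1) * (r + 1)) \<in> \<real>" "\<tau> (r * r) \<in> \<real>" "\<tau> (1 * 1) \<in> \<real>"
        using \<tau>_pos[of "r + 1"] \<tau>_pos[of r] \<tau>_pos[of 1] that DD by (auto simp: adj_add)
      ultimately show ?thesis by (metis Reals_diff Reals_divide Reals_numeral)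
    qed
    have \<tau>_adj: "\<tau> (adj x) = cnj (\<tau> x)" if x: "x \<in> D" for x
    proof -
      have "\<tau> (re x) \<in> \<real>" "\<tau> (im x) \<in> \<real>" using \<tau>_real re_im[OF x] re_im_adj by auto
      moreover have "\<tau> x = \<tau> (re x) + \<i> * \<tau> (im x)"
        using re_im[OF x] DD by (subst decomp(1)) (simp add: \<tau>_add \<tau>_scale)
      moreover have "\<tau> (adj x) = \<tau> (re x) - \<i> * \<tau> (im x)"
        using re_im[OF x] DD by (subst decomp(2)) (simp add: \<tau>_minus \<tau>_scale)
      ultimately show ?thesis by (auto simp: Reals_cnj_iff)
    qed
    \<comment> \<open>By the trace property \<open>adj x * x\<close> and \<open>x * adj x\<close>
      have equal traces, and their sum is twice the sum of the squares of the real and imaginary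
      parts of x.\<close>
    have pos: "\<tau> (adj x * x) \<in> \<real> \<and> 0 \<le> Re (\<tau> (adj x * x)) \<and> (\<tau> (adj x * x) = 0 \<longrightarrow> x = 0)"
      if x: "x \<in> D" for x
    proof -
      note rD = re_im[OF x]
      have "adj x * x + x * adj x = 2 *\<^sub>C (re x * re x + im x * im x)"
      proof -
        have "adj x * x + x * adj x = (re x - \<i> *\<^sub>C im x) * (re x + \<i> *\<^sub>C im x) + (re x + \<i> *\<^sub>C im x) * (re x - \<i> *\<^sub>C im x)"
          using decomp[of x] by metis
        also have "\<dots> = (re x * re x + im x * im x) + (re x * re x + im x * im x)"
          by (simp add: algebra_simps star_simps scaleC_scaleC)
        finally show ?thesis
          using scaleC_add_left[of 1 1 "re x * re x + im x * im x"] by (simp add: scaleC_one)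
      qed
      moreover have "\<tau> (adj x * x + x * adj x) = 2 * \<tau> (adj x * x)"
        using \<tau>_comm[of x "adj x"] x DD by (simp add: \<tau>_add)
      ultimately have "2 * \<tau> (adj x * x) = 2 * (\<tau> (re x * re x) + \<tau> (im x * im x))"
        using rD DD by (simp add: \<tau>_add \<tau>_scale)
      then have eq: "\<tau> (adj x * x) = \<tau> (re x * re x) + \<tau> (im x * im x)"
        by (rule mult_left_cancel[THEN iffD1, rotated]) simp
      have p1: "\<tau> (re x * re x) \<in> \<real>" "0 \<le> Re (\<tau> (re x * re x))" "\<tau> (re x * re x) = 0 \<longrightarrow> re x = 0"
        using \<tau>_pos[OF rD(1) re_im_adj(1)] by auto
      have p2: "\<tau> (im x * im x) \<in> \<real>" "0 \<le> Re (\<tau> (im x * im x))" "\<tau> (im x * im x) = 0 \<longrightarrow> im x = 0"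
        using \<tau>_pos[OF rD(2) re_im_adj(2)] by auto
      have "x = 0" if "\<tau> (adj x * x) = 0"
      proof -
        have "Re (\<tau> (re x * re x)) + Re (\<tau> (im x * im x)) = 0" using that eq by (metis plus_complex.sel(1) zero_complex.sel(1))
        then have "re x = 0" "im x = 0"
          using p1 p2 by (auto simp: complex_eq_iff complex_is_Real_iff)
        then show ?thesis using decomp(1)[of x] by simp
      qed
      then show ?thesis using eq p1 p2 by auto
    qed
    \<comment> \<open>Gram-Schmidt for the form \<tau>(adj q * p), stated for spanning sets so that
      a vector with residue \<open>w = 0\<close> is simply dropped.\<close>
    have gs: "\<exists>S. finite S \<and> S \<subseteq> D \<and> (\<forall>p\<in>S. \<forall>q\<in>S. \<tau> (adj q * p) = (if p = q then 1 else 0)) \<and> B \<subseteq> cvs.span S"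
      if "finite B" "B \<subseteq> D" for B
      using that
    proof (induction B)
      case empty
      then show ?case by (intro exI[of _ "{}"]) auto
    next
      case (insert v B)
      then obtain S where S: "finite S" "S \<subseteq> D" "\<forall>p\<in>S. \<forall>q\<in>S. \<tau> (adj q * p) = (if p = q then 1 else 0)"
        "B \<subseteq> cvs.span S" by blast
      have vD: "v \<in> D" using insert.prems by simp
      define s where "s = (\<Sum>p\<in>S. \<tau> (adj p * v) *\<^sub>C p)"
      define w where "w = v - s"
      have sS: "s \<in> cvs.span S" unfolding s_def
        by (intro cvs.span_sum cvs.span_scale cvs.span_base) auto
      have sD: "s \<in> D" unfolding s_def using S(2) by (intro DD(9) DD(6)) auto
      have wD: "w \<in> D" unfolding w_def using vD sD DD by blast
      have orth: "\<tau> (adj q * w) = 0" if q: "q \<in> S" for q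
      proof -
        have qD: "q \<in> D" using q S by auto
        have "\<tau> (adj q * s) = (\<Sum>p\<in>S. \<tau> (adj p * v) * \<tau> (adj q * p))"
          unfolding s_def sum_distrib_left mult_scaleC_right using S(2) qD DD by (intro \<tau>_lin) auto
        also have "\<dots> = (\<Sum>p\<in>S. if p = q then \<tau> (adj p * v) else 0)"
          using S(3) q by (intro sum.cong) auto
        also have "\<dots> = \<tau> (adj q * v)" using q S(1) by simp
        finally show ?thesis unfolding w_def right_diff_distrib using qD vD sD DD by (simp add: \<tau>_minus)
      qed
      show ?case
      proof (cases "w = 0")
        case True
        then have "v \<in> cvs.span S" using sS by (simp add: w_def)
        then show ?thesis using S by (intro exI[of _ S]) auto
      next
        case False
        define t where "t = Re (\<tau> (adj w * w))"
        have tw: "\<tau> (adj w * w) = of_real t" using pos[OF wD] unfolding t_def by auto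
        have t: "0 < t" using pos[OF wD] False tw by (auto simp: less_le)
        obtain g where g: "g * g * t = 1" "g > 0"
          using t by (intro that[of "1 / sqrt t"]) (auto simp: field_simps)
        define p0 where "p0 = of_real g *\<^sub>C w"
        have p0D: "p0 \<in> D" using wD DD by (simp add: p0_def)
        have o1: "\<tau> (adj p0 * p0) = 1"
        proof -
          have "\<tau> (adj p0 * p0) = of_real (g * g * t)"
            using wD DD by (simp add: p0_def star_simps \<tau>_scale tw)
          then show ?thesis using g by simp
        qed
        have o2: "\<tau> (adj q * p0) = 0" if "q \<in> S" for q
          using orth[OF that] that S(2) wD DD by (auto simp: p0_def star_simps \<tau>_scale)
        have o3: "\<tau> (adj p0 * q) = 0" if "q \<in> S" for q
        proof -
          have "\<tau> (adj (adj q * p0)) = 0"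
            using o2[OF that] that S(2) p0D DD by (subst \<tau>_adj) auto
          then show ?thesis by (simp add: star_simps)
        qed
        have "p0 \<notin> S" using o1 o2 by auto
        have "w = of_real (inverse g) *\<^sub>C p0"
          using g(2) by (simp add: p0_def scaleC_scaleC scaleC_one flip: of_real_mult)
        then have "v = s + of_real (inverse g) *\<^sub>C p0" by (simp add: w_def algebra_simps)
        moreover have "s \<in> cvs.span (insert p0 S)" using sS cvs.span_mono[of S "insert p0 S"] by blast
        ultimately have "v \<in> cvs.span (insert p0 S)"
          using cvs.span_add cvs.span_scale cvs.span_base by (metis insertI1)
        moreover have "B \<subseteq> cvs.span (insert p0 S)" using S(4) cvs.span_mono[of S "insert p0 S"] by blast
        ultimately show ?thesis
          using S p0D o1 o2 o3 \<open>p0 \<notin> S\<close> by (intro exI[of _ "insert p0 S"]) auto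
      qed
    qed
    obtain B where B: "finite B" "D = cvs.span B" using D by (auto simp: fd_star_subalgebra_def)
    then have "B \<subseteq> D" using cvs.span_superset by auto
    from gs[OF B(1) this] obtain S where S: "finite S" "S \<subseteq> D"
      "\<forall>p\<in>S. \<forall>q\<in>S. \<tau> (adj q * p) = (if p = q then 1 else 0)" "B \<subseteq> cvs.span S" by blast
    have DS: "D \<subseteq> cvs.span S" using S(4) B(2) cvs.span_minimal cvs.subspace_span by blast
    have SD: "p \<in> D" if "p \<in> S" for p using that S(2) by blast
    define \<phi> where "\<phi> p a = \<tau> (adj p * a)" for p a
    define K where "K = (\<Sum>p\<in>S. \<bar>K0\<bar> * norm p)"
    have expand: "a = (\<Sum>p\<in>S. \<phi> p a *\<^sub>C p)" if a: "a \<in> D" for a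
    proof -
      obtain u where u: "a = (\<Sum>p\<in>S. u p *\<^sub>C p)"
        using DS a cvs.span_finite[OF S(1)] by auto
      have "\<phi> q a = u q" if q: "q \<in> S" for q
      proof -
        have "\<phi> q a = (\<Sum>p\<in>S. u p * \<tau> (adj q * p))"
          unfolding \<phi>_def u sum_distrib_left mult_scaleC_right using SD q DD by (intro \<tau>_lin) auto
        also have "\<dots> = (\<Sum>p\<in>S. if p = q then u p else 0)"
          using S(3) q by (intro sum.cong) auto
        finally show ?thesis using q S(1) by simp
      qed
      then show ?thesis by (subst u) (auto intro!: sum.cong)
    qed
    have \<phi>_add: "\<phi> p (a + b) = \<phi> p a + \<phi> p b" if "p \<in> S" "a \<in> D" "b \<in> D" for p a b
      using that SD DD by (simp add: \<phi>_def distrib_left \<tau>_add)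
    have \<phi>_scale: "\<phi> p (c *\<^sub>C a) = c * \<phi> p a" if "p \<in> S" "a \<in> D" for p a c
      using that SD DD by (simp add: \<phi>_def mult_scaleC_right \<tau>_scale)
    define e where "e = (\<Sum>p\<in>S. p * adj p)"
    have eD: "e \<in> D" unfolding e_def using SD DD by (intro DD(9)) auto
    have tre: "\<tau> (x * e) = \<tau> x" if x: "x \<in> D" for x
    proof -
      have "\<tau> (x * e) = (\<Sum>p\<in>S. \<tau> (x * p * adj p))"
        using \<tau>_lin[of S "\<lambda>p. x * p * adj p" "\<lambda>p. 1"] SD DD x
        by (simp add: e_def sum_distrib_left mult.assoc scaleC_one)
      also have "\<dots> = (\<Sum>p\<in>S. \<phi> p (x * p))"
        unfolding \<phi>_def using SD DD x by (intro sum.cong refl \<tau>_comm) auto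
      also have "\<dots> = \<tau> x"
        using \<tau>_tr[OF S(1,2) \<phi>_add \<phi>_scale expand x] by simp
      finally show ?thesis .
    qed
    have "\<tau> (adj (e - 1) * (e - 1)) = 0"
      using tre[of "adj (e - 1)"] eD DD by (simp add: right_diff_distrib \<tau>_minus)
    then have e1: "e = 1" using pos[of "e - 1"] eD DD by simp
    have "casimir_basis D S \<phi> K"
      unfolding casimir_basis_def
    proof (intro conjI ballI allI)
      show "0 \<le> K" by (auto simp: K_def intro!: sum_nonneg)
      show "cmod (\<phi> p a) \<le> K * norm a" if "p \<in> S" "a \<in> D" for p a
      proof -
        have "cmod (\<phi> p a) \<le> K0 * norm (adj p * a)"
          unfolding \<phi>_def using that SD DD by (intro \<tau>_bd) auto
        also have "\<dots> \<le> \<bar>K0\<bar> * (norm p * norm a)"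
          using norm_mult_ineq[of "adj p" a] by (intro mult_mono) (auto simp: norm_adj)
        also have "\<dots> \<le> K * norm a"
          unfolding K_def mult.assoc[symmetric]
          using that S(1) by (intro mult_right_mono member_le_sum) auto
        finally show ?thesis .
      qed
      show "adj p * a = (\<Sum>q\<in>S. \<phi> p (a * q) *\<^sub>C adj q)" if p: "p \<in> S" and a: "a \<in> D" for p a
      proof -
        \<comment> \<open>Expand \<open>adj a * p\<close> and take adjoints: the conjugate of
          \<tau>(adj q * adj a * p) is \<tau>(adj p * a * q), which is the coefficient wanted on the
          other leg.\<close>
        have "adj a * p = (\<Sum>q\<in>S. \<phi> q (adj a * p) *\<^sub>C q)" using p a SD DD by (intro expand) auto
        then have "adj (adj a * p) = adj (\<Sum>q\<in>S. \<phi> q (adj a * p) *\<^sub>C q)" by (rule arg_cong)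
        then have "adj p * a = (\<Sum>q\<in>S. cnj (\<phi> q (adj a * p)) *\<^sub>C adj q)"
          by (simp add: adj_sum star_simps)
        moreover have "cnj (\<phi> q (adj a * p)) = \<phi> p (a * q)" if "q \<in> S" for q
          using \<tau>_adj[of "adj q * (adj a * p)"] SD[OF that] SD[OF p] a DD
          by (simp add: \<phi>_def star_simps mult.assoc)
        ultimately show ?thesis by simp
      qed
    qed (use S expand \<phi>_add \<phi>_scale e1 e_def in auto)
    then show thesis by (rule that)
  qed
qed

text \<open>Coordinates in a Casimir basis are bounded, so they converge along a convergent
  sequence, and the limit is the combination of S with the limiting coordinates.\<close>

lemma closed_fd_star_subalgebra:
  fixes D :: "'a :: star_banach set"
  assumes D: "fd_star_subalgebra D"
  shows "closed D"
proof (rule closed_sequential_limits[THEN iffD2], intro allI impI, elim conjE)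
  fix f l assume fD: "\<forall>n. f n \<in> D" and lim: "f \<longlonglongrightarrow> l"
  note DD = star_subalgebraD[OF fd_star_subalgebraD[OF D]]
  obtain S \<phi> K where "casimir_basis D S \<phi> K" using casimir_basis_exists[OF D] by blast
  note C = casimir_basisD[OF this]
  have "\<exists>z. (\<lambda>n. \<phi> p (f n)) \<longlonglongrightarrow> z" if p: "p \<in> S" for p
  proof -
    have diff: "\<phi> p (f m) - \<phi> p (f n) = \<phi> p (f m - f n)" for m n
      using C(4)[OF p, of "f m - f n" "f n"] fD DD by simp
    have "Cauchy (\<lambda>n. \<phi> p (f n))"
    proof (rule metric_CauchyI)
      fix e :: real assume "0 < e"
      \<comment> \<open>The bound K may be 0, hence \<open>K + 1\<close> in the denominator.\<close>
      then have "0 < e / (K + 1)" using C(3) by simp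
      then obtain N where N: "\<And>m n. m \<ge> N \<Longrightarrow> n \<ge> N \<Longrightarrow> dist (f m) (f n) < e / (K + 1)"
        using LIMSEQ_imp_Cauchy[OF lim] metric_CauchyD by blast
      have "dist (\<phi> p (f m)) (\<phi> p (f n)) < e" if "m \<ge> N" "n \<ge> N" for m n
      proof -
        have "dist (\<phi> p (f m)) (\<phi> p (f n)) \<le> K * norm (f m - f n)"
          using C(6)[OF p, of "f m - f n"] fD DD by (simp add: dist_norm diff)
        also have "\<dots> \<le> (K + 1) * norm (f m - f n)" by (simp add: distrib_right)
        also have "\<dots> < (K + 1) * (e / (K + 1))"
          using N[OF that] C(3) by (intro mult_strict_left_mono) (auto simp: dist_norm)
        finally show ?thesis using C(3) by simp
      qed
      then show "\<exists>M. \<forall>m\<ge>M. \<forall>n\<ge>M. dist (\<phi> p (f m)) (\<phi> p (f n)) < e" by blast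
    qed
    then show ?thesis using Cauchy_convergent convergent_def by blast
  qed
  then obtain z where z: "\<And>p. p \<in> S \<Longrightarrow> (\<lambda>n. \<phi> p (f n)) \<longlonglongrightarrow> z p" by metis
  have sc: "(\<lambda>n. g n *\<^sub>C p) \<longlonglongrightarrow> c *\<^sub>C p" if "g \<longlonglongrightarrow> c" for g c and p :: 'a
  proof -
    have "bounded_linear (\<lambda>c. c *\<^sub>C p)"
    proof (rule bounded_linear_intro[where K="norm p"])
      show "(r *\<^sub>R c) *\<^sub>C p = r *\<^sub>R (c *\<^sub>C p)" for r c
        by (metis scaleC_of_real scaleC_scaleC scaleR_conv_of_real)
    qed (auto simp: scaleC_add_left norm_scaleC)
    then show ?thesis using that by (rule bounded_linear.tendsto)
  qed
  have "(\<lambda>n. \<Sum>p\<in>S. \<phi> p (f n) *\<^sub>C p) \<longlonglongrightarrow> (\<Sum>p\<in>S. z p *\<^sub>C p)"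
    using z by (intro tendsto_sum sc) auto
  moreover have "(\<lambda>n. \<Sum>p\<in>S. \<phi> p (f n) *\<^sub>C p) = f"
    by (intro ext C(7)[symmetric]) (use fD in blast)
  ultimately have "l = (\<Sum>p\<in>S. z p *\<^sub>C p)" using lim LIMSEQ_unique by metis
  then show "l \<in> D" using C(2) by (auto intro!: DD(6,9))
qed

section \<open>Perturbation of finite-dimensional star-subalgebras\<close>

definition clinear_on :: "'a :: star_banach set \<Rightarrow> ('a \<Rightarrow> 'a) \<Rightarrow> bool" where
  "clinear_on D T \<longleftrightarrow> (\<forall>a\<in>D. \<forall>b\<in>D. T (a + b) = T a + T b) \<and> (\<forall>a\<in>D. \<forall>c. T (c *\<^sub>C a) = c *\<^sub>C T a)"

lemma clinear_on_sum:
  assumes T: "clinear_on D T" and D: "star_subalgebra D" and g: "\<And>i. i \<in> I \<Longrightarrow> g i \<in> D"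
  shows "T (\<Sum>i\<in>I. f i *\<^sub>C g i) = (\<Sum>i\<in>I. f i *\<^sub>C T (g i))"
proof -
  note DD = star_subalgebraD[OF D]
  have T0: "T 0 = 0"
    using T DD(1) unfolding clinear_on_def by (metis cvs.scale_zero_left)
  show ?thesis
    using g
  proof (induction I rule: infinite_finite_induct)
    case (insert i I)
    then have "(\<Sum>i\<in>I. f i *\<^sub>C g i) \<in> D" by (intro DD(9) DD(6)) auto
    then show ?case using insert T DD(6) by (simp add: clinear_on_def)
  qed (auto simp: T0)
qed

text \<open>Both identities come from d \<Sum> p \<otimes> adj p = \<Sum> p \<otimes> adj p d by
  applying T to the second or to the first leg and multiplying. The coefficient identities of a
  Casimir basis carry this out without tensor products.\<close>

lemma casimir_basis_commute:
  assumes D: "star_subalgebra D" and C: "casimir_basis D S \<phi> K" and d: "d \<in> D"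
    and T: "clinear_on D T"
  shows "(\<Sum>p\<in>S. p * T (adj p * d)) = d * (\<Sum>p\<in>S. p * T (adj p))"
    and "(\<Sum>p\<in>S. T (d * p) * adj p) = (\<Sum>p\<in>S. T p * adj p) * d"
proof -
  note DD = star_subalgebraD[OF D] and CC = casimir_basisD[OF C]
  have SD: "p \<in> D" if "p \<in> S" for p using that CC(2) by auto
  have "(\<Sum>p\<in>S. p * T (adj p * d)) = (\<Sum>p\<in>S. p * (\<Sum>q\<in>S. \<phi> p (d * q) *\<^sub>C T (adj q)))"
  proof (intro sum.cong refl arg_cong2[where f=times])
    fix p assume p: "p \<in> S"
    show "T (adj p * d) = (\<Sum>q\<in>S. \<phi> p (d * q) *\<^sub>C T (adj q))"
      unfolding CC(9)[OF p d] using SD DD(8) by (intro clinear_on_sum[OF T D]) auto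
  qed
  also have "\<dots> = (\<Sum>q\<in>S. (\<Sum>p\<in>S. \<phi> p (d * q) *\<^sub>C p) * T (adj q))"
    unfolding sum_distrib_left sum_distrib_right mult_scaleC_left mult_scaleC_right by (rule sum.swap)
  also have "\<dots> = (\<Sum>q\<in>S. d * q * T (adj q))"
    using CC(7)[symmetric] SD DD(5) d by (intro sum.cong refl arg_cong2[where f=times]) auto
  finally show "(\<Sum>p\<in>S. p * T (adj p * d)) = d * (\<Sum>p\<in>S. p * T (adj p))"
    by (simp add: sum_distrib_left mult.assoc)
  have "(\<Sum>p\<in>S. T (d * p) * adj p) = (\<Sum>q\<in>S. (\<Sum>p\<in>S. \<phi> p (d * q) *\<^sub>C T p) * adj q)"
  proof (intro sum.cong refl arg_cong2[where f=times])
    fix q assume q: "q \<in> S"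
    have "T (d * q) = T (\<Sum>p\<in>S. \<phi> p (d * q) *\<^sub>C p)"
      using CC(7)[of "d * q"] SD[OF q] DD(5) d by simp
    also have "\<dots> = (\<Sum>p\<in>S. \<phi> p (d * q) *\<^sub>C T p)"
      using SD by (intro clinear_on_sum[OF T D]) auto
    finally show "T (d * q) = (\<Sum>p\<in>S. \<phi> p (d * q) *\<^sub>C T p)" .
  qed
  also have "\<dots> = (\<Sum>p\<in>S. T p * (\<Sum>q\<in>S. \<phi> p (d * q) *\<^sub>C adj q))"
    unfolding sum_distrib_left sum_distrib_right mult_scaleC_left mult_scaleC_right by (rule sum.swap)
  also have "\<dots> = (\<Sum>p\<in>S. T p * (adj p * d))"
    using CC(9)[symmetric] d by (intro sum.cong refl arg_cong2[where f=times]) auto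
  finally show "(\<Sum>p\<in>S. T (d * p) * adj p) = (\<Sum>p\<in>S. T p * adj p) * d"
    by (simp add: sum_distrib_right mult.assoc)
qed

lemma norm_mult3:
  fixes a b c :: "'a :: real_normed_algebra"
  shows "norm (a * b * c) \<le> norm a * norm b * norm c"
  by (rule order_trans[OF norm_mult_ineq]) (intro mult_right_mono norm_mult_ineq norm_ge_zero)

text \<open>Three stages: send each basis element to a neighbour in F and extend by coordinates,
  symmetrize under the adjoint, average over the diagonal of D0 on both sides. The inclusion of D is
  fixed by the last two, so the error grows only by constant factors. The factor m is found before F
  and \<delta>, because F will change during the iteration.\<close>

lemma near_inclusion_bimodule_map:
  fixes D D0 :: "'a :: star_banach set"
  assumes D: "star_subalgebra D" and D0: "fd_star_subalgebra D0" and sub: "D0 \<subseteq> D"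
    and C: "casimir_basis D S \<phi> K"
  obtains m where "0 \<le> m"
    "\<And>F \<delta>. star_subalgebra F \<Longrightarrow> D0 \<subseteq> F \<Longrightarrow> 0 < \<delta> \<Longrightarrow> (\<forall>p\<in>S. \<exists>f\<in>F. norm (f - p) \<le> \<delta>) \<Longrightarrow>
      \<exists>T. clinear_on D T \<and> (\<forall>a\<in>D. T a \<in> F \<and> T (adj a) = adj (T a) \<and> norm (T a - a) \<le> m * \<delta> * norm a)
        \<and> (\<forall>d\<in>D0. \<forall>a\<in>D. T (d * a) = d * T a)"
proof -
  note DD = star_subalgebraD[OF D] and CC = casimir_basisD[OF C]
  have SD: "p \<in> D" if "p \<in> S" for p using that CC(2) by auto
  obtain S0 \<psi> L where C0: "casimir_basis D0 S0 \<psi> L" using casimir_basis_exists[OF D0] by blast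
  note CC0 = casimir_basisD[OF C0] and DD0 = star_subalgebraD[OF fd_star_subalgebraD[OF D0]]
  have S0D: "p \<in> D0" "p \<in> D" if "p \<in> S0" for p using that CC0(2) sub by auto
  define m0 where "m0 = real (card S) * K"
  \<comment> \<open>The norms of c and e occur twice, once outside T1 and once inside its
    argument.\<close>
  define N where "N = (\<Sum>c\<in>S0. \<Sum>e\<in>S0. norm c * (norm c * norm e) * norm e)"
  have m0: "0 \<le> m0" using CC(3) by (simp add: m0_def)
  have N: "0 \<le> N" by (auto simp: N_def intro!: sum_nonneg)
  show thesis
  proof (rule that[of "N * m0"])
    show "0 \<le> N * m0" using N m0 by simp
    fix F \<delta> assume F: "star_subalgebra F" and D0F: "D0 \<subseteq> F" and \<delta>: "0 < (\<delta> :: real)"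
      and near: "\<forall>p\<in>S. \<exists>f\<in>F. norm (f - p) \<le> \<delta>"
    note FF = star_subalgebraD[OF F]
    obtain f where f: "\<And>p. p \<in> S \<Longrightarrow> f p \<in> F" "\<And>p. p \<in> S \<Longrightarrow> norm (f p - p) \<le> \<delta>"
      using near by metis
    define T0 where "T0 a = (\<Sum>p\<in>S. \<phi> p a *\<^sub>C f p)" for a
    have T0F: "T0 a \<in> F" for a unfolding T0_def using f(1) by (intro FF(9) FF(6)) auto
    have T0_add: "T0 (a + b) = T0 a + T0 b" if "a \<in> D" "b \<in> D" for a b
      using CC(4) that by (simp add: T0_def scaleC_add_left sum.distrib)
    have T0_scale: "T0 (c *\<^sub>C a) = c *\<^sub>C T0 a" if "a \<in> D" for c a
      using CC(5) that by (simp add: T0_def scaleC_scaleC cvs.scale_sum_right)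
    have T0_near: "norm (T0 a - a) \<le> m0 * \<delta> * norm a" if a: "a \<in> D" for a
    proof -
      have "T0 a - a = (\<Sum>p\<in>S. \<phi> p a *\<^sub>C f p) - (\<Sum>p\<in>S. \<phi> p a *\<^sub>C p)"
        unfolding T0_def using CC(7)[OF a] by simp
      also have "\<dots> = (\<Sum>p\<in>S. \<phi> p a *\<^sub>C (f p - p))"
        by (simp add: sum_subtractf cvs.scale_right_diff_distrib)
      also have "norm \<dots> \<le> (\<Sum>p\<in>S. norm (\<phi> p a *\<^sub>C (f p - p)))" by (rule norm_sum)
      also have "\<dots> \<le> (\<Sum>p\<in>S. K * norm a * \<delta>)"
        unfolding norm_scaleC using CC(3,6) f(2) a by (intro sum_mono mult_mono) auto
      finally show ?thesis by (simp add: m0_def mult_ac)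
    qed
    define T1 where "T1 a = (1/2) *\<^sub>R (T0 a + adj (T0 (adj a)))" for a
    have T1F: "T1 a \<in> F" for a unfolding T1_def by (intro FF(3,7,8) T0F)
    have lin1: "clinear_on D T1"
      unfolding clinear_on_def
    proof (intro conjI ballI allI)
      fix a b assume "a \<in> D" "b \<in> D"
      then show "T1 (a + b) = T1 a + T1 b"
        using DD by (simp add: T1_def adj_add T0_add algebra_simps)
    next
      fix a c assume "a \<in> D"
      then show "T1 (c *\<^sub>C a) = c *\<^sub>C T1 a"
        using DD(8) by (simp add: T1_def adj_scaleC T0_scale scaleC_add_right mult.commute
            flip: scaleC_of_real add: scaleC_scaleC)
    qed
    have T1_adj: "T1 (adj a) = adj (T1 a)" for a
      by (simp add: T1_def adj_scaleR adj_add adj_adj add.commute)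
    have T1_near: "norm (T1 a - a) \<le> m0 * \<delta> * norm a" if a: "a \<in> D" for a
    proof -
      have "T1 a - a = (1/2) *\<^sub>R ((T0 a - a) + adj (T0 (adj a) - adj a))"
      proof -
        have "(1/2) *\<^sub>R (a + a) = a" by (simp flip: scaleR_2)
        then show ?thesis by (simp add: T1_def adj_diff adj_adj algebra_simps)
      qed
      also have "norm \<dots> \<le> (1/2) * (norm (T0 a - a) + norm (T0 (adj a) - adj a))"
        using norm_triangle_ineq[of "T0 a - a" "adj (T0 (adj a) - adj a)"] by (simp add: norm_adj)
      also have "\<dots> \<le> (1/2) * (m0 * \<delta> * norm a + m0 * \<delta> * norm a)"
        using T0_near[OF a] T0_near[OF DD(8)[OF a]] unfolding norm_adj
        by (intro mult_left_mono add_mono) auto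
      finally show ?thesis by (simp add: mult_ac)
    qed
    \<comment> \<open>Averaging on both sides keeps the map compatible with the adjoint, and the
      values stay in F because D0 is contained in F.\<close>
    define T where "T a = (\<Sum>c\<in>S0. \<Sum>e\<in>S0. c * T1 (adj c * a * e) * adj e)" for a
    have inD: "adj c * a * e \<in> D" if "a \<in> D" "c \<in> S0" "e \<in> S0" for a c e
      using that DD(5,8) S0D(2) by metis
    have lin: "clinear_on D T"
      unfolding clinear_on_def
    proof (intro conjI ballI allI)
      fix a b assume ab: "a \<in> D" "b \<in> D"
      have "T1 (adj c * (a + b) * e) = T1 (adj c * a * e) + T1 (adj c * b * e)" if "c \<in> S0" "e \<in> S0" for c e
        using lin1 inD[OF ab(1) that] inD[OF ab(2) that]
        by (simp add: clinear_on_def distrib_left distrib_right)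
      then have "c * T1 (adj c * (a + b) * e) * adj e = c * T1 (adj c * a * e) * adj e + c * T1 (adj c * b * e) * adj e"
        if "c \<in> S0" "e \<in> S0" for c e
        using that by (simp add: distrib_left distrib_right)
      then show "T (a + b) = T a + T b" by (simp add: T_def sum.distrib)
    next
      fix a c assume a: "a \<in> D"
      have "T1 (adj c' * (c *\<^sub>C a) * e) = c *\<^sub>C T1 (adj c' * a * e)" if "c' \<in> S0" "e \<in> S0" for c' e
        using lin1 inD[OF a that] by (simp add: clinear_on_def mult_scaleC_right mult_scaleC_left)
      then show "T (c *\<^sub>C a) = c *\<^sub>C T a"
        by (simp add: T_def mult_scaleC_right mult_scaleC_left cvs.scale_sum_right)
    qed
    have "T a \<in> F" for a
      unfolding T_def using S0D D0F T1F by (intro FF(9) FF(5) FF(8)) auto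
    moreover have "T (adj a) = adj (T a)" for a
    proof -
      have "adj (T a) = (\<Sum>c\<in>S0. \<Sum>e\<in>S0. e * T1 (adj e * adj a * c) * adj c)"
        by (simp add: T_def adj_sum adj_mult adj_adj mult.assoc flip: T1_adj)
      also have "\<dots> = T (adj a)" unfolding T_def by (rule sum.swap)
      finally show ?thesis by simp
    qed
    moreover have "norm (T a - a) \<le> N * m0 * \<delta> * norm a" if a: "a \<in> D" for a
    proof -
      \<comment> \<open>The diagonal of D0 sums to 1, so the same average fixes a, and only the
        difference between T1 and the inclusion is averaged.\<close>
      have "(\<Sum>c\<in>S0. c * adj c) * a * (\<Sum>e\<in>S0. e * adj e) = a" using CC0(8) by simp
      then have "a = (\<Sum>c\<in>S0. \<Sum>e\<in>S0. c * (adj c * a * e) * adj e)"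
        by (subst sum.swap) (simp add: sum_distrib_left sum_distrib_right mult.assoc)
      then have "T a - a = T a - (\<Sum>c\<in>S0. \<Sum>e\<in>S0. c * (adj c * a * e) * adj e)" by simp
      also have "\<dots> = (\<Sum>c\<in>S0. \<Sum>e\<in>S0. c * (T1 (adj c * a * e) - adj c * a * e) * adj e)"
        by (simp add: T_def sum_subtractf right_diff_distrib left_diff_distrib)
      also have "norm \<dots> \<le> (\<Sum>c\<in>S0. \<Sum>e\<in>S0. norm c * (norm c * norm e) * norm e * (m0 * \<delta> * norm a))"
      proof (intro sum_norm_le)
        fix c e assume ce: "c \<in> S0" "e \<in> S0"
        have "norm (c * (T1 (adj c * a * e) - adj c * a * e) * adj e)
            \<le> norm c * norm (T1 (adj c * a * e) - adj c * a * e) * norm e"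
          using norm_mult3[of c _ "adj e"] by (simp add: norm_adj)
        also have "\<dots> \<le> norm c * (m0 * \<delta> * norm (adj c * a * e)) * norm e"
          using T1_near[OF inD[OF a ce]] by (intro mult_right_mono mult_left_mono) auto
        also have "\<dots> \<le> norm c * (m0 * \<delta> * (norm c * norm a * norm e)) * norm e"
          using norm_mult3[of "adj c" a e] m0 \<delta>
          by (intro mult_right_mono mult_left_mono) (auto simp: norm_adj)
        finally show "norm (c * (T1 (adj c * a * e) - adj c * a * e) * adj e)
            \<le> norm c * (norm c * norm e) * norm e * (m0 * \<delta> * norm a)"
          by (simp add: mult_ac)
      qed
      also have "\<dots> = N * m0 * \<delta> * norm a"
        by (simp add: N_def sum_distrib_right mult.assoc)
      finally show ?thesis .
    qed
    moreover have "T (d * a) = d * T a" if d: "d \<in> D0" and a: "a \<in> D" for d a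
    proof -
      \<comment> \<open>With a fixed, the sum over e is a linear map of the left factor alone, to
        which the commutation rule for the diagonal of D0 applies.\<close>
      define G where "G b = (\<Sum>e\<in>S0. T1 (b * a * e) * adj e)" for b
      have Gl: "clinear_on D0 G"
        unfolding clinear_on_def
      proof (intro conjI ballI allI)
        fix b b' assume b: "b \<in> D0" "b' \<in> D0"
        have "T1 ((b + b') * a * e) = T1 (b * a * e) + T1 (b' * a * e)" if "e \<in> S0" for e
          using lin1 b sub a S0D(2)[OF that] DD(5) by (auto simp: clinear_on_def distrib_right subset_iff)
        then show "G (b + b') = G b + G b'" by (simp add: G_def sum.distrib distrib_right)
      next
        fix b c assume b: "b \<in> D0"
        have "T1 ((c *\<^sub>C b) * a * e) = c *\<^sub>C T1 (b * a * e)" if "e \<in> S0" for e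
          using lin1 b sub a S0D(2)[OF that] DD(5) by (auto simp: clinear_on_def mult_scaleC_left subset_iff)
        then show "G (c *\<^sub>C b) = c *\<^sub>C G b" by (simp add: G_def mult_scaleC_left cvs.scale_sum_right)
      qed
      have TG: "T b = (\<Sum>c\<in>S0. c * G (adj c))" if "b = a" for b
        using that by (simp add: T_def G_def sum_distrib_left mult.assoc)
      have "T (d * a) = (\<Sum>c\<in>S0. c * G (adj c * d))"
        by (simp add: T_def G_def sum_distrib_left mult.assoc)
      then show ?thesis
        using casimir_basis_commute(1)[OF fd_star_subalgebraD[OF D0] C0 d Gl] TG by simp
    qed
    ultimately show "\<exists>T. clinear_on D T \<and>
        (\<forall>a\<in>D. T a \<in> F \<and> T (adj a) = adj (T a) \<and> norm (T a - a) \<le> N * m0 * \<delta> * norm a)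
        \<and> (\<forall>d\<in>D0. \<forall>a\<in>D. T (d * a) = d * T a)"
      using lin by (intro exI[of _ T]) auto
  qed
qed

text \<open>One Newton step: \<open>p + [k, p]\<close> is the derivative at \<open>0\<close> of \<open>e\<^sup>t\<^sup>k p e\<^sup>-\<^sup>t\<^sup>k\<close>, and it
  approximates \<open>F\<close> to second order.\<close>

lemma newton_step:
  fixes D D0 :: "'a :: star_banach set"
  assumes D: "star_subalgebra D" and D0: "fd_star_subalgebra D0" and sub: "D0 \<subseteq> D"
    and C: "casimir_basis D S \<phi> K"
  obtains M where "1 \<le> M"
    "\<And>F \<delta>. star_subalgebra F \<Longrightarrow> D0 \<subseteq> F \<Longrightarrow> 0 < \<delta> \<Longrightarrow> \<delta> \<le> 1 \<Longrightarrow> (\<forall>p\<in>S. \<exists>f\<in>F. norm (f - p) \<le> \<delta>) \<Longrightarrow>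
      \<exists>k. adj k = - k \<and> (\<forall>d\<in>D0. k * d = d * k) \<and> norm k \<le> M * \<delta> \<and>
        (\<forall>p\<in>S. \<exists>f\<in>F. norm (f - (p + k * p - p * k)) \<le> M * \<delta>\<^sup>2)"
proof -
  note DD = star_subalgebraD[OF D] and CC = casimir_basisD[OF C]
  have SD: "p \<in> D" if "p \<in> S" for p using that CC(2) by auto
  obtain m where m: "0 \<le> m" and bimod: "\<And>F \<delta>. star_subalgebra F \<Longrightarrow> D0 \<subseteq> F \<Longrightarrow> 0 < \<delta> \<Longrightarrow>
      (\<forall>p\<in>S. \<exists>f\<in>F. norm (f - p) \<le> \<delta>) \<Longrightarrow>
      \<exists>T. clinear_on D T \<and> (\<forall>a\<in>D. T a \<in> F \<and> T (adj a) = adj (T a) \<and> norm (T a - a) \<le> m * \<delta> * norm a)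
        \<and> (\<forall>d\<in>D0. \<forall>a\<in>D. T (d * a) = d * T a)"
    using near_inclusion_bimodule_map[OF D D0 sub C] by blast
  define s1 where "s1 = (\<Sum>p\<in>S. norm p)"
  define s2 where "s2 = (\<Sum>p\<in>S. norm p * norm p)"
  have s: "0 \<le> s1" "0 \<le> s2" by (auto simp: s1_def s2_def intro!: sum_nonneg)
  have ps1: "norm p \<le> s1" if "p \<in> S" for p
    unfolding s1_def using that CC(1) by (intro member_le_sum) auto
  define c where "c = m * m * s2"
  have c: "0 \<le> c" using m s by (simp add: c_def)
  \<comment> \<open>The summand \<open>m * s2\<close> bounds the norm of k. In the factor of s1, the
    first c bounds R, \<open>c * (1 + m)\<close> the products of \<open>R 1\<close> with
    \<open>T a\<close>, and \<open>2 * c\<close> those of \<open>x + adj x\<close> with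
    \<open>\<alpha> a\<close>, the last two after the factor 1/2.\<close>
  define M where "M = 1 + m * s2 + (c + (c * (1 + m) + 2 * c)) * s1"
  show thesis
  proof (rule that[of M])
    show "1 \<le> M" using m s c by (simp add: M_def)
    fix F \<delta> assume F: "star_subalgebra F" and D0F: "D0 \<subseteq> F" and \<delta>: "0 < (\<delta> :: real)" "\<delta> \<le> 1"
      and near: "\<forall>p\<in>S. \<exists>f\<in>F. norm (f - p) \<le> \<delta>"
    note FF = star_subalgebraD[OF F]
    obtain T where lin: "clinear_on D T" and T: "\<And>a. a \<in> D \<Longrightarrow> T a \<in> F"
        "\<And>a. a \<in> D \<Longrightarrow> T (adj a) = adj (T a)" "\<And>a. a \<in> D \<Longrightarrow> norm (T a - a) \<le> m * \<delta> * norm a"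
        "\<And>d a. d \<in> D0 \<Longrightarrow> a \<in> D \<Longrightarrow> T (d * a) = d * T a"
      using bimod[OF F D0F \<delta>(1) near] by blast
    define \<alpha> where "\<alpha> a = T a - a" for a
    have T\<alpha>: "T a = a + \<alpha> a" for a by (simp add: \<alpha>_def)
    have lin\<alpha>: "clinear_on D \<alpha>"
      using lin by (auto simp: clinear_on_def \<alpha>_def cvs.scale_right_diff_distrib)
    have \<alpha>_adj: "\<alpha> (adj a) = adj (\<alpha> a)" if "a \<in> D" for a
      using T(2)[OF that] by (simp add: \<alpha>_def adj_diff)
    have \<alpha>_bd: "norm (\<alpha> a) \<le> m * \<delta> * norm a" if "a \<in> D" for a
      using T(3)[OF that] by (simp add: \<alpha>_def)
    have \<alpha>_mod: "\<alpha> (d * a) = d * \<alpha> a" if "d \<in> D0" "a \<in> D" for d a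
      using T(4)[OF that] by (simp add: \<alpha>_def right_diff_distrib)
    \<comment> \<open>The defect \<alpha>, paired with the diagonal of D. It commutes with D0 since
      \<alpha> is D0-linear.\<close>
    define x where "x = (\<Sum>p\<in>S. \<alpha> p * adj p)"
    have x_adj: "adj x = (\<Sum>p\<in>S. p * \<alpha> (adj p))"
      unfolding x_def adj_sum adj_mult adj_adj using \<alpha>_adj SD by simp
    have x_comm: "x * d = d * x" if d: "d \<in> D0" for d
    proof -
      have "x * d = (\<Sum>p\<in>S. \<alpha> (d * p) * adj p)"
        unfolding x_def using casimir_basis_commute(2)[OF D C _ lin\<alpha>] d sub by auto
      also have "\<dots> = d * x"
        unfolding x_def sum_distrib_left using \<alpha>_mod[OF d] SD by (simp add: mult.assoc)
      finally show ?thesis .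
    qed
    have xa_comm: "adj x * d = d * adj x" if d: "d \<in> D0" for d
    proof -
      have "adj (x * adj d) = adj (adj d * x)"
        using x_comm[of "adj d"] d star_subalgebraD(8)[OF fd_star_subalgebraD[OF D0]] by simp
      then show ?thesis by (simp add: adj_mult adj_adj)
    qed
    have x_bd: "norm x \<le> m * \<delta> * s2"
    proof -
      have "norm x \<le> (\<Sum>p\<in>S. m * \<delta> * (norm p * norm p))"
        unfolding x_def
      proof (intro sum_norm_le)
        fix p assume p: "p \<in> S"
        have "norm (\<alpha> p * adj p) \<le> norm (\<alpha> p) * norm p"
          using norm_mult_ineq[of "\<alpha> p" "adj p"] by (simp add: norm_adj)
        also have "\<dots> \<le> m * \<delta> * norm p * norm p"
          using \<alpha>_bd[OF SD[OF p]] by (intro mult_right_mono) auto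
        finally show "norm (\<alpha> p * adj p) \<le> m * \<delta> * (norm p * norm p)" by (simp add: mult.assoc)
      qed
      then show ?thesis by (simp add: s2_def sum_distrib_left)
    qed
    define R where "R a = (\<Sum>p\<in>S. \<alpha> p * \<alpha> (adj p * a))" for a
    have R_bd: "norm (R a) \<le> c * \<delta>\<^sup>2 * norm a" if a: "a \<in> D" for a
    proof -
      have "norm (R a) \<le> (\<Sum>p\<in>S. m * m * \<delta>\<^sup>2 * norm a * (norm p * norm p))"
        unfolding R_def
      proof (intro sum_norm_le)
        fix p assume p: "p \<in> S"
        have "norm (\<alpha> p * \<alpha> (adj p * a)) \<le> norm (\<alpha> p) * norm (\<alpha> (adj p * a))"
          by (rule norm_mult_ineq)
        also have "\<dots> \<le> (m * \<delta> * norm p) * (m * \<delta> * norm (adj p * a))"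
          using \<alpha>_bd[OF SD[OF p]] \<alpha>_bd[of "adj p * a"] SD[OF p] a DD(5,8) m \<delta>
          by (intro mult_mono) auto
        also have "\<dots> \<le> (m * \<delta> * norm p) * (m * \<delta> * (norm p * norm a))"
          using norm_mult_ineq[of "adj p" a] m \<delta> by (intro mult_left_mono) (auto simp: norm_adj)
        finally show "norm (\<alpha> p * \<alpha> (adj p * a)) \<le> m * m * \<delta>\<^sup>2 * norm a * (norm p * norm p)"
          by (simp add: power2_eq_square mult_ac)
      qed
      also have "\<dots> = c * \<delta>\<^sup>2 * norm a"
        unfolding sum_distrib_left[symmetric] by (simp add: c_def s2_def mult_ac)
      finally show ?thesis .
    qed
    \<comment> \<open>For multiplicative T this would be T again. In general the averaged product
      replaces the first-order error \<open>\<alpha> a\<close> by \<open>x * a + a * adj x\<close>,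
      in which \<alpha> no longer acts on a, and leaves the quadratic remainder R.\<close>
    define T' where "T' a = (\<Sum>p\<in>S. T p * T (adj p * a))" for a
    have T'F: "T' a \<in> F" if "a \<in> D" for a
      unfolding T'_def using that SD DD(5,8) by (intro FF(9) FF(5) T(1)) auto
    have T'_eq: "T' a = a + x * a + a * adj x + R a" if a: "a \<in> D" for a
    proof -
      have "T' a = (\<Sum>p\<in>S. p * adj p * a + \<alpha> p * adj p * a + p * \<alpha> (adj p * a) + \<alpha> p * \<alpha> (adj p * a))"
        unfolding T'_def T\<alpha> by (intro sum.cong refl) (simp add: algebra_simps)
      also have "\<dots> = (\<Sum>p\<in>S. p * adj p) * a + x * a + (\<Sum>p\<in>S. p * \<alpha> (adj p * a)) + R a"
        by (simp add: sum.distrib x_def R_def sum_distrib_right)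
      also have "\<dots> = a + x * a + a * adj x + R a"
        unfolding CC(8) x_adj casimir_basis_commute(1)[OF D C a lin\<alpha>] by simp
      finally show ?thesis .
    qed
    define h where "h = T' 1 - 1"
    have hF: "h \<in> F" unfolding h_def using T'F DD(2) FF by blast
    have h_eq: "h = x + adj x + R 1" unfolding h_def using T'_eq[OF DD(2)] by simp
    \<comment> \<open>Half the anticommutator of a with \<open>x + adj x\<close> is the part of
      \<open>x * a + a * adj x\<close> that is not a commutator, and h equals
      \<open>x + adj x\<close> to first order. Subtracting it with \<open>T a\<close> in place of a
      stays inside F and leaves a plus the commutator with k, up to second order.\<close>
    define Y where "Y a = T' a - (1/2) *\<^sub>R (h * T a + T a * h)" for a
    have YF: "Y a \<in> F" if "a \<in> D" for a
      unfolding Y_def using that T'F hF T(1) by (intro FF(4) FF(7) FF(3) FF(5)) auto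
    define k where "k = (1/2) *\<^sub>R (x - adj x)"
    have k_adj: "adj k = - k"
      by (simp add: k_def adj_scaleR adj_diff adj_adj flip: scaleR_minus_right)
    have k_comm: "k * d = d * k" if "d \<in> D0" for d
      using x_comm[OF that] xa_comm[OF that] by (simp add: k_def algebra_simps)
    have k_bd: "norm k \<le> m * \<delta> * s2"
    proof -
      have "norm k \<le> (1/2) * (norm x + norm (adj x))"
        unfolding k_def using norm_triangle_ineq4[of x "adj x"] by simp
      then show ?thesis using x_bd by (simp add: norm_adj)
    qed
    have half: "(1/2) *\<^sub>R (y + y) = y" for y :: 'a by (simp flip: scaleR_2)
    have Y_eq: "Y a - (a + k * a - a * k) =
      R a - (1/2) *\<^sub>R (R 1 * T a + T a * R 1 + (x + adj x) * \<alpha> a + \<alpha> a * (x + adj x))" if a: "a \<in> D" for a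
    proof -
      have e: "x * a + a * adj x = (1/2) *\<^sub>R (x * a + x * a + a * adj x + a * adj x)"
        using half[of "x * a"] half[of "a * adj x"] by (simp add: scaleR_add_right)
      have "Y a - (a + k * a - a * k) = (x * a + a * adj x) + R a
          - (1/2) *\<^sub>R ((x + adj x + R 1) * (a + \<alpha> a) + (a + \<alpha> a) * (x + adj x + R 1))
          - (1/2) *\<^sub>R ((x - adj x) * a - a * (x - adj x))"
        unfolding Y_def T'_eq[OF a] h_eq k_def T\<alpha>
        by (simp add: algebra_simps)
      also have "\<dots> = R a - (1/2) *\<^sub>R (R 1 * T a + T a * R 1 + (x + adj x) * \<alpha> a + \<alpha> a * (x + adj x))"
        unfolding e T\<alpha> by (simp add: algebra_simps)
      finally show ?thesis .
    qed
    have "norm (Y a - (a + k * a - a * k)) \<le> (c + (c * (1 + m) + 2 * c)) * \<delta>\<^sup>2 * norm a" if a: "a \<in> D" for a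
    proof -
      have R1: "norm (R 1) \<le> c * \<delta>\<^sup>2" using R_bd[OF DD(2)] by simp
      have Ta: "norm (T a) \<le> (1 + m) * norm a"
      proof -
        have "norm (T a) \<le> norm a + norm (\<alpha> a)" unfolding T\<alpha> by (rule norm_triangle_ineq)
        also have "\<dots> \<le> norm a + m * \<delta> * norm a" using \<alpha>_bd[OF a] by simp
        also have "\<dots> \<le> norm a + m * norm a"
          using m \<delta> by (intro add_left_mono mult_right_mono) (auto simp: mult_left_le)
        finally show ?thesis by (simp add: distrib_right)
      qed
      have t1: "norm (R 1 * T a) \<le> c * \<delta>\<^sup>2 * ((1 + m) * norm a)"
        by (rule order_trans[OF norm_mult_ineq]) (intro mult_mono R1 Ta; use c in simp)
      have t2: "norm (T a * R 1) \<le> c * \<delta>\<^sup>2 * ((1 + m) * norm a)"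
        by (rule order_trans[OF norm_mult_ineq], subst mult.commute) (intro mult_mono R1 Ta; use c in simp)
      have xx: "norm (x + adj x) \<le> 2 * (m * \<delta> * s2)"
        using norm_triangle_ineq[of x "adj x"] x_bd by (simp add: norm_adj)
      have xa: "2 * (m * \<delta> * s2) * (m * \<delta> * norm a) = 2 * c * \<delta>\<^sup>2 * norm a"
        by (simp add: c_def power2_eq_square mult_ac)
      have t3: "norm ((x + adj x) * \<alpha> a) \<le> 2 * (m * \<delta> * s2) * (m * \<delta> * norm a)"
        by (rule order_trans[OF norm_mult_ineq]) (intro mult_mono xx \<alpha>_bd[OF a]; use m s \<delta> in simp)
      have t4: "norm (\<alpha> a * (x + adj x)) \<le> 2 * (m * \<delta> * s2) * (m * \<delta> * norm a)"
        by (rule order_trans[OF norm_mult_ineq], subst mult.commute)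
           (intro mult_mono xx \<alpha>_bd[OF a]; use m s \<delta> in simp)
      have "norm (R 1 * T a + T a * R 1 + (x + adj x) * \<alpha> a + \<alpha> a * (x + adj x))
          \<le> c * \<delta>\<^sup>2 * ((1 + m) * norm a) + c * \<delta>\<^sup>2 * ((1 + m) * norm a)
             + 2 * c * \<delta>\<^sup>2 * norm a + 2 * c * \<delta>\<^sup>2 * norm a"
        using t1 t2 t3 t4 unfolding xa by (intro norm_add_rule_thm) auto
      then have "norm ((1/2) *\<^sub>R (R 1 * T a + T a * R 1 + (x + adj x) * \<alpha> a + \<alpha> a * (x + adj x)))
          \<le> c * \<delta>\<^sup>2 * ((1 + m) * norm a) + 2 * c * \<delta>\<^sup>2 * norm a"
        unfolding norm_scaleR by (simp add: algebra_simps)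
      then have "norm (Y a - (a + k * a - a * k)) \<le> c * \<delta>\<^sup>2 * norm a + (c * \<delta>\<^sup>2 * ((1 + m) * norm a) + 2 * c * \<delta>\<^sup>2 * norm a)"
        unfolding Y_eq[OF a] using R_bd[OF a] norm_triangle_ineq4 add_mono order_trans by blast
      then show ?thesis by (simp add: algebra_simps)
    qed
    then have "norm (Y p - (p + k * p - p * k)) \<le> M * \<delta>\<^sup>2" if p: "p \<in> S" for p
    proof -
      assume *: "\<And>a. a \<in> D \<Longrightarrow> norm (Y a - (a + k * a - a * k)) \<le> (c + (c * (1 + m) + 2 * c)) * \<delta>\<^sup>2 * norm a"
      have "norm (Y p - (p + k * p - p * k)) \<le> (c + (c * (1 + m) + 2 * c)) * \<delta>\<^sup>2 * norm p"
        using *[OF SD[OF p]] .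
      also have "\<dots> \<le> (c + (c * (1 + m) + 2 * c)) * \<delta>\<^sup>2 * s1"
        using ps1[OF p] c m by (intro mult_left_mono) auto
      also have "\<dots> = ((c + (c * (1 + m) + 2 * c)) * s1) * \<delta>\<^sup>2" by simp
      also have "\<dots> \<le> M * \<delta>\<^sup>2"
        using m s by (intro mult_right_mono) (auto simp: M_def)
      finally show ?thesis .
    qed
    moreover have "norm k \<le> M * \<delta>"
    proof -
      have "norm k \<le> (m * s2) * \<delta>" using k_bd by (simp add: mult_ac)
      also have "\<dots> \<le> M * \<delta>"
        using \<delta> s c m by (intro mult_right_mono) (auto simp: M_def)
      finally show ?thesis .
    qed
    ultimately show "\<exists>k. adj k = - k \<and> (\<forall>d\<in>D0. k * d = d * k) \<and> norm k \<le> M * \<delta> \<and>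
        (\<forall>p\<in>S. \<exists>f\<in>F. norm (f - (p + k * p - p * k)) \<le> M * \<delta>\<^sup>2)"
      using k_adj k_comm YF SD by (intro exI[of _ k]) blast
  qed
qed

section \<open>Exponentials, unitaries and conjugation\<close>

lemma norm_exp_remainder:
  fixes x :: "'a :: {real_normed_algebra_1, banach}"
  assumes "norm x \<le> 1"
  shows "norm (exp x - 1 - x) \<le> (norm x)\<^sup>2"
proof -
  have sm: "summable (\<lambda>n. inverse (fact (n + 2)) * norm x ^ (n + 2))"
    using summable_exp[of "norm x", THEN summable_ignore_initial_segment, of 2] .
  have le: "norm (inverse (fact (n + 2)) *\<^sub>R x ^ (n + 2)) \<le> inverse (fact (n + 2)) * norm x ^ (n + 2)" for n
    using norm_power_ineq[of x "n + 2"] by (simp add: mult_left_mono)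
  have "norm (exp x - 1 - x) = norm (\<Sum>n. inverse (fact (n + 2)) *\<^sub>R x ^ (n + 2))"
    by (subst exp_first_two_terms) simp
  also have "\<dots> \<le> (\<Sum>n. inverse (fact (n + 2)) * norm x ^ (n + 2))"
    by (rule norm_suminf_le[OF le sm])
  also have "\<dots> = exp (norm x) - 1 - norm x"
    by (subst exp_first_two_terms[of "norm x"]) simp
  also have "\<dots> \<le> (norm x)\<^sup>2"
    using exp_bound[of "norm x"] assms by simp
  finally show ?thesis .
qed

lemma adj_exp: "adj (exp x :: 'a :: star_banach) = exp (adj x)"
proof -
  have pow: "adj (x ^ n) = adj x ^ n" for n
    by (induction n) (auto simp: adj_mult power_commutes)
  have "adj (exp x) = (\<Sum>n. adj (x ^ n /\<^sub>R fact n))"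
    unfolding exp_def by (rule bounded_linear.suminf[OF bounded_linear_adj summable_exp_generic])
  also have "\<dots> = exp (adj x)"
    by (simp add: exp_def adj_scaleR pow)
  finally show ?thesis .
qed

lemma exp_commutes:
  fixes k d :: "'a :: {real_normed_algebra_1, banach}"
  assumes "k * d = d * k"
  shows "exp k * d = d * exp k"
proof -
  have pow: "k ^ n * d = d * k ^ n" for n
    using power_commuting_commutes[OF assms] by simp
  have "exp k * d = (\<Sum>n. k ^ n /\<^sub>R fact n * d)"
    unfolding exp_def by (rule suminf_mult2[OF summable_exp_generic])
  also have "\<dots> = (\<Sum>n. d * (k ^ n /\<^sub>R fact n))" by (simp add: pow)
  also have "\<dots> = d * exp k"
    unfolding exp_def by (rule suminf_mult[OF summable_exp_generic])
  finally show ?thesis .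
qed

definition is_unitary :: "'a :: star_banach \<Rightarrow> bool" where
  "is_unitary u \<longleftrightarrow> adj u * u = 1 \<and> u * adj u = 1"

lemma is_unitary_one: "is_unitary 1"
  by (simp add: is_unitary_def)

lemma is_unitary_adj: "is_unitary u \<Longrightarrow> is_unitary (adj u)"
  by (simp add: is_unitary_def adj_adj)

lemma is_unitary_mult: "is_unitary u \<Longrightarrow> is_unitary v \<Longrightarrow> is_unitary (u * v)"
  unfolding is_unitary_def adj_mult by (metis mult.assoc mult.left_neutral)

lemma is_unitary_exp: "adj k = - k \<Longrightarrow> is_unitary (exp k)"
  unfolding is_unitary_def adj_exp by (simp add: exp_minus_inverse) (metis exp_minus_inverse add.inverse_inverse)

lemma unitary_cancel:
  assumes "is_unitary u"
  shows "adj u * (u * x) = x" "u * (adj u * x) = x"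
  using assms unfolding is_unitary_def by (metis mult.assoc mult.left_neutral)+

text \<open>Without the C*-identity a unitary need not have norm 1; closeness to 1 supplies the
  bound used in the estimates.\<close>

lemma norm_unitary_le:
  fixes u :: "'a :: star_banach"
  assumes "norm (u - 1) \<le> 1"
  shows "norm u \<le> 2"
  using norm_triangle_ineq[of "u - 1" 1] assms by simp

text \<open>Split off \<open>u - 1\<close> and \<open>adj u - 1\<close> one at a time. As u and
  \<open>adj u\<close> have norm at most 2, the constants are 4 = 2 * 2 and 3 = 2 + 1.\<close>

lemma unitary_conj_near:
  fixes u :: "'a :: star_banach"
  assumes u: "is_unitary u" and t: "norm (u - 1) \<le> t" "t \<le> 1"
  shows "norm (u * y * adj u - x) \<le> 4 * norm (y - x) + 3 * t * norm x"
proof -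
  have u2: "norm u \<le> 2" by (rule norm_unitary_le) (use t in linarith)
  have ua: "norm (adj u - 1) \<le> t" using t(1) norm_adj[of "u - 1"] by (simp add: adj_diff)
  have t0: "0 \<le> t" using t(1) norm_ge_zero order_trans by blast
  have "u * y * adj u - x = u * (y - x) * adj u + (u - 1) * x * adj u + x * (adj u - 1)"
    by (simp add: algebra_simps)
  also have "norm \<dots> \<le> norm (u * (y - x) * adj u) + norm ((u - 1) * x * adj u) + norm (x * (adj u - 1))"
    by (intro norm_add_rule_thm order_refl)
  also have "\<dots> \<le> 2 * norm (y - x) * 2 + t * norm x * 2 + norm x * t"
  proof (intro add_mono)
    show "norm (u * (y - x) * adj u) \<le> 2 * norm (y - x) * 2"
      by (rule order_trans[OF norm_mult3]) (intro mult_mono; use u2 norm_adj[of u] in simp)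
    show "norm ((u - 1) * x * adj u) \<le> t * norm x * 2"
      by (rule order_trans[OF norm_mult3]) (intro mult_mono; use u2 t t0 norm_adj[of u] in simp)
    show "norm (x * (adj u - 1)) \<le> norm x * t"
      by (rule order_trans[OF norm_mult_ineq]) (intro mult_left_mono ua norm_ge_zero)
  qed
  finally show ?thesis by (simp add: algebra_simps)
qed

lemma star_subalgebra_conj:
  assumes u: "is_unitary u" and F: "star_subalgebra F"
  shows "star_subalgebra ((\<lambda>x. u * x * adj u) ` F)"
  unfolding star_subalgebra_def
proof (intro conjI ballI)
  note FF = star_subalgebraD[OF F]
  show "cvs.subspace ((\<lambda>x. u * x * adj u) ` F)"
    unfolding cvs.subspace_def
  proof (intro conjI ballI allI)
    show "0 \<in> (\<lambda>x. u * x * adj u) ` F" using FF(1) by (auto intro!: image_eqI[of _ _ 0])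
  next
    fix x y assume "x \<in> (\<lambda>x. u * x * adj u) ` F" "y \<in> (\<lambda>x. u * x * adj u) ` F"
    then obtain a b where "a \<in> F" "b \<in> F" "x = u * a * adj u" "y = u * b * adj u" by auto
    then show "x + y \<in> (\<lambda>x. u * x * adj u) ` F"
      using FF(3) by (intro image_eqI[of _ _ "a + b"]) (auto simp: algebra_simps)
  next
    fix c x assume "x \<in> (\<lambda>x. u * x * adj u) ` F"
    then obtain a where "a \<in> F" "x = u * a * adj u" by auto
    then show "c *\<^sub>C x \<in> (\<lambda>x. u * x * adj u) ` F"
      using FF(6) by (intro image_eqI[of _ _ "c *\<^sub>C a"]) (auto simp: star_simps)
  qed
  show "1 \<in> (\<lambda>x. u * x * adj u) ` F"
    using FF(2) u by (intro image_eqI[of _ _ 1]) (auto simp: is_unitary_def)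
next
  note FF = star_subalgebraD[OF F]
  fix x y assume "x \<in> (\<lambda>x. u * x * adj u) ` F" "y \<in> (\<lambda>x. u * x * adj u) ` F"
  then obtain a b where "a \<in> F" "b \<in> F" "x = u * a * adj u" "y = u * b * adj u" by auto
  then show "x * y \<in> (\<lambda>x. u * x * adj u) ` F"
    using FF(5) unitary_cancel[OF u] by (intro image_eqI[of _ _ "a * b"]) (auto simp: mult.assoc)
next
  note FF = star_subalgebraD[OF F]
  fix x assume "x \<in> (\<lambda>x. u * x * adj u) ` F"
  then obtain a where "a \<in> F" "x = u * a * adj u" by auto
  then show "adj x \<in> (\<lambda>x. u * x * adj u) ` F"
    using FF(8) by (intro image_eqI[of _ _ "adj a"]) (auto simp: star_simps mult.assoc)
qed

lemma fd_star_subalgebra_conj: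
  assumes u: "is_unitary u" and F: "fd_star_subalgebra F"
  shows "fd_star_subalgebra ((\<lambda>x. u * x * adj u) ` F)"
proof -
  obtain B where B: "finite B" "F = cvs.span B" using F by (auto simp: fd_star_subalgebra_def)
  have "Modules.module_hom scaleC scaleC (\<lambda>x. u * x * adj u)"
    by unfold_locales (auto simp: algebra_simps star_simps scaleC_add_right scaleC_add_left scaleC_scaleC scaleC_one)
  then have "(\<lambda>x. u * x * adj u) ` F = cvs.span ((\<lambda>x. u * x * adj u) ` B)"
    unfolding B(2) by (rule Modules.module_hom.span_image[symmetric])
  then show ?thesis
    using star_subalgebra_conj[OF u fd_star_subalgebraD[OF F]] B(1) by (auto simp: fd_star_subalgebra_def)
qed

text \<open>The scalars serve as D0 when nothing has to be kept fixed, and as a least member of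
  directed families.\<close>

lemma fd_star_subalgebra_scalars: "fd_star_subalgebra (cvs.span {1 :: 'a :: star_banach})"
proof -
  have r: "cvs.span {1 :: 'a} = range (\<lambda>c. c *\<^sub>C 1)" by (rule cvs.span_singleton)
  have "star_subalgebra (cvs.span {1 :: 'a})"
    unfolding star_subalgebra_def
  proof (intro conjI ballI)
    show "x * y \<in> cvs.span {1}" if "x \<in> cvs.span {1}" "y \<in> cvs.span {1}" for x y :: 'a
      using that unfolding r by (auto simp: star_simps scaleC_scaleC)
    show "adj x \<in> cvs.span {1}" if "x \<in> cvs.span {1}" for x :: 'a
      using that unfolding r by (auto simp: star_simps)
  qed (auto intro: cvs.span_base)
  then show ?thesis unfolding fd_star_subalgebra_def by blast
qed

lemma scalars_subset: "star_subalgebra F \<Longrightarrow> cvs.span {1} \<subseteq> F"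
  by (rule cvs.span_minimal) (auto simp: star_subalgebra_def)

section \<open>Limits of unitaries and the Newton iteration\<close>

lemma convergent_if_geometric:
  fixes w :: "nat \<Rightarrow> 'a :: banach"
  assumes "\<And>n. norm (w (Suc n) - w n) \<le> c * (1/2) ^ n"
  obtains l where "w \<longlonglongrightarrow> l"
proof -
  have "summable (\<lambda>n. w (Suc n) - w n)"
    by (rule summable_comparison_test'[where N=0 and g="\<lambda>n. c * (1/2) ^ n"])
       (auto intro!: assms summable_mult summable_geometric)
  then have "convergent (\<lambda>n. \<Sum>i<n. w (Suc i) - w i)"
    by (simp add: summable_iff_convergent)
  then obtain s where "(\<lambda>n. \<Sum>i<n. w (Suc i) - w i) \<longlonglongrightarrow> s"
    by (auto simp: convergent_def)
  then have "(\<lambda>n. (\<Sum>i<n. w (Suc i) - w i) + w 0) \<longlonglongrightarrow> s + w 0"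
    by (intro tendsto_add tendsto_const)
  then have "w \<longlonglongrightarrow> s + w 0" by (simp add: sum_lessThan_telescope)
  then show thesis by (rule that)
qed

lemma unitary_limit:
  assumes lim: "w \<longlonglongrightarrow> u" and w: "\<And>n. is_unitary (w n)"
  shows "is_unitary u"
proof -
  have a: "(\<lambda>n. adj (w n)) \<longlonglongrightarrow> adj u"
    using lim by (rule bounded_linear.tendsto[OF bounded_linear_adj])
  have "(\<lambda>n. adj (w n) * w n) \<longlonglongrightarrow> adj u * u" "(\<lambda>n. w n * adj (w n)) \<longlonglongrightarrow> u * adj u"
    using lim a by (auto intro: tendsto_mult)
  then show ?thesis
    using w by (auto simp: is_unitary_def LIMSEQ_const_iff)
qed

lemma commutes_limit:
  fixes w :: "nat \<Rightarrow> 'a :: real_normed_algebra"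
  assumes lim: "w \<longlonglongrightarrow> u" and w: "\<And>n. w n * d = d * w n"
  shows "u * d = d * u"
proof -
  have "(\<lambda>n. w n * d) \<longlonglongrightarrow> u * d" "(\<lambda>n. d * w n) \<longlonglongrightarrow> d * u"
    using lim by (auto intro: tendsto_mult_left tendsto_mult_right)
  then show ?thesis using w LIMSEQ_unique by auto
qed

text \<open>Replacing the linearized conjugation by the one with \<open>exp k\<close> makes the
  correction an exact unitary at the price of one more second-order error, so the quadratic gain
  survives.\<close>

lemma newton_unitary_step:
  fixes D D0 :: "'a :: star_banach set"
  assumes D: "star_subalgebra D" and D0: "fd_star_subalgebra D0" and sub: "D0 \<subseteq> D"
    and C: "casimir_basis D S \<phi> K"
  obtains M where "1 \<le> M"
    "\<And>F \<delta>. star_subalgebra F \<Longrightarrow> D0 \<subseteq> F \<Longrightarrow> 0 < \<delta> \<Longrightarrow> M * \<delta> \<le> 1 \<Longrightarrow> (\<forall>p\<in>S. \<exists>f\<in>F. norm (f - p) \<le> \<delta>) \<Longrightarrow>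
      \<exists>v. is_unitary v \<and> (\<forall>d\<in>D0. v * d = d * v) \<and> norm (v - 1) \<le> M * \<delta> \<and>
        (\<forall>p\<in>S. \<exists>f\<in>F. norm (f - v * p * adj v) \<le> M * \<delta>\<^sup>2)"
proof -
  note CC = casimir_basisD[OF C]
  obtain M where M: "1 \<le> M" and step: "\<And>F \<delta>. star_subalgebra F \<Longrightarrow> D0 \<subseteq> F \<Longrightarrow> 0 < \<delta> \<Longrightarrow> \<delta> \<le> 1 \<Longrightarrow>
      (\<forall>p\<in>S. \<exists>f\<in>F. norm (f - p) \<le> \<delta>) \<Longrightarrow>
      \<exists>k. adj k = - k \<and> (\<forall>d\<in>D0. k * d = d * k) \<and> norm k \<le> M * \<delta> \<and>
        (\<forall>p\<in>S. \<exists>f\<in>F. norm (f - (p + k * p - p * k)) \<le> M * \<delta>\<^sup>2)"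
    using newton_step[OF D D0 sub C] by blast
  define s where "s = (\<Sum>p\<in>S. norm p)"
  have s: "0 \<le> s" by (auto simp: s_def intro!: sum_nonneg)
  have ps: "norm p \<le> s" if "p \<in> S" for p
    unfolding s_def using that CC(1) by (intro member_le_sum) auto
  \<comment> \<open>The first summand bounds the distance of \<open>exp k\<close> from 1, which is
    at most \<open>2 * norm k\<close>; in the second, 6 comes from comparing conjugation with its
    linearization.\<close>
  define M' where "M' = 2 * M + 6 * M\<^sup>2 * s"
  have M': "2 * M \<le> M'" "M + 6 * M\<^sup>2 * s \<le> M'" using M s by (auto simp: M'_def)
  show thesis
  proof (rule that[of M'])
    show "1 \<le> M'" using M M' by simp
    fix F \<delta> assume F: "star_subalgebra F" and D0F: "D0 \<subseteq> F" and \<delta>: "0 < (\<delta> :: real)" "M' * \<delta> \<le> 1"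
      and near: "\<forall>p\<in>S. \<exists>f\<in>F. norm (f - p) \<le> \<delta>"
    have M\<delta>: "2 * (M * \<delta>) \<le> M' * \<delta>" using M'(1) \<delta>(1) mult_right_mono[of "2 * M" M' \<delta>] by simp
    have "\<delta> \<le> M * \<delta>" using M \<delta> by simp
    then have "\<delta> \<le> 1" "M * \<delta> \<le> 1" using M\<delta> \<delta> by linarith+
    obtain k where k: "adj k = - k" "\<forall>d\<in>D0. k * d = d * k" "norm k \<le> M * \<delta>"
        and kF: "\<forall>p\<in>S. \<exists>f\<in>F. norm (f - (p + k * p - p * k)) \<le> M * \<delta>\<^sup>2"
      using step[OF F D0F \<delta>(1) \<open>\<delta> \<le> 1\<close> near] by blast
    have k1: "norm k \<le> 1" using k(3) \<open>M * \<delta> \<le> 1\<close> by simp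
    have k2: "(norm k)\<^sup>2 \<le> norm k" using k1 by (simp add: power2_eq_square mult_left_le)
    define v where "v = exp k"
    have v: "is_unitary v" unfolding v_def using k(1) by (rule is_unitary_exp)
    have va: "adj v = exp (- k)" by (simp add: v_def adj_exp k(1))
    have comm: "\<forall>d\<in>D0. v * d = d * v" using k(2) exp_commutes by (auto simp: v_def)
    have r1: "norm (v - 1 - k) \<le> (norm k)\<^sup>2" unfolding v_def using norm_exp_remainder[OF k1] .
    have r2: "norm (adj v - 1 + k) \<le> (norm k)\<^sup>2" unfolding va using norm_exp_remainder[of "- k"] k1 by simp
    have v1: "norm (v - 1) \<le> 2 * norm k"
      using norm_triangle_ineq[of "v - 1 - k" k] r1 k2 by simp
    have va2: "norm (adj v) \<le> 3"
      using norm_triangle_ineq[of "adj v - 1" 1] v1 k1 norm_adj[of "v - 1"] by (simp add: adj_diff)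
    have k12: "norm (1 + k) \<le> 2" using norm_triangle_ineq[of 1 k] k1 by simp
    have conj: "norm (p + k * p - p * k - v * p * adj v) \<le> 6 * (norm k)\<^sup>2 * norm p" for p
    proof -
      \<comment> \<open>Write v as 1 + k plus a remainder and \<open>adj v\<close> as 1 - k plus a
        remainder. The linear parts alone miss the linearization by \<open>k * p * k\<close>; the
        three terms have weights 1 + 3 + 2 = 6.\<close>
      have "p + k * p - p * k - v * p * adj v =
          k * p * k - (v - 1 - k) * p * adj v - (1 + k) * p * (adj v - 1 + k)"
        by (simp add: algebra_simps)
      also have "norm \<dots> \<le> norm (k * p * k) + norm ((v - 1 - k) * p * adj v) + norm ((1 + k) * p * (adj v - 1 + k))"
        by (meson add_mono norm_triangle_ineq4 order_refl order_trans)
      also have "\<dots> \<le> norm k * norm p * norm k + (norm k)\<^sup>2 * norm p * 3 + 2 * norm p * (norm k)\<^sup>2"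
        by (intro add_mono order_trans[OF norm_mult3] mult_mono r1 r2 va2 k12 order_refl) auto
      finally show ?thesis by (simp add: power2_eq_square algebra_simps)
    qed
    have "\<exists>f\<in>F. norm (f - v * p * adj v) \<le> M' * \<delta>\<^sup>2" if p: "p \<in> S" for p
    proof -
      obtain f where f: "f \<in> F" "norm (f - (p + k * p - p * k)) \<le> M * \<delta>\<^sup>2" using kF p by blast
      have "norm (f - v * p * adj v) \<le> norm (f - (p + k * p - p * k)) + norm (p + k * p - p * k - v * p * adj v)"
        using norm_triangle_ineq[of "f - (p + k * p - p * k)" "p + k * p - p * k - v * p * adj v"] by simp
      also have "\<dots> \<le> M * \<delta>\<^sup>2 + 6 * (M * \<delta>)\<^sup>2 * s"
        using k(3) ps[OF p]
        by (intro add_mono f(2) order_trans[OF conj] mult_mono mult_left_mono power_mono) auto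
      also have "\<dots> = (M + 6 * M\<^sup>2 * s) * \<delta>\<^sup>2" by (simp add: power_mult_distrib algebra_simps)
      also have "\<dots> \<le> M' * \<delta>\<^sup>2" using M'(2) by (intro mult_right_mono) auto
      finally show ?thesis using f(1) by blast
    qed
    moreover have "norm (v - 1) \<le> M' * \<delta>" using v1 k(3) M\<delta> by linarith
    ultimately show "\<exists>v. is_unitary v \<and> (\<forall>d\<in>D0. v * d = d * v) \<and> norm (v - 1) \<le> M' * \<delta> \<and>
        (\<forall>p\<in>S. \<exists>f\<in>F. norm (f - v * p * adj v) \<le> M' * \<delta>\<^sup>2)"
      using v comm by blast
  qed
qed

text \<open>D stays put and F is rotated: each step is applied to the conjugate of F by
  \<open>adj w\<close>, so one Casimir basis and one constant M serve the whole iteration. The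
  quadratic error is used only to halve the distance at every step, which already makes the
  unitaries converge. Closedness of F then puts the limit conjugates of S, and by linearity those of
  D, into F.\<close>

lemma unitary_perturbation:
  fixes D D0 :: "'a :: star_banach set"
  assumes D: "fd_star_subalgebra D" and D0: "fd_star_subalgebra D0" and sub: "D0 \<subseteq> D" and \<epsilon>: "0 < \<epsilon>"
  obtains S \<delta> where "finite S" "0 < \<delta>"
    "\<And>F. fd_star_subalgebra F \<Longrightarrow> D0 \<subseteq> F \<Longrightarrow> \<forall>p\<in>S. \<exists>f\<in>F. norm (f - p) < \<delta> \<Longrightarrow>
      \<exists>u. is_unitary u \<and> norm (u - 1) < \<epsilon> \<and> (\<forall>d\<in>D0. u * d = d * u) \<and> (\<forall>a\<in>D. u * a * adj u \<in> F)"
proof -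
  note Ds = fd_star_subalgebraD[OF D]
  obtain S \<phi> K where C: "casimir_basis D S \<phi> K" using casimir_basis_exists[OF D] by blast
  note CC = casimir_basisD[OF C]
  obtain M where M: "1 \<le> M" and step: "\<And>F \<delta>. star_subalgebra F \<Longrightarrow> D0 \<subseteq> F \<Longrightarrow> 0 < \<delta> \<Longrightarrow> M * \<delta> \<le> 1 \<Longrightarrow>
      (\<forall>p\<in>S. \<exists>f\<in>F. norm (f - p) \<le> \<delta>) \<Longrightarrow>
      \<exists>v. is_unitary v \<and> (\<forall>d\<in>D0. v * d = d * v) \<and> norm (v - 1) \<le> M * \<delta> \<and>
        (\<forall>p\<in>S. \<exists>f\<in>F. norm (f - v * p * adj v) \<le> M * \<delta>\<^sup>2)"
    using newton_unitary_step[OF Ds D0 sub C] by blast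
  \<comment> \<open>With \<open>8 * M * \<delta> \<le> 1\<close> every w stays within 1 of the unit,
    hence of norm at most 2, and \<open>4 * M * dl n \<le> 1/2\<close> is the factor that halves the
    error. The second bound makes the distance of u from 1 strictly less than \<epsilon>.\<close>
  define \<delta> where "\<delta> = min (1 / (8 * M)) (\<epsilon> / (16 * M))"
  have \<delta>: "0 < \<delta>" using M \<epsilon> by (simp add: \<delta>_def)
  have "\<delta> \<le> 1 / (8 * M)" by (simp add: \<delta>_def)
  then have \<delta>1: "8 * M * \<delta> \<le> 1" using M by (simp add: field_simps)
  have "\<delta> \<le> \<epsilon> / (16 * M)" by (simp add: \<delta>_def)
  then have \<delta>2: "8 * M * \<delta> \<le> \<epsilon> / 2" using M by (simp add: field_simps)
  show thesis
  proof (rule that[of S \<delta>])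
    show "finite S" by (rule CC(1))
    show "0 < \<delta>" by (rule \<delta>)
    fix F assume F: "fd_star_subalgebra F" and D0F: "D0 \<subseteq> F" and near: "\<forall>p\<in>S. \<exists>f\<in>F. norm (f - p) < \<delta>"
    note Fs = fd_star_subalgebraD[OF F]
    define dl where "dl n = \<delta> * (1/2) ^ n" for n :: nat
    have dl: "0 < dl n" "dl n \<le> \<delta>" for n using \<delta> by (auto simp: dl_def power_le_one mult_left_le)
    define P where "P n w \<longleftrightarrow> is_unitary w \<and> (\<forall>d\<in>D0. w * d = d * w) \<and> norm (w - 1) \<le> 8 * M * \<delta> * (1 - (1/2) ^ n) \<and>
        (\<forall>p\<in>S. \<exists>f\<in>F. norm (adj w * f * w - p) \<le> dl n)" for n w
    have "\<exists>w. \<forall>n. P n (w n) \<and> norm (w (Suc n) - w n) \<le> 2 * M * dl n"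
    proof (rule dependent_nat_choice)
      show "\<exists>w. P 0 w" using near is_unitary_one by (intro exI[of _ 1]) (auto simp: P_def dl_def intro: less_imp_le)
    next
      fix w n assume "P n w"
      then have w: "is_unitary w" "\<forall>d\<in>D0. w * d = d * w" "norm (w - 1) \<le> 8 * M * \<delta> * (1 - (1/2) ^ n)"
        and wF: "\<forall>p\<in>S. \<exists>f\<in>F. norm (adj w * f * w - p) \<le> dl n" by (auto simp: P_def)
      define F' where "F' = (\<lambda>x. adj w * x * w) ` F"
      have F': "star_subalgebra F'"
        using star_subalgebra_conj[OF is_unitary_adj[OF w(1)] Fs] by (simp add: F'_def adj_adj)
      have "d \<in> F'" if "d \<in> D0" for d
      proof -
        have "d = adj w * d * w"
          using w(2) that unitary_cancel[OF w(1)] by (simp add: mult.assoc flip: w(2))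
        then show ?thesis unfolding F'_def using that D0F by blast
      qed
      then have D0F': "D0 \<subseteq> F'" by blast
      have "M * dl n \<le> M * \<delta>" using dl(2) M by (intro mult_left_mono) auto
      moreover have "M * \<delta> \<ge> 0" using M \<delta> by simp
      ultimately have Md: "M * dl n \<le> 1/8" "M * dl n \<le> 1" using \<delta>1 by linarith+
      have near': "\<forall>p\<in>S. \<exists>f\<in>F'. norm (f - p) \<le> dl n" using wF by (auto simp: F'_def)
      obtain v where v: "is_unitary v" "\<forall>d\<in>D0. v * d = d * v" "norm (v - 1) \<le> M * dl n"
          and vF: "\<forall>p\<in>S. \<exists>f\<in>F'. norm (f - v * p * adj v) \<le> M * (dl n)\<^sup>2"
        using step[OF F' D0F' dl(1) Md(2) near'] by blast
      have v2: "norm v \<le> 2" by (rule norm_unitary_le) (use v(3) Md(2) in linarith)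
      have "8 * M * \<delta> * (1 - (1/2) ^ n) \<le> 1"
      proof -
        have "8 * M * \<delta> * (1 - (1/2) ^ n) \<le> 8 * M * \<delta>"
          using M \<delta> by (intro mult_left_le) auto
        then show ?thesis using \<delta>1 by linarith
      qed
      then have w2: "norm w \<le> 2" by (intro norm_unitary_le) (use w(3) in linarith)
      have diff: "norm (w * v - w) \<le> 2 * M * dl n"
      proof -
        have "norm (w * (v - 1)) \<le> 2 * (M * dl n)"
          by (rule order_trans[OF norm_mult_ineq]) (intro mult_mono w2 v(3); simp)
        then show ?thesis by (simp add: algebra_simps)
      qed
      have "P (Suc n) (w * v)"
        unfolding P_def
      proof (intro conjI ballI)
        show "is_unitary (w * v)" using w(1) v(1) by (rule is_unitary_mult)
        show "w * v * d = d * (w * v)" if "d \<in> D0" for d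
          using w(2) v(2) that by (metis mult.assoc)
        have "norm (w * v - 1) \<le> norm (w * v - w) + norm (w - 1)"
          using norm_triangle_ineq[of "w * v - w" "w - 1"] by simp
        also have "\<dots> \<le> 2 * M * dl n + 8 * M * \<delta> * (1 - (1/2) ^ n)" using diff w(3) by simp
        also have "\<dots> = 8 * M * \<delta> * (1 - (1/2) ^ n) + 2 * (M * dl n)" by simp
        also have "\<dots> \<le> 8 * M * \<delta> * (1 - (1/2) ^ n) + 4 * (M * dl n)" using M dl(1)[of n] by simp
        also have "\<dots> = 8 * M * \<delta> * (1 - (1/2) ^ Suc n)" by (simp add: dl_def algebra_simps)
        finally show "norm (w * v - 1) \<le> 8 * M * \<delta> * (1 - (1/2) ^ Suc n)" .
        fix p assume "p \<in> S"
        then obtain f where f: "f \<in> F" "norm (adj w * f * w - v * p * adj v) \<le> M * (dl n)\<^sup>2"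
          using vF by (auto simp: F'_def)
        have "adj (w * v) * f * (w * v) - p = adj v * (adj w * f * w - v * p * adj v) * v"
          using unitary_cancel[OF v(1)] v(1)
          by (simp add: adj_mult right_diff_distrib left_diff_distrib mult.assoc is_unitary_def)
        also have "norm \<dots> \<le> 2 * (M * (dl n)\<^sup>2) * 2"
          by (rule order_trans[OF norm_mult3]) (intro mult_mono f(2); use v2 norm_adj[of v] M in simp)
        also have "\<dots> = 4 * (M * dl n) * dl n" by (simp add: power2_eq_square)
        also have "\<dots> \<le> (1/2) * dl n" using Md(1) dl(1)[of n] by (intro mult_right_mono) auto
        also have "\<dots> = dl (Suc n)" by (simp add: dl_def)
        finally show "\<exists>f\<in>F. norm (adj (w * v) * f * (w * v) - p) \<le> dl (Suc n)" using f(1) by blast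
      qed
      then show "\<exists>w'. P (Suc n) w' \<and> norm (w' - w) \<le> 2 * M * dl n" using diff by blast
    qed
    then obtain w where P: "\<And>n. P n (w n)" and diff: "\<And>n. norm (w (Suc n) - w n) \<le> 2 * M * dl n" by blast
    have w: "is_unitary (w n)" "\<And>d. d \<in> D0 \<Longrightarrow> w n * d = d * w n" "norm (w n - 1) \<le> 8 * M * \<delta> * (1 - (1/2) ^ n)" for n
      using P[of n] by (auto simp: P_def)
    have w1: "norm (w n - 1) \<le> 8 * M * \<delta>" for n
    proof -
      have "8 * M * \<delta> * (1 - (1/2) ^ n) \<le> 8 * M * \<delta>"
        using M \<delta> by (intro mult_left_le) auto
      then show ?thesis using w(3)[of n] by linarith
    qed
    have w2: "norm (w n) \<le> 2" for n by (rule norm_unitary_le) (use w1[of n] \<delta>1 in linarith)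
    obtain u where lim: "w \<longlonglongrightarrow> u"
      using convergent_if_geometric[of w "2 * M * \<delta>"] diff by (auto simp: dl_def mult.assoc)
    have u: "is_unitary u" using unitary_limit[OF lim w(1)] .
    have "norm (u - 1) \<le> 8 * M * \<delta>"
      by (rule Lim_bounded[of "\<lambda>n. norm (w n - 1)" _ 0]) (auto intro!: tendsto_norm tendsto_diff lim tendsto_const w1)
    then have u1: "norm (u - 1) < \<epsilon>" using \<delta>2 \<epsilon> by linarith
    have uc: "u * d = d * u" if "d \<in> D0" for d using commutes_limit[OF lim w(2)[OF that]] .
    have conjp: "u * p * adj u \<in> F" if p: "p \<in> S" for p
    proof -
      have "\<forall>n. \<exists>f\<in>F. norm (adj (w n) * f * w n - p) \<le> dl n" using P p by (auto simp: P_def)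
      then obtain f where f: "\<And>n. f n \<in> F" "\<And>n. norm (adj (w n) * f n * w n - p) \<le> dl n" by metis
      have bd: "norm (f n - w n * p * adj (w n)) \<le> 4 * \<delta> * (1/2) ^ n" for n
      proof -
        have "f n - w n * p * adj (w n) = w n * (adj (w n) * f n * w n - p) * adj (w n)"
          using unitary_cancel[OF w(1)[of n]] w(1)[of n]
          by (simp add: right_diff_distrib left_diff_distrib mult.assoc is_unitary_def)
        also have "norm \<dots> \<le> 2 * dl n * 2"
          by (rule order_trans[OF norm_mult3])
             (intro mult_mono f(2); use w2[of n] norm_adj[of "w n"] dl(1)[of n] in simp)
        finally show ?thesis by (simp add: dl_def)
      qed
      have "(\<lambda>n. 4 * \<delta> * (1/2) ^ n) \<longlonglongrightarrow> 4 * \<delta> * 0"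
        by (intro tendsto_mult tendsto_const LIMSEQ_power_zero) auto
      then have "(\<lambda>n. f n - w n * p * adj (w n)) \<longlonglongrightarrow> 0"
        using Lim_null_comparison[OF always_eventually[OF allI[OF bd]]] by simp
      moreover have "(\<lambda>n. w n * p * adj (w n)) \<longlonglongrightarrow> u * p * adj u"
        by (intro tendsto_mult tendsto_const lim bounded_linear.tendsto[OF bounded_linear_adj lim])
      ultimately have "(\<lambda>n. (f n - w n * p * adj (w n)) + w n * p * adj (w n)) \<longlonglongrightarrow> 0 + u * p * adj u"
        by (rule tendsto_add)
      then have "f \<longlonglongrightarrow> u * p * adj u" by simp
      then show ?thesis
        using closed_fd_star_subalgebra[OF F] f(1) closed_sequentially by blast
    qed
    have "u * a * adj u \<in> F" if a: "a \<in> D" for a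
    proof -
      have "u * a * adj u = u * (\<Sum>p\<in>S. \<phi> p a *\<^sub>C p) * adj u" using CC(7)[OF a] by simp
      also have "\<dots> = (\<Sum>p\<in>S. \<phi> p a *\<^sub>C (u * p * adj u))"
        by (simp add: sum_distrib_left sum_distrib_right star_simps)
      also have "\<dots> \<in> F" by (intro star_subalgebraD(9)[OF Fs] star_subalgebraD(6)[OF Fs] conjp)
      finally show ?thesis .
    qed
    then show "\<exists>u. is_unitary u \<and> norm (u - 1) < \<epsilon> \<and> (\<forall>d\<in>D0. u * d = d * u) \<and> (\<forall>a\<in>D. u * a * adj u \<in> F)"
      using u u1 uc by blast
  qed
qed

section \<open>Directed families in density at most aleph 1\<close>

definition locally_fd :: "'a :: star_banach itself \<Rightarrow> bool" where
  "locally_fd _ \<longleftrightarrow> (\<forall>(X :: 'a set) \<epsilon>. finite X \<longrightarrow> 0 < \<epsilon> \<longrightarrow>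
     (\<exists>G. fd_star_subalgebra G \<and> (\<forall>x\<in>X. \<exists>g\<in>G. norm (g - x) < \<epsilon>)))"

text \<open>Two rotations. The first brings D into a local approximant, which is then rotated back
  so as to contain D itself; here only scalars are kept fixed. The second brings F into the result
  and commutes with the common subalgebra D0. The set S belonging to the second must be approximated
  after the rotation back, so the tolerances for the second are chosen before those for the
  first.\<close>

lemma extend_fd_subalgebra:
  fixes D D0 F :: "'a :: star_banach set"
  assumes LF: "locally_fd TYPE('a)"
    and D: "fd_star_subalgebra D" and D0: "fd_star_subalgebra D0" and F: "fd_star_subalgebra F"
    and D0D: "D0 \<subseteq> D" and D0F: "D0 \<subseteq> F" and X: "finite X" and \<epsilon>: "0 < \<epsilon>"
  obtains u G where "is_unitary u" "norm (u - 1) < \<epsilon>" "\<And>d. d \<in> D0 \<Longrightarrow> u * d = d * u"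
    "fd_star_subalgebra G" "D \<subseteq> G" "\<And>a. a \<in> F \<Longrightarrow> u * a * adj u \<in> G"
    "\<And>x. x \<in> X \<Longrightarrow> \<exists>g\<in>G. norm (g - x) < \<epsilon>"
proof -
  obtain S \<delta> where S: "finite S" "0 < \<delta>" and pert: "\<And>G. fd_star_subalgebra G \<Longrightarrow> D0 \<subseteq> G \<Longrightarrow>
      \<forall>p\<in>S. \<exists>f\<in>G. norm (f - p) < \<delta> \<Longrightarrow>
      \<exists>u. is_unitary u \<and> norm (u - 1) < \<epsilon> \<and> (\<forall>d\<in>D0. u * d = d * u) \<and> (\<forall>a\<in>F. u * a * adj u \<in> G)"
    using unitary_perturbation[OF F D0 D0F \<epsilon>] by blast
  define \<theta> where "\<theta> = min \<epsilon> \<delta>"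
  have \<theta>: "0 < \<theta>" "\<theta> \<le> \<epsilon>" "\<theta> \<le> \<delta>" using \<epsilon> S by (auto simp: \<theta>_def)
  define b where "b = (\<Sum>x\<in>S \<union> X. norm x)"
  have b0: "0 \<le> b" by (auto simp: b_def intro!: sum_nonneg)
  have b: "norm x \<le> b" if "x \<in> S \<union> X" for x
    unfolding b_def using that S(1) X by (intro member_le_sum) auto
  \<comment> \<open>After the rotation back, the distance to x is at most
    \<open>4 * \<eta> + 3 * \<epsilon>1 * norm x\<close>, up to the choice of a neighbour within
    \<eta>; both terms are made at most \<open>\<theta> / 2\<close>.\<close>
  define \<epsilon>1 where "\<epsilon>1 = min 1 (\<theta> / (6 * (b + 1)))"
  have \<epsilon>1: "0 < \<epsilon>1" "\<epsilon>1 \<le> 1" using \<theta> b0 by (auto simp: \<epsilon>1_def)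
  have "\<epsilon>1 \<le> \<theta> / (6 * (b + 1))" by (simp add: \<epsilon>1_def)
  then have "3 * \<epsilon>1 * (b + 1) \<le> \<theta> / 2" using b0 by (simp add: field_simps)
  moreover have "3 * \<epsilon>1 * b \<le> 3 * \<epsilon>1 * (b + 1)" using \<epsilon>1 by simp
  ultimately have \<epsilon>1b: "3 * \<epsilon>1 * b \<le> \<theta> / 2" by linarith
  obtain S' \<delta>' where S': "finite S'" "0 < \<delta>'" and pert': "\<And>G. fd_star_subalgebra G \<Longrightarrow> cvs.span {1} \<subseteq> G \<Longrightarrow>
      \<forall>p\<in>S'. \<exists>f\<in>G. norm (f - p) < \<delta>' \<Longrightarrow>
      \<exists>u. is_unitary u \<and> norm (u - 1) < \<epsilon>1 \<and> (\<forall>d\<in>cvs.span {1}. u * d = d * u) \<and> (\<forall>a\<in>D. u * a * adj u \<in> G)"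
    using unitary_perturbation[OF D fd_star_subalgebra_scalars scalars_subset[OF fd_star_subalgebraD[OF D]] \<epsilon>1(1)]
    by blast
  define \<eta> where "\<eta> = min \<delta>' (\<theta> / 8)"
  have \<eta>: "0 < \<eta>" "\<eta> \<le> \<delta>'" "4 * \<eta> \<le> \<theta> / 2" using S' \<theta> by (auto simp: \<eta>_def)
  have "finite (S \<union> X \<union> S')" using S(1) X S'(1) by simp
  then obtain G where G: "fd_star_subalgebra G" "\<forall>x\<in>S \<union> X \<union> S'. \<exists>g\<in>G. norm (g - x) < \<eta>"
    using LF[unfolded locally_fd_def, rule_format, OF _ \<eta>(1)] by blast
  have "\<forall>p\<in>S'. \<exists>f\<in>G. norm (f - p) < \<delta>'" using G(2) \<eta>(2) by (meson UnI2 less_le_trans)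
  then obtain v where v: "is_unitary v" "norm (v - 1) < \<epsilon>1" "\<forall>a\<in>D. v * a * adj v \<in> G"
    using pert'[OF G(1) scalars_subset[OF fd_star_subalgebraD[OF G(1)]]] by blast
  define H where "H = (\<lambda>x. adj v * x * v) ` G"
  have H: "fd_star_subalgebra H"
    using fd_star_subalgebra_conj[OF is_unitary_adj[OF v(1)] G(1)] by (simp add: H_def adj_adj)
  have DH: "D \<subseteq> H"
  proof
    fix a assume "a \<in> D"
    then have "v * a * adj v \<in> G" using v(3) by blast
    moreover have "a = adj v * (v * a * adj v) * v"
      using unitary_cancel[OF v(1)] v(1) by (simp add: mult.assoc is_unitary_def)
    ultimately show "a \<in> H" unfolding H_def by blast
  qed
  have near: "\<exists>g\<in>H. norm (g - x) < \<theta>" if x: "x \<in> S \<union> X" for x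
  proof -
    obtain g where g: "g \<in> G" "norm (g - x) < \<eta>" using G(2) x by blast
    have "norm (adj v - 1) \<le> \<epsilon>1" using v(2) norm_adj[of "v - 1"] by (simp add: adj_diff)
    from unitary_conj_near[OF is_unitary_adj[OF v(1)] this \<epsilon>1(2), of g x]
    have "norm (adj v * g * v - x) \<le> 4 * norm (g - x) + 3 * \<epsilon>1 * norm x" by (simp add: adj_adj)
    also have "3 * \<epsilon>1 * norm x \<le> 3 * \<epsilon>1 * b" using b[OF x] \<epsilon>1 by simp
    finally have "norm (adj v * g * v - x) < \<theta>" using g(2) \<eta>(3) \<epsilon>1b by simp
    then show ?thesis unfolding H_def using g(1) by blast
  qed
  have "\<forall>p\<in>S. \<exists>f\<in>H. norm (f - p) < \<delta>" using near \<theta>(3) by (meson UnI1 less_le_trans)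
  then obtain u where u: "is_unitary u" "norm (u - 1) < \<epsilon>" "\<forall>d\<in>D0. u * d = d * u" "\<forall>a\<in>F. u * a * adj u \<in> H"
    using pert[OF H] D0D DH by blast
  have "\<exists>g\<in>H. norm (g - x) < \<epsilon>" if "x \<in> X" for x
    using near \<theta>(2) that by (meson UnI2 less_le_trans)
  then show thesis
    using that[OF u(1,2) _ H DH] u(3,4) by blast
qed

text \<open>The algebras F n found step by step contain D n but are nested only up to the unitaries
  u n. Conjugating F n by the infinite product w n of the u j with \<open>j \<ge> n\<close> makes
  them nested. Each such u j commutes with D j, hence with D n, so D n is untouched by w n.\<close>

lemma extend_tower:
  fixes D :: "nat \<Rightarrow> 'a :: star_banach set" and x :: "nat \<Rightarrow> 'a"
  assumes LF: "locally_fd TYPE('a)"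
    and D: "\<And>n. fd_star_subalgebra (D n)" and incr: "\<And>n. D n \<subseteq> D (Suc n)"
  obtains E where "\<And>n. fd_star_subalgebra (E n)" "\<And>n. E n \<subseteq> E (Suc n)" "\<And>n. D n \<subseteq> E n"
    "\<And>i. x i \<in> closure (\<Union>n. E n)"
proof -
  \<comment> \<open>The exponent \<open>n + 3\<close> gives
    \<open>4 * \<epsilon> n \<le> 1/2\<close>, so all partial products have norm at most 2, and the
    geometric decay makes them converge.\<close>
  define \<epsilon> :: "nat \<Rightarrow> real" where "\<epsilon> n = (1/2) ^ (n + 3)" for n
  have \<epsilon>0: "0 < \<epsilon> n" for n by (simp add: \<epsilon>_def)
  have \<epsilon>1: "4 * \<epsilon> n \<le> 1/2" for n
    using power_le_one[of "1/2 :: real" n] by (simp add: \<epsilon>_def power_add power3_eq_cube)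
  have \<epsilon>S: "\<epsilon> (n + j) = \<epsilon> n * (1/2) ^ j" for n j by (simp add: \<epsilon>_def power_add)
  define Q where "Q n F F' u \<longleftrightarrow> is_unitary u \<and> norm (u - 1) < \<epsilon> n \<and> (\<forall>d\<in>D n. u * d = d * u) \<and>
      (\<forall>a\<in>F. u * a * adj u \<in> F') \<and> (\<forall>i\<le>n. \<exists>g\<in>F'. norm (g - x i) < \<epsilon> n)" for n F F' u
  have "\<exists>F. \<forall>n. (fd_star_subalgebra (F n) \<and> D n \<subseteq> F n) \<and> (\<exists>u. Q n (F n) (F (Suc n)) u)"
  proof (rule dependent_nat_choice)
    show "\<exists>F. fd_star_subalgebra F \<and> D 0 \<subseteq> F" using D by blast
  next
    fix F n assume F: "fd_star_subalgebra F \<and> D n \<subseteq> F"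
    have "finite (x ` {..n})" by simp
    obtain u G where "is_unitary u" "norm (u - 1) < \<epsilon> n" "\<And>d. d \<in> D n \<Longrightarrow> u * d = d * u"
      "fd_star_subalgebra G" "D (Suc n) \<subseteq> G" "\<And>a. a \<in> F \<Longrightarrow> u * a * adj u \<in> G"
      "\<And>y. y \<in> x ` {..n} \<Longrightarrow> \<exists>g\<in>G. norm (g - y) < \<epsilon> n"
      using extend_fd_subalgebra[OF LF D[of "Suc n"] D[of n] conjunct1[OF F] incr[of n] conjunct2[OF F]
          \<open>finite (x ` {..n})\<close> \<epsilon>0[of n]] by blast
    then show "\<exists>F'. (fd_star_subalgebra F' \<and> D (Suc n) \<subseteq> F') \<and> (\<exists>u. Q n F F' u)"
      unfolding Q_def by (intro exI[of _ G] conjI exI[of _ u]) auto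
  qed
  then obtain F where F: "\<And>n. fd_star_subalgebra (F n)" "\<And>n. D n \<subseteq> F n" and "\<forall>n. \<exists>u. Q n (F n) (F (Suc n)) u"
    by blast
  then obtain u where Q: "\<And>n. Q n (F n) (F (Suc n)) (u n)" by metis
  have u: "is_unitary (u n)" "norm (u n - 1) < \<epsilon> n" "\<And>d. d \<in> D n \<Longrightarrow> u n * d = d * u n"
    "\<And>a. a \<in> F n \<Longrightarrow> u n * a * adj (u n) \<in> F (Suc n)" "\<And>i. i \<le> n \<Longrightarrow> \<exists>g\<in>F (Suc n). norm (g - x i) < \<epsilon> n" for n
    using Q[of n] by (auto simp: Q_def)
  \<comment> \<open>The finite product from u n up to u (n + j - 1), later factors standing on the
    left.\<close>
  define W where "W n j = rec_nat 1 (\<lambda>j w. u (n + j) * w) j" for n j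
  have W0: "W n 0 = 1" and WS: "W n (Suc j) = u (n + j) * W n j" for n j by (simp_all add: W_def)
  have Wshift: "W n (Suc j) = W (Suc n) j * u n" for n j
  proof (induction j)
    case (Suc j)
    have "W n (Suc (Suc j)) = u (n + Suc j) * (W (Suc n) j * u n)" using WS[of n "Suc j"] Suc by simp
    then show ?case using WS[of "Suc n" j] by (simp add: mult.assoc)
  qed (simp add: W0 WS)
  have Wu: "is_unitary (W n j)" for n j
    by (induction j) (auto simp: W0 WS is_unitary_one intro!: is_unitary_mult u(1))
  have W1: "norm (W n j - 1) \<le> 4 * \<epsilon> n * (1 - (1/2) ^ j) \<and> norm (W n (Suc j) - W n j) \<le> 2 * \<epsilon> n * (1/2) ^ j" for n j
  proof -
    have step: "norm (W n (Suc j) - W n j) \<le> 2 * \<epsilon> n * (1/2) ^ j"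
      if "norm (W n j - 1) \<le> 4 * \<epsilon> n * (1 - (1/2) ^ j)" for j
    proof -
      have "4 * \<epsilon> n * (1 - (1/2) ^ j) \<le> 4 * \<epsilon> n" using \<epsilon>0[of n] by (intro mult_left_le) auto
      then have W2: "norm (W n j) \<le> 2" by (intro norm_unitary_le) (use that \<epsilon>1[of n] in linarith)
      have "W n (Suc j) - W n j = (u (n + j) - 1) * W n j" by (simp add: WS algebra_simps)
      also have "norm \<dots> \<le> \<epsilon> (n + j) * 2"
        by (rule order_trans[OF norm_mult_ineq]) (intro mult_mono W2 less_imp_le[OF u(2)] norm_ge_zero less_imp_le[OF \<epsilon>0])
      finally show ?thesis by (simp add: \<epsilon>S)
    qed
    have "norm (W n j - 1) \<le> 4 * \<epsilon> n * (1 - (1/2) ^ j)"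
    proof (induction j)
      case (Suc j)
      have "norm (W n (Suc j) - 1) \<le> norm (W n (Suc j) - W n j) + norm (W n j - 1)"
        using norm_triangle_ineq[of "W n (Suc j) - W n j" "W n j - 1"] by simp
      also have "\<dots> \<le> 2 * \<epsilon> n * (1/2) ^ j + 4 * \<epsilon> n * (1 - (1/2) ^ j)" using step[OF Suc] Suc by simp
      also have "\<dots> = 4 * \<epsilon> n * (1 - (1/2) ^ Suc j)" by (simp add: algebra_simps)
      finally show ?case .
    qed (simp add: W0)
    then show ?thesis using step by blast
  qed
  have "\<forall>n. \<exists>l. W n \<longlonglongrightarrow> l"
    using convergent_if_geometric W1 by metis
  then obtain w where lim: "\<And>n. W n \<longlonglongrightarrow> w n" by metis
  have wu: "is_unitary (w n)" for n using unitary_limit[OF lim Wu] .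
  \<comment> \<open>This relation makes E increasing: conjugating F n by w n is conjugating by u n,
    which lands in F (Suc n), and then by w (Suc n).\<close>
  have ws: "w n = w (Suc n) * u n" for n
  proof -
    have "(\<lambda>j. W n (Suc j)) \<longlonglongrightarrow> w n" using LIMSEQ_Suc[OF lim] .
    moreover have "(\<lambda>j. W (Suc n) j * u n) \<longlonglongrightarrow> w (Suc n) * u n" by (intro tendsto_mult tendsto_const lim)
    ultimately show ?thesis using LIMSEQ_unique by (simp add: Wshift)
  qed
  have w1: "norm (w n - 1) \<le> 4 * \<epsilon> n" for n
  proof (rule Lim_bounded[of "\<lambda>j. norm (W n j - 1)" _ 0])
    show "(\<lambda>j. norm (W n j - 1)) \<longlonglongrightarrow> norm (w n - 1)" by (intro tendsto_norm tendsto_diff lim tendsto_const)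
    have "4 * \<epsilon> n * (1 - (1/2) ^ j) \<le> 4 * \<epsilon> n" for j using \<epsilon>0[of n] by (intro mult_left_le) auto
    then show "\<forall>j\<ge>0. norm (W n j - 1) \<le> 4 * \<epsilon> n" using W1 order_trans by blast
  qed
  have Dmono: "D n \<subseteq> D (n + j)" for n j by (induction j) (use incr in auto)
  have wd: "w n * d = d * w n" if d: "d \<in> D n" for n d
  proof (rule commutes_limit[OF lim])
    show "W n j * d = d * W n j" for j
    proof (induction j)
      case (Suc j)
      have "u (n + j) * d = d * u (n + j)" using u(3) d Dmono by blast
      then show ?case using Suc by (metis WS mult.assoc)
    qed (simp add: W0)
  qed
  define E where "E n = (\<lambda>a. w n * a * adj (w n)) ` F n" for n
  show thesis
  proof (rule that[of E])
    show "fd_star_subalgebra (E n)" for n unfolding E_def by (rule fd_star_subalgebra_conj[OF wu F(1)])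
    show "E n \<subseteq> E (Suc n)" for n
    proof
      fix y assume "y \<in> E n"
      then obtain a where a: "a \<in> F n" "y = w n * a * adj (w n)" by (auto simp: E_def)
      have "y = w (Suc n) * (u n * a * adj (u n)) * adj (w (Suc n))"
        by (simp add: a(2) ws[of n] adj_mult mult.assoc)
      then show "y \<in> E (Suc n)" using u(4)[OF a(1)] by (auto simp: E_def)
    qed
    show "D n \<subseteq> E n" for n
    proof
      fix d assume d: "d \<in> D n"
      have "d = w n * d * adj (w n)"
        using wd[OF d] wu[of n] by (simp add: mult.assoc is_unitary_def)
      then show "d \<in> E n" using d F(2) by (auto simp: E_def)
    qed
    show "x i \<in> closure (\<Union>n. E n)" for i
      unfolding closure_approachable
    proof (intro allI impI)
      fix e :: real assume e: "0 < e"
      \<comment> \<open>The conjugation estimate with \<open>t = 4 * \<epsilon> n\<close> gives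
        \<open>4 * \<epsilon> n\<close> for the distance of g to x i and
        \<open>12 * \<epsilon> n * norm (x i)\<close> for the rotation.\<close>
      define c where "c = 4 + 12 * norm (x i)"
      have c: "0 < c" using norm_ge_zero[of "x i"] unfolding c_def by linarith
      have "(\<lambda>n. c * \<epsilon> n) \<longlonglongrightarrow> c * 0"
        unfolding \<epsilon>_def by (intro tendsto_mult tendsto_const LIMSEQ_ignore_initial_segment LIMSEQ_power_zero) simp
      then have "\<forall>\<^sub>F n in sequentially. c * \<epsilon> n < e" using e by (intro order_tendstoD) simp
      then obtain N where N: "\<And>n. n \<ge> N \<Longrightarrow> c * \<epsilon> n < e" by (auto simp: eventually_sequentially)
      define n where "n = max N i"
      obtain g where g: "g \<in> F (Suc n)" "norm (g - x i) < \<epsilon> n" using u(5)[of i n] by (auto simp: n_def)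
      have \<epsilon>mono: "\<epsilon> (Suc n) \<le> \<epsilon> n" by (simp add: \<epsilon>_def)
      have w1': "norm (w (Suc n) - 1) \<le> 4 * \<epsilon> n" using w1[of "Suc n"] \<epsilon>mono by linarith
      have "4 * \<epsilon> n \<le> 1" using \<epsilon>1[of n] by linarith
      from unitary_conj_near[OF wu w1' this, of g "x i"]
      have "norm (w (Suc n) * g * adj (w (Suc n)) - x i) \<le> 4 * norm (g - x i) + 3 * (4 * \<epsilon> n) * norm (x i)" .
      also have "\<dots> \<le> c * \<epsilon> n" using g(2) by (simp add: c_def algebra_simps)
      also have "\<dots> < e" using N[of n] by (simp add: n_def)
      finally have "dist (w (Suc n) * g * adj (w (Suc n))) (x i) < e" by (simp add: dist_norm)
      then show "\<exists>y\<in>\<Union>n. E n. dist y (x i) < e" using g(1) by (auto simp: E_def)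
    qed
  qed
qed

section \<open>Countable directed families and the transfinite recursion\<close>

definition directed_fd :: "'a :: star_banach set set \<Rightarrow> bool" where
  "directed_fd \<C> \<longleftrightarrow> \<C> \<noteq> {} \<and> (\<forall>D\<in>\<C>. fd_star_subalgebra D) \<and> (\<forall>D1\<in>\<C>. \<forall>D2\<in>\<C>. \<exists>D3\<in>\<C>. D1 \<union> D2 \<subseteq> D3)"

text \<open>Each term dominates the next entry of an enumeration. Countability matters here: an
  uncountable directed family need not have a cofinal sequence.\<close>

lemma countable_directed_cofinal_tower:
  assumes C: "directed_fd \<C>" and cnt: "countable \<C>"
  obtains D where "\<And>n. D n \<in> \<C>" "\<And>n. D n \<subseteq> D (Suc n)" "\<And>X. X \<in> \<C> \<Longrightarrow> \<exists>n. X \<subseteq> D n"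
proof -
  have ne: "\<C> \<noteq> {}" using C by (simp add: directed_fd_def)
  have "\<exists>D. \<forall>n. D n \<in> \<C> \<and> (D n \<union> from_nat_into \<C> n \<subseteq> D (Suc n))"
  proof (rule dependent_nat_choice)
    show "\<exists>D. D \<in> \<C>" using ne by blast
    show "\<exists>D'. D' \<in> \<C> \<and> D \<union> from_nat_into \<C> n \<subseteq> D'" if "D \<in> \<C>" for D n
      using that from_nat_into[OF ne, of n] C unfolding directed_fd_def by blast
  qed
  then obtain D where D: "\<And>n. D n \<in> \<C>" "\<And>n. D n \<union> from_nat_into \<C> n \<subseteq> D (Suc n)" by blast
  show thesis
  proof (rule that[of D])
    show "\<exists>n. X \<subseteq> D n" if "X \<in> \<C>" for X
      using D(2) from_nat_into_surj[OF cnt that] by blast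
  qed (use D in auto)
qed

text \<open>The old family is kept and not rotated, so that the stages of a recursion form a chain.
  The added tower dominates a cofinal sequence of the old family, hence all its members.\<close>

lemma extend_countable_directed:
  fixes \<C> :: "'a :: star_banach set set"
  assumes LF: "locally_fd TYPE('a)" and C: "directed_fd \<C>" and cnt: "countable \<C>"
  shows "\<exists>\<C>'. directed_fd \<C>' \<and> countable \<C>' \<and> \<C> \<subseteq> \<C>' \<and> x \<in> closure (\<Union>\<C>')"
proof -
  obtain D where D: "\<And>n. D n \<in> \<C>" "\<And>n. D n \<subseteq> D (Suc n)" "\<And>X. X \<in> \<C> \<Longrightarrow> \<exists>n. X \<subseteq> D n"
    using countable_directed_cofinal_tower[OF C cnt] by blast
  have fdD: "fd_star_subalgebra (D n)" for n using D(1) C by (auto simp: directed_fd_def)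
  obtain E where E: "\<And>n. fd_star_subalgebra (E n)" "\<And>n. E n \<subseteq> E (Suc n)" "\<And>n. D n \<subseteq> E n"
      "\<And>i::nat. x \<in> closure (\<Union>n. E n)"
    using extend_tower[where D=D and x="\<lambda>_. x", OF LF fdD D(2)] by blast
  have Emono: "E m \<subseteq> E n" if "m \<le> n" for m n using that E(2) by (rule lift_Suc_mono_le[rotated])
  have cof: "\<exists>n. X \<subseteq> E n" if "X \<in> \<C> \<union> range E" for X
    using that D(3) E(3) by blast
  have "directed_fd (\<C> \<union> range E)"
    unfolding directed_fd_def
  proof (intro conjI ballI)
    show "\<C> \<union> range E \<noteq> {}" by blast
    show "fd_star_subalgebra X" if "X \<in> \<C> \<union> range E" for X
      using that E(1) C by (auto simp: directed_fd_def)
    fix D1 D2 assume D12: "D1 \<in> \<C> \<union> range E" "D2 \<in> \<C> \<union> range E"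
    obtain m n where "D1 \<subseteq> E m" "D2 \<subseteq> E n" using cof[OF D12(1)] cof[OF D12(2)] by blast
    then have "D1 \<union> D2 \<subseteq> E (max m n)" using Emono[of m "max m n"] Emono[of n "max m n"] by auto
    then show "\<exists>D3\<in>\<C> \<union> range E. D1 \<union> D2 \<subseteq> D3" by blast
  qed
  moreover have "x \<in> closure (\<Union>(\<C> \<union> range E))"
    using E(4) closure_mono[of "\<Union>n. E n" "\<Union>(\<C> \<union> range E)"] by auto
  ultimately show ?thesis using cnt by (intro exI[of _ "\<C> \<union> range E"]) auto
qed

text \<open>The scalars are inserted to have a nonempty family when I is empty, that is, at the
  first stage; lying in every unital subalgebra, they do not disturb directedness.\<close>

lemma directed_fd_Union_chain:
  assumes "\<And>t. t \<in> I \<Longrightarrow> directed_fd (C t)" "\<And>s t. s \<in> I \<Longrightarrow> t \<in> I \<Longrightarrow> C s \<subseteq> C t \<or> C t \<subseteq> C s"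
  shows "directed_fd (insert (cvs.span {1}) (\<Union>t\<in>I. C t))"
  unfolding directed_fd_def
proof (intro conjI ballI)
  let ?U = "insert (cvs.span {1}) (\<Union>t\<in>I. C t)"
  show "?U \<noteq> {}" by blast
  show fd: "fd_star_subalgebra X" if "X \<in> ?U" for X
    using that assms(1) fd_star_subalgebra_scalars by (auto simp: directed_fd_def)
  fix D1 D2 assume D: "D1 \<in> ?U" "D2 \<in> ?U"
  have sc: "cvs.span {1} \<subseteq> X" if "X \<in> ?U" for X
    using scalars_subset[OF fd_star_subalgebraD[OF fd[OF that]]] .
  consider "D1 = cvs.span {1}" | "D2 = cvs.span {1}" | s t where "s \<in> I" "t \<in> I" "D1 \<in> C s" "D2 \<in> C t"
    using D by blast
  then show "\<exists>D3\<in>?U. D1 \<union> D2 \<subseteq> D3"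
  proof cases
    case 3
    then obtain r where "r \<in> I" "D1 \<in> C r" "D2 \<in> C r" using assms(2)[of s t] by blast
    then show ?thesis using assms(1)[of r] unfolding directed_fd_def by blast
  qed (use sc D in blast)+
qed

text \<open>\<open>card_of S\<close> orders S in the least possible type, so its proper initial
  segments have fewer elements than S; fewer than aleph 1 means countable.\<close>

lemma countable_initial_segment:
  assumes "(card_of S, aleph1) \<in> ordLeq" "s \<in> S"
  shows "countable (underS (card_of S) s)"
proof -
  have "(card_of (underS (card_of S) s), card_of S) \<in> ordLess"
    using card_of_underS[OF card_of_Card_order, of s S] assms(2) by (simp add: Field_card_of)
  then have "(card_of (underS (card_of S) s), aleph1) \<in> ordLess"
    using assms(1) ordLess_ordLeq_trans by blast
  then have "(card_of (underS (card_of S) s), natLeq) \<in> ordLeq"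
    using cardSuc_ordLess_ordLeq[OF natLeq_Card_order card_of_Card_order] ordLess_ordLeq_trans
      not_ordLess_ordLeq ordLess_or_ordLeq[OF natLeq_Well_order card_of_Well_order]
    by (metis card_of_Card_order cardSuc_ordLess_ordLeq cardSuc_ordLeq_ordLess natLeq_Card_order)
  then show ?thesis
    by (metis card_of_ordLeq card_of_nat countable_def ordIso_symmetric ordLeq_ordIso_trans)
qed

theorem AF_of_locally_fd:
  fixes S :: "'a :: star_banach set"
  assumes LF: "locally_fd TYPE('a)" and dense: "closure S = UNIV" and card: "(card_of S, aleph1) \<in> ordLeq"
  obtains \<D> :: "'a set set" where "directed_fd \<D>" "closure (\<Union>\<D>) = UNIV"
proof -
  define r where "r = card_of S"
  have wo: "Well_order r" unfolding r_def by (rule card_of_Well_order)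
  have Fr: "Field r = S" by (simp add: r_def Field_card_of)
  have wf: "wf (r - Id)" using wo by (simp add: well_order_on_def)
  obtain nxt where nxt: "\<And>\<C> x. directed_fd \<C> \<Longrightarrow> countable \<C> \<Longrightarrow>
      directed_fd (nxt \<C> x) \<and> countable (nxt \<C> x) \<and> \<C> \<subseteq> nxt \<C> x \<and> x \<in> closure (\<Union>(nxt \<C> (x::'a)))"
    using extend_countable_directed[OF LF] by metis
  \<comment> \<open>The union of all earlier families handles first, successor and limit stages
    alike; it is countable because the initial segment is.\<close>
  define pre where "pre f s = insert (cvs.span {1}) (\<Union>t\<in>underS r s. f t)" for f :: "'a \<Rightarrow> 'a set set" and s
  define C where "C = wfrec (r - Id) (\<lambda>f s. nxt (pre f s) s)"
  have C_eq: "C s = nxt (pre C s) s" for s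
  proof -
    have "C s = nxt (pre (cut C (r - Id) s) s) s"
      unfolding C_def using wfrec[OF wf, of "\<lambda>f s. nxt (pre f s) s" s] by simp
    also have "pre (cut C (r - Id) s) s = pre C s"
      by (auto simp: pre_def cut_def underS_def)
    finally show ?thesis .
  qed
  have trans: "trans r" and total: "total_on S r"
    using wo Fr by (auto simp: order_on_defs)
  have underS_S: "underS r s \<subseteq> S" for s using Fr by (auto simp: underS_def Field_def)
  have comparable: "s = t \<or> s \<in> underS r t \<or> t \<in> underS r s" if "s \<in> S" "t \<in> S" for s t
    using that total by (auto simp: total_on_def underS_def)
  \<comment> \<open>Monotonicity belongs to the induction, since it is the chain condition for the
    union taken at s.\<close>
  have good: "s \<in> S \<longrightarrow> directed_fd (C s) \<and> countable (C s) \<and> (\<forall>t\<in>underS r s. C t \<subseteq> C s) \<and> s \<in> closure (\<Union>(C s))" for s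
  proof (induction s rule: wf_induct[OF wf])
    case (1 s)
    show ?case
    proof
      assume s: "s \<in> S"
      have IH: "directed_fd (C t) \<and> countable (C t) \<and> (\<forall>t'\<in>underS r t. C t' \<subseteq> C t)" if "t \<in> underS r s" for t
        using 1 that underS_S by (auto simp: underS_def)
      have "directed_fd (pre C s)"
        unfolding pre_def
      proof (rule directed_fd_Union_chain)
        show "directed_fd (C t)" if "t \<in> underS r s" for t using IH that by blast
        show "C t \<subseteq> C t' \<or> C t' \<subseteq> C t" if "t \<in> underS r s" "t' \<in> underS r s" for t t'
          using IH[OF that(1)] IH[OF that(2)] comparable[of t t'] underS_S that by blast
      qed
      moreover have "countable (pre C s)"
        using IH countable_initial_segment[OF card s] by (auto simp: pre_def r_def)
      ultimately have "directed_fd (C s)" "countable (C s)" "pre C s \<subseteq> C s" "s \<in> closure (\<Union>(C s))"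
        using nxt[of "pre C s" s] C_eq[of s] by auto
      then show "directed_fd (C s) \<and> countable (C s) \<and> (\<forall>t\<in>underS r s. C t \<subseteq> C s) \<and> s \<in> closure (\<Union>(C s))"
        by (auto simp: pre_def)
    qed
  qed
  define \<D> where "\<D> = insert (cvs.span {1}) (\<Union>s\<in>S. C s)"
  have "directed_fd \<D>"
    unfolding \<D>_def
  proof (rule directed_fd_Union_chain)
    show "directed_fd (C t)" if "t \<in> S" for t using good that by blast
    show "C s \<subseteq> C t \<or> C t \<subseteq> C s" if "s \<in> S" "t \<in> S" for s t
      using good comparable[OF that] that by blast
  qed
  moreover have "S \<subseteq> closure (\<Union>\<D>)"
  proof
    fix s assume s: "s \<in> S"
    have "\<Union>(C s) \<subseteq> \<Union>\<D>" using s by (auto simp: \<D>_def)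
    then show "s \<in> closure (\<Union>\<D>)" using good s closure_mono by blast
  qed
  then have "closure (\<Union>\<D>) = UNIV"
    using dense closure_minimal[of S "closure (\<Union>\<D>)"] by auto
  ultimately show thesis by (rule that)
qed

section \<open>Unitization\<close>

hide_const (open) partial_object.carrier ring.add

locale cstar =
  fixes A :: "'a cstar_struct"
  assumes cstar: "cstar_algebra A"
begin

text \<open>The axioms are kept in their quantified form and in the order of the definition: rewrite
  rules are derived from them, and the transport along an injection uses them as they stand.\<close>

lemma cstar_axioms_ball:
  "zer A \<in> carrier A"
  "\<forall>x\<in>carrier A. \<forall>y\<in>carrier A. add A x y \<in> carrier A \<and> mul A x y \<in> carrier A"
  "\<forall>c. \<forall>x\<in>carrier A. smul A c x \<in> carrier A"
  "\<forall>x\<in>carrier A. star A x \<in> carrier A"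
  "\<forall>x\<in>carrier A. \<forall>y\<in>carrier A. \<forall>z\<in>carrier A. add A (add A x y) z = add A x (add A y z)"
  "\<forall>x\<in>carrier A. \<forall>y\<in>carrier A. add A x y = add A y x"
  "\<forall>x\<in>carrier A. add A (zer A) x = x"
  "\<forall>x\<in>carrier A. add A x (smul A (-1) x) = zer A"
  "\<forall>x\<in>carrier A. smul A 1 x = x"
  "\<forall>a b. \<forall>x\<in>carrier A. smul A a (smul A b x) = smul A (a * b) x"
  "\<forall>a b. \<forall>x\<in>carrier A. smul A (a + b) x = add A (smul A a x) (smul A b x)"
  "\<forall>a. \<forall>x\<in>carrier A. \<forall>y\<in>carrier A. smul A a (add A x y) = add A (smul A a x) (smul A a y)"
  "\<forall>x\<in>carrier A. \<forall>y\<in>carrier A. \<forall>z\<in>carrier A. mul A (mul A x y) z = mul A x (mul A y z)"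
  "\<forall>x\<in>carrier A. \<forall>y\<in>carrier A. \<forall>z\<in>carrier A. mul A (add A x y) z = add A (mul A x z) (mul A y z)"
  "\<forall>x\<in>carrier A. \<forall>y\<in>carrier A. \<forall>z\<in>carrier A. mul A x (add A y z) = add A (mul A x y) (mul A x z)"
  "\<forall>a. \<forall>x\<in>carrier A. \<forall>y\<in>carrier A. mul A (smul A a x) y = smul A a (mul A x y)"
  "\<forall>a. \<forall>x\<in>carrier A. \<forall>y\<in>carrier A. mul A x (smul A a y) = smul A a (mul A x y)"
  "\<forall>x\<in>carrier A. star A (star A x) = x"
  "\<forall>x\<in>carrier A. \<forall>y\<in>carrier A. star A (add A x y) = add A (star A x) (star A y)"
  "\<forall>a. \<forall>x\<in>carrier A. star A (smul A a x) = smul A (cnj a) (star A x)"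
  "\<forall>x\<in>carrier A. \<forall>y\<in>carrier A. star A (mul A x y) = mul A (star A y) (star A x)"
  "\<forall>x\<in>carrier A. nrm A x = 0 \<longleftrightarrow> x = zer A"
  "\<forall>x\<in>carrier A. \<forall>y\<in>carrier A. nrm A (add A x y) \<le> nrm A x + nrm A y"
  "\<forall>a. \<forall>x\<in>carrier A. nrm A (smul A a x) = cmod a * nrm A x"
  "\<forall>x\<in>carrier A. \<forall>y\<in>carrier A. nrm A (mul A x y) \<le> nrm A x * nrm A y"
  "\<forall>x\<in>carrier A. nrm A (mul A (star A x) x) = (nrm A x)\<^sup>2"
  "\<forall>f :: nat \<Rightarrow> 'a. (\<forall>n. f n \<in> carrier A) \<longrightarrow>
          (\<forall>e>0. \<exists>N. \<forall>m\<ge>N. \<forall>n\<ge>N. cdist A (f m) (f n) < e) \<longrightarrow>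
          (\<exists>x\<in>carrier A. \<forall>e>0. \<exists>N. \<forall>n\<ge>N. cdist A (f n) x < e)"
  by (insert cstar[unfolded cstar_algebra_def]) (elim conjE, assumption)+

lemmas zer_closed [simp] = cstar_axioms_ball(1)
lemmas add_closed [simp] = cstar_axioms_ball(2)[rule_format, THEN conjunct1]
lemmas mul_closed [simp] = cstar_axioms_ball(2)[rule_format, THEN conjunct2]
lemmas smul_closed [simp] = cstar_axioms_ball(3)[rule_format]
lemmas star_closed [simp] = cstar_axioms_ball(4)[rule_format]
lemmas add_assoc = cstar_axioms_ball(5)[rule_format]
lemmas add_comm = cstar_axioms_ball(6)[rule_format]
lemmas add_zer = cstar_axioms_ball(7)[rule_format]
lemmas add_neg = cstar_axioms_ball(8)[rule_format]
lemmas smul_one = cstar_axioms_ball(9)[rule_format]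
lemmas smul_smul = cstar_axioms_ball(10)[rule_format]
lemmas smul_add_left = cstar_axioms_ball(11)[rule_format]
lemmas smul_add_right = cstar_axioms_ball(12)[rule_format]
lemmas mul_assoc = cstar_axioms_ball(13)[rule_format]
lemmas mul_add_left = cstar_axioms_ball(14)[rule_format]
lemmas mul_add_right = cstar_axioms_ball(15)[rule_format]
lemmas mul_smul_left = cstar_axioms_ball(16)[rule_format]
lemmas mul_smul_right = cstar_axioms_ball(17)[rule_format]
lemmas star_star = cstar_axioms_ball(18)[rule_format]
lemmas star_add = cstar_axioms_ball(19)[rule_format]
lemmas star_smul = cstar_axioms_ball(20)[rule_format]
lemmas star_mul = cstar_axioms_ball(21)[rule_format]
lemmas nrm_eq_0 = cstar_axioms_ball(22)[rule_format]
lemmas nrm_triangle = cstar_axioms_ball(23)[rule_format]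
lemmas nrm_smul = cstar_axioms_ball(24)[rule_format]
lemmas nrm_mul = cstar_axioms_ball(25)[rule_format]
lemmas nrm_star_mul = cstar_axioms_ball(26)[rule_format]
lemmas complete = cstar_axioms_ball(27)[rule_format]

lemma add_left_comm:
  "x \<in> carrier A \<Longrightarrow> y \<in> carrier A \<Longrightarrow> z \<in> carrier A \<Longrightarrow> add A x (add A y z) = add A y (add A x z)"
  by (metis add_assoc add_comm)

lemma add_zer_right: "x \<in> carrier A \<Longrightarrow> add A x (zer A) = x"
  by (metis add_comm add_zer zer_closed)

lemma smul_zero: "x \<in> carrier A \<Longrightarrow> smul A 0 x = zer A"
  using smul_add_left[of x 1 "-1"] by (simp add: smul_one add_neg)

lemma smul_zer: "smul A c (zer A) = zer A"
  using smul_smul[of "zer A" c 0] by (simp add: smul_zero)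

lemma mul_zer: "x \<in> carrier A \<Longrightarrow> mul A x (zer A) = zer A" "x \<in> carrier A \<Longrightarrow> mul A (zer A) x = zer A"
  using mul_smul_right[of x "zer A" 0] mul_smul_left[of "zer A" x 0] by (simp_all add: smul_zero)

lemma star_zer: "star A (zer A) = zer A"
  using star_smul[of "zer A" 0] by (simp add: smul_zero)

lemma nrm_zer: "nrm A (zer A) = 0"
  by (simp add: nrm_eq_0)

lemma nrm_nonneg: "x \<in> carrier A \<Longrightarrow> 0 \<le> nrm A x"
  using nrm_triangle[of x "smul A (-1) x"] by (simp add: add_neg nrm_zer nrm_smul)

lemma nrm_le_nrm_star: "x \<in> carrier A \<Longrightarrow> nrm A x \<le> nrm A (star A x)"
proof -
  assume x: "x \<in> carrier A"
  have "nrm A x * nrm A x \<le> nrm A (star A x) * nrm A x"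
    using nrm_star_mul[OF x] nrm_mul[of "star A x" x] x by (simp add: power2_eq_square)
  then show ?thesis
    using nrm_nonneg[OF x] nrm_nonneg[of "star A x"] x by (cases "nrm A x = 0") auto
qed

lemma nrm_star: "x \<in> carrier A \<Longrightarrow> nrm A (star A x) = nrm A x"
  using nrm_le_nrm_star[of x] nrm_le_nrm_star[of "star A x"] by (simp add: star_star)

end

text \<open>Density treats the elements of F singly, and directedness merges the subalgebras
  obtained.\<close>

lemma is_AF_imp_is_LF:
  assumes "is_AF A"
  shows "is_LF A"
proof -
  obtain \<D> where D: "\<D> \<noteq> {}" "\<And>D. D \<in> \<D> \<Longrightarrow> fd_subalgebra A D"
      "\<And>D1 D2. D1 \<in> \<D> \<Longrightarrow> D2 \<in> \<D> \<Longrightarrow> \<exists>D3\<in>\<D>. D1 \<union> D2 \<subseteq> D3" "dense_in A (\<Union>\<D>)"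
    using assms unfolding is_AF_def by metis
  have "\<exists>D\<in>\<D>. approx_subset A e F D" if "finite F" "F \<subseteq> carrier A" "0 < e" for F e
    using that(1,2)
  proof (induction F)
    case empty
    then show ?case using D(1) by (auto simp: approx_subset_def)
  next
    case (insert x F)
    then obtain D1 where D1: "D1 \<in> \<D>" "approx_subset A e F D1" by auto
    have "\<exists>y\<in>\<Union>\<D>. cdist A x y < e"
      using D(4) insert.prems \<open>0 < e\<close> by (simp add: dense_in_def)
    then obtain D2 y where D2: "D2 \<in> \<D>" "y \<in> D2" "cdist A x y < e" by (meson UnionE)
    obtain D3 where D3: "D3 \<in> \<D>" "D1 \<union> D2 \<subseteq> D3" using D(3)[OF D1(1) D2(1)] by blast
    have "approx_subset A e (insert x F) D3"
      unfolding approx_subset_def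
    proof
      fix z assume "z \<in> insert x F"
      then consider "z = x" | "z \<in> F" by blast
      then show "\<exists>y\<in>D3. cdist A z y < e"
      proof cases
        case 1
        then show ?thesis using D2(2,3) D3(2) by (intro bexI[of _ y]) auto
      next
        case 2
        then obtain y where "y \<in> D1" "cdist A z y < e" using D1(2) by (auto simp: approx_subset_def)
        then show ?thesis using D3(2) by (intro bexI[of _ y]) auto
      qed
    qed
    then show ?case using D3(1) by (rule bexI)
  qed
  then show ?thesis unfolding is_LF_def using D(2) by blast
qed

text \<open>The value of \<open>generic\<close> when no counterexample exists. It makes
  \<open>generic\<close> a C*-algebra in every case, as the unconditional class instances below
  require.\<close>

definition zero_struct :: "'a cstar_struct" where
  "zero_struct = \<lparr>carrier = {undefined}, zer = undefined, add = (\<lambda>_ _. undefined), smul = (\<lambda>_ _. undefined),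
     mul = (\<lambda>_ _. undefined), star = (\<lambda>_. undefined), nrm = (\<lambda>_. 0)\<rparr>"

lemma cstar_algebra_zero_struct: "cstar_algebra zero_struct"
  by (simp add: cstar_algebra_def zero_struct_def cdist_def)

text \<open>A type cannot depend on an algebra given as a term.  The unitization is therefore formed for
  one fixed algebra \<open>generic\<close>: a counterexample to the implication from LF to AF in density at
  most aleph 1, if there is one on the type at hand.  That \<open>generic\<close> is AF
  when it is LF and of density at most aleph 1 then settles all algebras at once.\<close>

definition generic :: "'a cstar_struct" where
  "generic = (let P = (\<lambda>A. cstar_algebra A \<and> density_le A aleph1 \<and> is_LF A \<and> \<not> is_AF A) in
     if \<exists>A. P A then SOME A. P A else zero_struct)"

lemma generic_counterexample:
  fixes A :: "'a cstar_struct"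
  assumes "cstar_algebra A" "density_le A aleph1" "is_LF A" "\<not> is_AF A"
  shows "density_le (generic :: 'a cstar_struct) aleph1 \<and> is_LF (generic :: 'a cstar_struct) \<and>
    \<not> is_AF (generic :: 'a cstar_struct)"
proof -
  let ?P = "\<lambda>A :: 'a cstar_struct. cstar_algebra A \<and> density_le A aleph1 \<and> is_LF A \<and> \<not> is_AF A"
  have ex: "\<exists>A. ?P A" using assms by blast
  then have "generic = (SOME A. ?P A)" by (simp only: generic_def Let_def if_True)
  then show ?thesis using someI_ex[OF ex] by simp
qed

lemma cstar_algebra_generic: "cstar_algebra generic"
proof (cases "\<exists>A :: 'a cstar_struct. cstar_algebra A \<and> density_le A aleph1 \<and> is_LF A \<and> \<not> is_AF A")
  case True
  then show ?thesis using someI_ex[OF True] by (simp add: generic_def Let_def)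
next
  case False
  then show ?thesis by (simp only: generic_def Let_def if_False cstar_algebra_zero_struct)
qed

interpretation gen: cstar "generic :: 'a cstar_struct"
  by unfold_locales (rule cstar_algebra_generic)

text \<open>The pair of x and c stands for x + c 1; a new unit is adjoined even if the algebra
  already has one.\<close>

typedef 'a unitization = "carrier (generic :: 'a cstar_struct) \<times> (UNIV :: complex set)"
  using gen.zer_closed by blast

definition ualg :: "'a unitization \<Rightarrow> 'a" where "ualg u = fst (Rep_unitization u)"
definition uscal :: "'a unitization \<Rightarrow> complex" where "uscal u = snd (Rep_unitization u)"
definition umk :: "'a \<Rightarrow> complex \<Rightarrow> 'a unitization" where "umk x c = Abs_unitization (x, c)"

lemma ualg_closed [simp]: "ualg u \<in> carrier generic"
  using Rep_unitization[of u] by (auto simp: ualg_def)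

lemma umk_sel [simp]: "x \<in> carrier generic \<Longrightarrow> ualg (umk x c) = x" "x \<in> carrier generic \<Longrightarrow> uscal (umk x c) = c"
  by (simp_all add: ualg_def uscal_def umk_def Abs_unitization_inverse)

lemma unitization_eqI: "ualg u = ualg v \<Longrightarrow> uscal u = uscal v \<Longrightarrow> u = v"
  by (metis Rep_unitization_inject prod_eqI ualg_def uscal_def)

lemma unitization_eq_iff: "u = v \<longleftrightarrow> ualg u = ualg v \<and> uscal u = uscal v"
  using unitization_eqI by blast

lemma umk_collapse [simp]: "umk (ualg u) (uscal u) = u"
  by (rule unitization_eqI) simp_all

instantiation unitization :: (type) real_normed_algebra_1
begin

definition zero_unitization where "0 = umk (zer generic) 0"
definition one_unitization where "1 = umk (zer generic) 1"
definition plus_unitization where "u + v = umk (add generic (ualg u) (ualg v)) (uscal u + uscal v)"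
definition uminus_unitization where "- u = umk (smul generic (-1) (ualg u)) (- uscal u)" for u :: "'a unitization"
definition minus_unitization where "u - v = u + - v" for u :: "'a unitization"
definition times_unitization where "u * v =
  umk (add generic (mul generic (ualg u) (ualg v))
        (add generic (smul generic (uscal u) (ualg v)) (smul generic (uscal v) (ualg u))))
      (uscal u * uscal v)"
definition scaleR_unitization where "r *\<^sub>R u = umk (smul generic (of_real r) (ualg u)) (of_real r * uscal u)" for u :: "'a unitization"
text \<open>The sum norm is submultiplicative and complete, and the involution is isometric for it.
  It is not a C*-norm in general, which explains the form of \<open>star_banach\<close>.\<close>

definition norm_unitization where "norm u = nrm generic (ualg u) + cmod (uscal u)"
definition dist_unitization where "dist u v = norm (u - v)" for u v :: "'a unitization"
definition sgn_unitization where "sgn u = inverse (norm u) *\<^sub>R u" for u :: "'a unitization"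
definition uniformity_unitization where
  "(uniformity :: ('a unitization \<times> 'a unitization) filter) = (INF e\<in>{0 <..}. principal {(x, y). dist x y < e})"
definition open_unitization where
  "open (U :: 'a unitization set) \<longleftrightarrow> (\<forall>x\<in>U. eventually (\<lambda>(x', y). x' = x \<longrightarrow> y \<in> U) uniformity)"

lemma unitization_sel:
  "ualg (0 :: 'a unitization) = zer generic" "uscal (0 :: 'a unitization) = 0"
  "ualg (1 :: 'a unitization) = zer generic" "uscal (1 :: 'a unitization) = 1"
  "ualg (u + v) = add generic (ualg u) (ualg v)" "uscal (u + v) = uscal u + uscal v"
  "ualg (- u) = smul generic (-1) (ualg u)" "uscal (- u) = - uscal u"
  "ualg (u - v) = add generic (ualg u) (smul generic (-1) (ualg v))" "uscal (u - v) = uscal u - uscal v"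
  "ualg (u * v) = add generic (mul generic (ualg u) (ualg v))
        (add generic (smul generic (uscal u) (ualg v)) (smul generic (uscal v) (ualg u)))"
  "uscal (u * v) = uscal u * uscal v"
  "ualg (r *\<^sub>R u) = smul generic (of_real r) (ualg u)" "uscal (r *\<^sub>R u) = of_real r * uscal u"
  for u v :: "'a unitization"
  by (simp_all add: zero_unitization_def one_unitization_def plus_unitization_def
      uminus_unitization_def minus_unitization_def times_unitization_def scaleR_unitization_def)

lemmas gen_simps = gen.add_assoc gen.add_comm gen.add_left_comm gen.add_zer gen.add_zer_right gen.add_neg
  gen.smul_one gen.smul_smul gen.smul_add_left gen.smul_add_right gen.mul_assoc gen.mul_add_left gen.mul_add_right
  gen.mul_smul_left gen.mul_smul_right gen.star_star gen.star_add gen.star_smul gen.star_mul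
  gen.smul_zero gen.smul_zer gen.mul_zer gen.star_zer

instance
proof
  fix a b c :: "'a unitization" and x y :: real
  show "a + b + c = a + (b + c)" by (rule unitization_eqI) (simp_all add: unitization_sel gen.add_assoc)
  show "a + b = b + a" by (rule unitization_eqI) (simp_all add: unitization_sel gen.add_comm)
  show "0 + a = a" by (rule unitization_eqI) (simp_all add: unitization_sel gen.add_zer)
  show "- a + a = 0" by (rule unitization_eqI) (simp_all add: unitization_sel gen.add_neg gen.add_comm)
  show "a - b = a + - b" by (simp add: minus_unitization_def)
  show "x *\<^sub>R (a + b) = x *\<^sub>R a + x *\<^sub>R b"
    by (rule unitization_eqI) (simp_all add: unitization_sel gen.smul_add_right algebra_simps)
  show "(x + y) *\<^sub>R a = x *\<^sub>R a + y *\<^sub>R a"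
    by (rule unitization_eqI) (simp_all add: unitization_sel gen.smul_add_left algebra_simps)
  show "x *\<^sub>R y *\<^sub>R a = (x * y) *\<^sub>R a"
    by (rule unitization_eqI) (simp_all add: unitization_sel gen.smul_smul)
  show "1 *\<^sub>R a = a" by (rule unitization_eqI) (simp_all add: unitization_sel gen.smul_one)
  show "a * b * c = a * (b * c)"
    by (rule unitization_eqI) (simp_all add: unitization_sel gen_simps mult_ac)
  show "(a + b) * c = a * c + b * c"
    by (rule unitization_eqI) (simp_all add: unitization_sel gen_simps algebra_simps)
  show "a * (b + c) = a * b + a * c"
    by (rule unitization_eqI) (simp_all add: unitization_sel gen_simps algebra_simps)
  show "1 * a = a" by (rule unitization_eqI) (simp_all add: unitization_sel gen_simps)
  show "a * 1 = a" by (rule unitization_eqI) (simp_all add: unitization_sel gen_simps)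
  show "x *\<^sub>R a * b = x *\<^sub>R (a * b)"
    by (rule unitization_eqI) (simp_all add: unitization_sel gen_simps mult_ac)
  show "a * x *\<^sub>R b = x *\<^sub>R (a * b)"
    by (rule unitization_eqI) (simp_all add: unitization_sel gen_simps mult_ac)
  show "(0 :: 'a unitization) \<noteq> 1" by (simp add: unitization_eq_iff unitization_sel)
  show "dist a b = norm (a - b)" by (simp add: dist_unitization_def)
  show "sgn a = inverse (norm a) *\<^sub>R a" by (simp add: sgn_unitization_def)
  show "(uniformity :: ('a unitization \<times> 'a unitization) filter) = (INF e\<in>{0 <..}. principal {(x, y). dist x y < e})"
    by (rule uniformity_unitization_def)
  show "open U \<longleftrightarrow> (\<forall>x\<in>U. eventually (\<lambda>(x', y). x' = x \<longrightarrow> y \<in> U) uniformity)" for U :: "'a unitization set"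
    by (rule open_unitization_def)
  show "norm a = 0 \<longleftrightarrow> a = 0"
    using gen.nrm_nonneg[of "ualg a"]
    by (auto simp: norm_unitization_def unitization_eq_iff unitization_sel gen.nrm_eq_0 add_nonneg_eq_0_iff)
  show "norm (a + b) \<le> norm a + norm b"
    using gen.nrm_triangle[of "ualg a" "ualg b"] norm_triangle_ineq[of "uscal a" "uscal b"]
    by (simp add: norm_unitization_def unitization_sel)
  show "norm (x *\<^sub>R a) = \<bar>x\<bar> * norm a"
    by (simp add: norm_unitization_def unitization_sel gen.nrm_smul norm_mult distrib_left)
  show "norm (a * b) \<le> norm a * norm b"
  proof -
    let ?A = "mul generic (ualg a) (ualg b)" and ?B = "smul generic (uscal a) (ualg b)"
      and ?C = "smul generic (uscal b) (ualg a)"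
    have "nrm generic (add generic ?A (add generic ?B ?C)) \<le> nrm generic ?A + nrm generic (add generic ?B ?C)"
      by (rule gen.nrm_triangle) simp_all
    also have "\<dots> \<le> nrm generic (ualg a) * nrm generic (ualg b) +
        (cmod (uscal a) * nrm generic (ualg b) + cmod (uscal b) * nrm generic (ualg a))"
      using gen.nrm_mul[of "ualg a" "ualg b"] gen.nrm_triangle[of ?B ?C] by (simp add: gen.nrm_smul)
    finally show ?thesis
      by (simp add: norm_unitization_def unitization_sel norm_mult algebra_simps)
  qed
  show "norm (1 :: 'a unitization) = 1" by (simp add: norm_unitization_def unitization_sel gen.nrm_zer)
qed

end

instantiation unitization :: (type) star_banach
begin

definition scaleC_unitization where "c *\<^sub>C u = umk (smul generic c (ualg u)) (c * uscal u)" for u :: "'a unitization"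
definition adj_unitization where "adj u = umk (star generic (ualg u)) (cnj (uscal u))"

lemma unitization_star_sel:
  "ualg (c *\<^sub>C u) = smul generic c (ualg u)" "uscal (c *\<^sub>C u) = c * uscal u"
  "ualg (adj u) = star generic (ualg u)" "uscal (adj u) = cnj (uscal u)"
  for u :: "'a unitization"
  by (simp_all add: scaleC_unitization_def adj_unitization_def)

instance
proof
  fix a b :: "'a unitization" and x :: real and k l :: complex
  show "k *\<^sub>C (a + b) = k *\<^sub>C a + k *\<^sub>C b"
    by (rule unitization_eqI) (simp_all add: unitization_sel unitization_star_sel gen.smul_add_right algebra_simps)
  show "(k + l) *\<^sub>C a = k *\<^sub>C a + l *\<^sub>C a"
    by (rule unitization_eqI) (simp_all add: unitization_sel unitization_star_sel gen.smul_add_left algebra_simps)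
  show "k *\<^sub>C (l *\<^sub>C a) = (k * l) *\<^sub>C a"
    by (rule unitization_eqI) (simp_all add: unitization_sel unitization_star_sel gen.smul_smul)
  show "of_real x *\<^sub>C a = x *\<^sub>R a" by (simp add: scaleR_unitization_def scaleC_unitization_def)
  show "(k *\<^sub>C a) * b = k *\<^sub>C (a * b)"
    by (rule unitization_eqI) (simp_all add: unitization_sel unitization_star_sel gen_simps mult_ac)
  show "a * (k *\<^sub>C b) = k *\<^sub>C (a * b)"
    by (rule unitization_eqI) (simp_all add: unitization_sel unitization_star_sel gen_simps mult_ac)
  show "norm (k *\<^sub>C a) = cmod k * norm a"
    by (simp add: norm_unitization_def unitization_sel unitization_star_sel gen.nrm_smul norm_mult distrib_left)
  show "adj (adj a) = a" by (rule unitization_eqI) (simp_all add: unitization_sel unitization_star_sel gen_simps)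
  show "adj (a + b) = adj a + adj b" by (rule unitization_eqI) (simp_all add: unitization_sel unitization_star_sel gen_simps)
  show "adj (a * b) = adj b * adj a"
    by (rule unitization_eqI) (simp_all add: unitization_sel unitization_star_sel gen_simps mult_ac)
  show "adj (k *\<^sub>C a) = cnj k *\<^sub>C adj a" by (rule unitization_eqI) (simp_all add: unitization_sel unitization_star_sel gen_simps)
  show "norm (adj a) = norm a" by (simp add: norm_unitization_def unitization_sel unitization_star_sel gen.nrm_star)
  show "a = 0" if "adj a * a = 0"
  proof -
    \<comment> \<open>The scalar part of \<open>adj a * a\<close> is the squared modulus of the
      scalar part of a; once it vanishes, the C*-identity of \<open>generic\<close> deals with the
      rest.\<close>
    have "cnj (uscal a) * uscal a = 0" using that by (simp add: unitization_eq_iff unitization_sel unitization_star_sel)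
    then have c: "uscal a = 0" by simp
    have "mul generic (star generic (ualg a)) (ualg a) = zer generic"
      using that c by (simp add: unitization_eq_iff unitization_sel unitization_star_sel gen.smul_zero gen.add_zer_right)
    then have "nrm generic (ualg a) = 0" using gen.nrm_star_mul[of "ualg a"] by (simp add: gen.nrm_zer)
    then show ?thesis using c by (simp add: unitization_eq_iff unitization_sel unitization_star_sel gen.nrm_eq_0)
  qed
next
  fix X :: "nat \<Rightarrow> 'a unitization"
  assume X: "Cauchy X"
  have le1: "cdist generic (ualg (X m)) (ualg (X n)) \<le> dist (X m) (X n)" for m n
    by (simp add: cdist_def dist_unitization_def norm_unitization_def unitization_sel unitization_star_sel)
  have le2: "dist (uscal (X m)) (uscal (X n)) \<le> dist (X m) (X n)" for m n
    by (simp add: dist_norm[of "uscal (X m)"] dist_unitization_def norm_unitization_def unitization_sel unitization_star_sel gen.nrm_nonneg)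
  have "\<exists>N. \<forall>m\<ge>N. \<forall>n\<ge>N. cdist generic (ualg (X m)) (ualg (X n)) < e" if "0 < e" for e
    using metric_CauchyD[OF X that] le1 by (meson le_less_trans)
  then obtain a where a: "a \<in> carrier generic" "\<And>e. e > 0 \<Longrightarrow> \<exists>N. \<forall>n\<ge>N. cdist generic (ualg (X n)) a < e"
    using gen.complete[of "\<lambda>n. ualg (X n)"] by (meson ualg_closed)
  have "Cauchy (\<lambda>n. uscal (X n))"
    by (rule metric_CauchyI) (use metric_CauchyD[OF X] le2 in \<open>meson le_less_trans\<close>)
  then obtain c where c: "(\<lambda>n. uscal (X n)) \<longlonglongrightarrow> c" using Cauchy_convergent convergent_def by blast
  have "X \<longlonglongrightarrow> umk a c"
  proof (rule metric_LIMSEQ_I)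
    fix e :: real assume "0 < e"
    then have e2: "0 < e / 2" by simp
    obtain N1 where N1: "\<And>n. n \<ge> N1 \<Longrightarrow> cdist generic (ualg (X n)) a < e / 2" using a(2)[OF e2] by blast
    obtain N2 where N2: "\<And>n. n \<ge> N2 \<Longrightarrow> dist (uscal (X n)) c < e / 2" using metric_LIMSEQ_D[OF c e2] by blast
    have "dist (X n) (umk a c) < e" if "n \<ge> max N1 N2" for n
      using N1[of n] N2[of n] that a(1)
      by (simp add: cdist_def dist_unitization_def norm_unitization_def unitization_sel unitization_star_sel dist_norm[of "uscal (X n)"])
    then show "\<exists>no. \<forall>n\<ge>no. dist (X n) (umk a c) < e" by blast
  qed
  then show "convergent X" by (auto simp: convergent_def)
qed

end

section \<open>Passage between an algebra and its unitization\<close>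

lemma unitization_split: "u = umk (ualg u) 0 + uscal u *\<^sub>C 1"
  by (rule unitization_eqI)
     (simp_all add: unitization_sel unitization_star_sel gen.smul_zer gen.add_zer_right)

lemma lin_span_generic_closed:
  assumes "B \<subseteq> carrier generic" "x \<in> lin_span generic B"
  shows "x \<in> carrier generic"
  using assms(2,1) by induction auto

lemma lin_span_imp_span:
  fixes B :: "'a set"
  assumes B: "B \<subseteq> carrier generic" and x: "x \<in> lin_span generic B"
  shows "umk x 0 \<in> cvs.span ((\<lambda>b. umk b 0) ` B)"
  using x
proof induction
  case span_zero
  have "umk (zer (generic :: 'a cstar_struct)) 0 = 0" by (simp add: zero_unitization_def)
  then show ?case by (simp add: cvs.span_zero)
next
  case (span_base x)
  then show ?case by (intro cvs.span_base) auto
next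
  case (span_add x y)
  have "umk (add generic x y) 0 = umk x 0 + umk y 0"
    using span_add lin_span_generic_closed[OF B] by (intro unitization_eqI) (simp_all add: unitization_sel)
  then show ?case using span_add cvs.span_add by simp
next
  case (span_smul x c)
  have "umk (smul generic c x) 0 = c *\<^sub>C umk x 0"
    using span_smul lin_span_generic_closed[OF B] by (intro unitization_eqI) (simp_all add: unitization_star_sel)
  then show ?case using span_smul cvs.span_scale by simp
qed

lemma fd_star_subalgebra_unitization:
  assumes D: "fd_subalgebra generic D"
  shows "fd_star_subalgebra {u. ualg u \<in> D}"
proof -
  have DD: "D \<subseteq> carrier generic" "zer generic \<in> D" "\<And>x y. x \<in> D \<Longrightarrow> y \<in> D \<Longrightarrow> add generic x y \<in> D"
      "\<And>x y. x \<in> D \<Longrightarrow> y \<in> D \<Longrightarrow> mul generic x y \<in> D" "\<And>c x. x \<in> D \<Longrightarrow> smul generic c x \<in> D"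
      "\<And>x. x \<in> D \<Longrightarrow> star generic x \<in> D"
    using D by (auto simp: fd_subalgebra_def)
  obtain B where B: "finite B" "B \<subseteq> D" "D \<subseteq> lin_span generic B"
    using D by (auto simp: fd_subalgebra_def)
  have sub: "star_subalgebra {u. ualg u \<in> D}"
    unfolding star_subalgebra_def cvs.subspace_def
    using DD by (auto simp: unitization_sel unitization_star_sel)
  let ?B = "insert 1 ((\<lambda>b. umk b 0) ` B)"
  have "{u. ualg u \<in> D} = cvs.span ?B"
  proof
    show "{u. ualg u \<in> D} \<subseteq> cvs.span ?B"
    proof
      fix u :: "'a unitization" assume "u \<in> {u. ualg u \<in> D}"
      then have "ualg u \<in> lin_span generic B" using B(3) by auto
      then have "umk (ualg u) 0 \<in> cvs.span ((\<lambda>b. umk b 0) ` B)"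
        using B(2) DD(1) by (intro lin_span_imp_span) auto
      then have "umk (ualg u) 0 \<in> cvs.span ?B" using cvs.span_mono[of "(\<lambda>b. umk b 0) ` B" ?B] by blast
      moreover have "uscal u *\<^sub>C 1 \<in> cvs.span ?B" by (intro cvs.span_scale cvs.span_base) simp
      ultimately have "umk (ualg u) 0 + uscal u *\<^sub>C 1 \<in> cvs.span ?B" by (rule cvs.span_add)
      then show "u \<in> cvs.span ?B" using unitization_split[of u] by simp
    qed
    show "cvs.span ?B \<subseteq> {u. ualg u \<in> D}"
    proof (rule cvs.span_minimal)
      show "?B \<subseteq> {u. ualg u \<in> D}" using B(2) DD(1,2) by (auto simp: unitization_sel subset_iff)
      show "cvs.subspace {u. ualg u \<in> D}" using sub by (simp add: star_subalgebra_def)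
    qed
  qed
  then show ?thesis
    unfolding fd_star_subalgebra_def using sub B(1) by (intro conjI exI[of _ ?B]) simp_all
qed

lemma norm_umk_diff:
  assumes "x \<in> carrier generic" "y \<in> carrier generic"
  shows "norm (umk x c - umk y d) = cdist generic x y + cmod (c - d)"
  using assms by (simp add: norm_unitization_def unitization_sel cdist_def)

lemma cdist_ualg_le: "cdist generic (ualg u) (ualg v) \<le> norm (u - v)"
  using norm_umk_diff[of "ualg u" "ualg v" "uscal u" "uscal v"] by simp

lemma locally_fd_unitization:
  assumes LF: "is_LF (generic :: 'a cstar_struct)"
  shows "locally_fd TYPE('a unitization)"
  unfolding locally_fd_def
proof (intro allI impI)
  fix X :: "'a unitization set" and \<epsilon> :: real assume X: "finite X" and \<epsilon>: "0 < \<epsilon>"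
  have "finite (ualg ` X) \<and> ualg ` X \<subseteq> carrier generic \<and> 0 < \<epsilon>" using X \<epsilon> by auto
  then obtain D where D: "fd_subalgebra generic D" "approx_subset generic \<epsilon> (ualg ` X) D"
    using LF unfolding is_LF_def by meson
  have Dc: "D \<subseteq> carrier generic" using D(1) by (simp add: fd_subalgebra_def)
  have "\<exists>g\<in>{u. ualg u \<in> D}. norm (g - x) < \<epsilon>" if x: "x \<in> X" for x
  proof -
    obtain y where y: "y \<in> D" "cdist generic (ualg x) y < \<epsilon>" using D(2) x by (auto simp: approx_subset_def)
    have yc: "y \<in> carrier generic" using y(1) Dc by blast
    have "norm (x - umk y (uscal x)) < \<epsilon>"
      using norm_umk_diff[of "ualg x" y "uscal x" "uscal x"] yc y(2) by simp
    then have "norm (umk y (uscal x) - x) < \<epsilon>" by (simp add: norm_minus_commute)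
    then show ?thesis using y(1) yc by (intro bexI[of _ "umk y (uscal x)"]) auto
  qed
  then show "\<exists>G. fd_star_subalgebra G \<and> (\<forall>x\<in>X. \<exists>g\<in>G. norm (g - x) < \<epsilon>)"
    using fd_star_subalgebra_unitization[OF D(1)] by blast
qed

lemma density_unitization:
  assumes "density_le (generic :: 'a cstar_struct) aleph1"
  obtains S :: "'a unitization set" where "closure S = UNIV" "(card_of S, aleph1) \<in> ordLeq"
proof -
  obtain S where S: "dense_in (generic :: 'a cstar_struct) S" "(card_of S, aleph1) \<in> ordLeq"
    using assms by (auto simp: density_le_def)
  have Sc: "S \<subseteq> carrier generic" using S(1) by (simp add: dense_in_def)
  obtain Q :: "complex set" where Q: "countable Q" "\<And>U. open U \<Longrightarrow> U \<noteq> {} \<Longrightarrow> \<exists>d\<in>Q. d \<in> U"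
    using countable_dense_exists by metis
  define S' where "S' = (\<lambda>(s, q). umk s q) ` (S \<times> Q)"
  have "u \<in> closure S'" for u
    unfolding closure_approachable
  proof (intro allI impI)
    fix e :: real assume "0 < e"
    then have e2: "0 < e / 2" by simp
    obtain s where s: "s \<in> S" "cdist generic (ualg u) s < e / 2"
      using S(1) e2 ualg_closed[of u] unfolding dense_in_def by meson
    obtain q where q: "q \<in> Q" "q \<in> ball (uscal u) (e / 2)"
      using Q(2)[of "ball (uscal u) (e / 2)"] e2 by auto
    have sc: "s \<in> carrier generic" using s(1) Sc by blast
    have "norm (u - umk s q) < e"
      using norm_umk_diff[of "ualg u" s "uscal u" q] sc s(2) q(2) by (simp add: dist_norm)
    then have "dist (umk s q) u < e" by (simp add: dist_norm norm_minus_commute)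
    then show "\<exists>y\<in>S'. dist y u < e" using s(1) q(1) by (auto simp: S'_def)
  qed
  then have "closure S' = UNIV" by blast
  moreover have "(card_of S', aleph1) \<in> ordLeq"
  proof -
    have "(card_of Q, natLeq) \<in> ordLeq"
      using Q(1) by (metis card_of_nat countable_def card_of_ordLeq ordLeq_ordIso_trans subset_UNIV)
    then have "(card_of Q, aleph1) \<in> ordLeq"
      using cardSuc_greater[OF natLeq_Card_order] ordLeq_ordLess_trans ordLess_imp_ordLeq by blast
    moreover have "\<not> finite (Field aleph1)"
      using cardSuc_finite[OF natLeq_Card_order] by (simp add: Field_natLeq)
    ultimately have "(card_of (S \<times> Q), aleph1) \<in> ordLeq"
      using S(2) cardSuc_Card_order[OF natLeq_Card_order] by (intro card_of_Times_ordLeq_infinite_Field) auto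
    then show ?thesis unfolding S'_def using card_of_image ordLeq_transitive by blast
  qed
  ultimately show thesis by (rule that)
qed

text \<open>The projection \<open>ualg\<close> is not multiplicative. But D contains 1, hence also
  each u without its scalar part, and between elements of scalar part 0 the projection does respect
  products.\<close>

lemma fd_subalgebra_ualg:
  assumes D: "fd_star_subalgebra D"
  shows "fd_subalgebra generic (ualg ` D)"
proof -
  note DD = star_subalgebraD[OF fd_star_subalgebraD[OF D]]
  have emb: "umk (ualg u) 0 \<in> D" if "u \<in> D" for u
  proof -
    have "umk (ualg u) 0 = u - uscal u *\<^sub>C 1"
      using unitization_split[of u] by (simp add: algebra_simps)
    then show ?thesis using that DD(2,4,6) by simp
  qed
  obtain B where B: "finite B" "D = cvs.span B" using D by (auto simp: fd_star_subalgebra_def)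
  have "ualg u \<in> lin_span generic (ualg ` B)" if "u \<in> cvs.span B" for u
    using that
  proof (induction rule: cvs.span_induct_alt)
    case base
    then show ?case by (simp add: unitization_sel lin_span.span_zero)
  next
    case (step c x y)
    then show ?case
      unfolding unitization_sel unitization_star_sel
      by (blast intro: lin_span.span_add lin_span.span_smul lin_span.span_base)
  qed
  then have span: "\<exists>B. finite B \<and> B \<subseteq> ualg ` D \<and> ualg ` D \<subseteq> lin_span generic B"
    using B cvs.span_superset[of B] by (intro exI[of _ "ualg ` B"]) auto
  have cl: "add generic (ualg u) (ualg v) \<in> ualg ` D" "mul generic (ualg u) (ualg v) \<in> ualg ` D"
      "smul generic c (ualg u) \<in> ualg ` D" "star generic (ualg u) \<in> ualg ` D"
    if "u \<in> D" "v \<in> D" for u v c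
  proof -
    have "ualg (u + v) \<in> ualg ` D" "ualg (umk (ualg u) 0 * umk (ualg v) 0) \<in> ualg ` D"
        "ualg (c *\<^sub>C u) \<in> ualg ` D" "ualg (adj u) \<in> ualg ` D"
      by (intro imageI DD(3,5,6,8) emb that)+
    then show "add generic (ualg u) (ualg v) \<in> ualg ` D" "mul generic (ualg u) (ualg v) \<in> ualg ` D"
        "smul generic c (ualg u) \<in> ualg ` D" "star generic (ualg u) \<in> ualg ` D"
      by (simp_all add: unitization_sel unitization_star_sel gen.smul_zero gen.add_zer_right)
  qed
  have z: "zer generic \<in> ualg ` D" using DD(1) by (metis image_eqI unitization_sel(1))
  show ?thesis
    unfolding fd_subalgebra_def using cl z span by (auto simp del: image_subset_iff)
qed

lemma is_AF_generic:
  assumes "density_le (generic :: 'a cstar_struct) aleph1" "is_LF (generic :: 'a cstar_struct)"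
  shows "is_AF (generic :: 'a cstar_struct)"
proof -
  obtain S :: "'a unitization set" where S: "closure S = UNIV" "(card_of S, aleph1) \<in> ordLeq"
    using density_unitization[OF assms(1)] by blast
  obtain \<D> :: "'a unitization set set" where D: "directed_fd \<D>" "closure (\<Union>\<D>) = UNIV"
    using AF_of_locally_fd[OF locally_fd_unitization[OF assms(2)] S] by blast
  define \<E> where "\<E> = (`) ualg ` \<D>"
  have "\<E> \<noteq> {}" using D(1) by (auto simp: \<E>_def directed_fd_def)
  moreover have "\<forall>E\<in>\<E>. fd_subalgebra generic E"
    using D(1) fd_subalgebra_ualg by (auto simp: \<E>_def directed_fd_def)
  moreover have "\<exists>E3\<in>\<E>. E1 \<union> E2 \<subseteq> E3" if "E1 \<in> \<E>" "E2 \<in> \<E>" for E1 E2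
  proof -
    obtain D1 D2 where D12: "D1 \<in> \<D>" "D2 \<in> \<D>" "E1 = ualg ` D1" "E2 = ualg ` D2" using \<open>E1 \<in> \<E>\<close> \<open>E2 \<in> \<E>\<close> by (auto simp: \<E>_def)
    obtain D3 where "D3 \<in> \<D>" "D1 \<union> D2 \<subseteq> D3" using D(1) D12(1,2) unfolding directed_fd_def by meson
    then show ?thesis using D12(3,4) by (intro bexI[of _ "ualg ` D3"]) (auto simp: \<E>_def)
  qed
  moreover have "dense_in generic (\<Union>\<E>)"
    unfolding dense_in_def
  proof (intro conjI ballI allI impI)
    show "\<Union>\<E> \<subseteq> carrier generic" by (auto simp: \<E>_def)
    fix x :: 'a and e :: real assume x: "x \<in> carrier generic" and e: "0 < e"
    have "umk x 0 \<in> closure (\<Union>\<D>)" using D(2) by simp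
    then obtain u where u: "u \<in> \<Union>\<D>" "dist u (umk x 0) < e"
      using e unfolding closure_approachable by blast
    have "cdist generic x (ualg u) < e"
      using cdist_ualg_le[of "umk x 0" u] x u(2) by (simp add: dist_norm norm_minus_commute)
    then show "\<exists>y\<in>\<Union>\<E>. cdist generic x y < e" using u(1) by (intro bexI[of _ "ualg u"]) (auto simp: \<E>_def)
  qed
  ultimately show ?thesis unfolding is_AF_def by (intro exI[of _ \<E>] conjI ballI) simp_all
qed

theorem is_AF_iff_is_LF:
  fixes A :: "'a cstar_struct"
  assumes "cstar_algebra A" "density_le A aleph1"
  shows "is_AF A \<longleftrightarrow> is_LF A"
  using is_AF_imp_is_LF[of A] generic_counterexample[OF assms] is_AF_generic by blast

section \<open>Two by two matrices\<close>

type_synonym cmat2 = "complex^2^2"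

definition opn :: "cmat2 \<Rightarrow> real" where
  "opn M = onorm (\<lambda>v. M *v v)"

definition madj :: "cmat2 \<Rightarrow> cmat2" where
  "madj M = (\<chi> i j. cnj (M $ j $ i))"

definition msc :: "complex \<Rightarrow> cmat2 \<Rightarrow> cmat2" where
  "msc c M = (\<chi> i j. c * M $ i $ j)"

lemma opn_ge: "norm (M *v v) \<le> opn M * norm v"
  unfolding opn_def by (rule onorm[OF matrix_vector_mul_bounded_linear])

lemma opn_le: "(\<And>v. norm (M *v v) \<le> b * norm v) \<Longrightarrow> opn M \<le> b"
  unfolding opn_def by (rule onorm_le)

lemma opn_nonneg [simp]: "0 \<le> opn M"
  unfolding opn_def by (rule onorm_pos_le[OF matrix_vector_mul_bounded_linear])

lemma opn_eq_0: "opn M = 0 \<longleftrightarrow> M = 0"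
  unfolding opn_def onorm_eq_0[OF matrix_vector_mul_bounded_linear]
  using matrix_eq[of M 0] by simp

lemma opn_zero [simp]: "opn 0 = 0"
  by (simp add: opn_eq_0)

lemma opn_triangle: "opn (M + N) \<le> opn M + opn N"
proof (rule opn_le)
  fix v
  show "norm ((M + N) *v v) \<le> (opn M + opn N) * norm v"
    using norm_triangle_ineq[of "M *v v" "N *v v"] opn_ge[of M v] opn_ge[of N v]
    by (simp add: matrix_vector_mult_add_rdistrib distrib_right)
qed

lemma msc_mult_vec: "msc c M *v v = c *s (M *v v)"
  by (simp add: Finite_Cartesian_Product.vec_eq_iff msc_def matrix_vector_mult_def sum_distrib_left mult.assoc)

lemma norm_complex_smult: "norm (c *s v) = cmod c * norm (v :: complex^2)"
  by (simp add: norm_vec_def L2_set_def norm_mult power_mult_distrib real_sqrt_mult flip: sum_distrib_left)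

lemma opn_msc: "opn (msc c M) = cmod c * opn M"
proof -
  have le: "opn (msc c M) \<le> cmod c * opn M" for c M
    by (rule opn_le) (simp add: msc_mult_vec norm_complex_smult opn_ge mult_left_mono mult.assoc)
  show ?thesis
  proof (cases "c = 0")
    case True
    then show ?thesis by (simp add: opn_eq_0 msc_def Finite_Cartesian_Product.vec_eq_iff)
  next
    case False
    then have "msc (inverse c) (msc c M) = M" by (simp add: msc_def Finite_Cartesian_Product.vec_eq_iff)
    then have "opn M \<le> inverse (cmod c) * opn (msc c M)"
      using le[of "inverse c" "msc c M"] by (simp add: norm_inverse)
    then show ?thesis using le[of c M] False by (simp add: field_simps)
  qed
qed

lemma opn_mult: "opn (M ** N) \<le> opn M * opn N"
proof (rule opn_le)
  fix v
  have "norm ((M ** N) *v v) \<le> opn M * norm (N *v v)"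
    using opn_ge[of M "N *v v"] by (simp add: matrix_vector_mul_assoc)
  also have "\<dots> \<le> opn M * (opn N * norm v)"
    by (intro mult_left_mono opn_ge opn_nonneg)
  finally show "norm ((M ** N) *v v) \<le> opn M * opn N * norm v" by (simp add: mult.assoc)
qed

text \<open>The inner product on \<open>complex^2\<close> is the real part of the Hermitian one.
  That suffices for the C*-identity, which only evaluates it at v and the image of v under
  \<open>madj M ** M\<close>.\<close>

lemma inner_madj: "(M *v v) \<bullet> w = v \<bullet> (madj M *v w)"
  by (simp add: inner_vec_def inner_complex_def matrix_vector_mult_def madj_def sum_2 algebra_simps)

lemma madj_madj: "madj (madj M) = M"
  by (simp add: madj_def Finite_Cartesian_Product.vec_eq_iff)

lemma opn_star_mult_ge: "(opn M)\<^sup>2 \<le> opn (madj M ** M)"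
proof -
  have "opn M \<le> sqrt (opn (madj M ** M))"
  proof (rule opn_le)
    fix v
    have "(norm (M *v v))\<^sup>2 = v \<bullet> ((madj M ** M) *v v)"
      by (simp add: power2_norm_eq_inner inner_madj matrix_vector_mul_assoc)
    also have "\<dots> \<le> norm v * (opn (madj M ** M) * norm v)"
      by (rule order_trans[OF norm_cauchy_schwarz]) (intro mult_left_mono opn_ge norm_ge_zero)
    also have "\<dots> = (sqrt (opn (madj M ** M)) * norm v)\<^sup>2"
      by (simp add: power_mult_distrib power2_eq_square)
    finally show "norm (M *v v) \<le> sqrt (opn (madj M ** M)) * norm v"
      by (rule power2_le_imp_le) simp
  qed
  then show ?thesis using power_mono[of "opn M" "sqrt (opn (madj M ** M))" 2] by simp
qed

lemma opn_le_opn_madj: "opn M \<le> opn (madj M)"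
proof -
  have "opn M * opn M \<le> opn (madj M) * opn M"
    using opn_star_mult_ge[of M] opn_mult[of "madj M" M] by (simp add: power2_eq_square)
  then show ?thesis using opn_nonneg[of M] opn_nonneg[of "madj M"] by (cases "opn M = 0") auto
qed

lemma opn_madj: "opn (madj M) = opn M"
  using opn_le_opn_madj[of M] opn_le_opn_madj[of "madj M"] by (simp add: madj_madj)

lemma opn_star_mult: "opn (madj M ** M) = (opn M)\<^sup>2"
  using opn_star_mult_ge[of M] opn_mult[of "madj M" M] by (simp add: opn_madj power2_eq_square)

lemma entry_le_opn: "cmod (M $ i $ j) \<le> opn M"
proof -
  have "(M *v axis j 1) $ i = M $ i $ j"
    by (simp add: matrix_vector_mult_def axis_def if_distrib[of "\<lambda>x. _ * x"] cong: if_cong)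
  then have "cmod (M $ i $ j) \<le> norm (M *v axis j 1)"
    using Finite_Cartesian_Product.norm_nth_le[of "M *v axis j 1" i] by simp
  also have "\<dots> \<le> opn M" using opn_ge[of M "axis j 1"] by simp
  finally show ?thesis .
qed

lemma opn_le_entries: "opn M \<le> (\<Sum>i\<in>UNIV. \<Sum>j\<in>UNIV. cmod (M $ i $ j))"
proof (rule opn_le)
  fix v :: "complex^2"
  have "norm (M *v v) \<le> (\<Sum>i\<in>UNIV. cmod ((M *v v) $ i))" unfolding norm_vec_def by (rule L2_set_le_sum) simp
  also have "\<dots> \<le> (\<Sum>i\<in>UNIV. \<Sum>j\<in>UNIV. cmod (M $ i $ j) * norm v)"
  proof (rule sum_mono)
    fix i
    have "cmod ((M *v v) $ i) \<le> (\<Sum>j\<in>UNIV. cmod (M $ i $ j * v $ j))"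
      by (simp add: matrix_vector_mult_def norm_sum)
    also have "\<dots> \<le> (\<Sum>j\<in>UNIV. cmod (M $ i $ j) * norm v)"
      by (intro sum_mono) (simp add: norm_mult Finite_Cartesian_Product.norm_nth_le mult_left_mono)
    finally show "cmod ((M *v v) $ i) \<le> (\<Sum>j\<in>UNIV. cmod (M $ i $ j) * norm v)" .
  qed
  finally show "norm (M *v v) \<le> (\<Sum>i\<in>UNIV. \<Sum>j\<in>UNIV. cmod (M $ i $ j)) * norm v"
    by (simp add: sum_distrib_right)
qed

lemma opn_le_norm: "opn M \<le> 4 * norm M"
proof -
  have "cmod (M $ i $ j) \<le> norm M" for i j
    using Finite_Cartesian_Product.norm_nth_le[of "M $ i" j] Finite_Cartesian_Product.norm_nth_le[of M i] by linarith
  then have "(\<Sum>i\<in>UNIV. \<Sum>j\<in>UNIV. cmod (M $ i $ j)) \<le> (\<Sum>i\<in>(UNIV :: 2 set). \<Sum>j\<in>(UNIV :: 2 set). norm M)"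
    by (intro sum_mono)
  then show ?thesis using opn_le_entries[of M] by simp
qed

lemma msc_minus_one: "msc (-1) M = - M"
  by (simp add: msc_def Finite_Cartesian_Product.vec_eq_iff)

lemma opn_minus: "opn (- M) = opn M"
  using opn_msc[of "-1" M] by (simp add: msc_minus_one)

lemma opn_diff_commute: "opn (M - N) = opn (N - M)"
  using opn_minus[of "M - N"] by simp

lemma opn_diff_triangle: "opn (M - L) \<le> opn (M - N) + opn (N - L)"
  using opn_triangle[of "M - N" "N - L"] by simp

lemma cmat_simps:
  "msc c (M + N) = msc c M + msc c N" "msc (c + d) M = msc c M + msc d M" "msc c (msc d M) = msc (c * d) M"
  "msc 1 M = M" "msc 0 M = 0" "msc c 0 = 0" "msc c (M - N) = msc c M - msc c N" "msc (c - d) M = msc c M - msc d M"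
  "M ** (N + L) = M ** N + M ** L" "(M + N) ** L = M ** L + N ** L"
  "M ** (N - L) = M ** N - M ** L" "(M - N) ** L = M ** L - N ** L"
  "msc c M ** N = msc c (M ** N)" "M ** msc c N = msc c (M ** N)"
  "madj (M + N) = madj M + madj N" "madj (M ** N) = madj N ** madj M" "madj (msc c M) = msc (cnj c) (madj M)"
  "M ** 0 = 0" "0 ** M = 0" "madj 0 = 0"
  by (simp_all add: Finite_Cartesian_Product.vec_eq_iff msc_def madj_def matrix_matrix_mult_def sum.distrib sum_subtractf sum_distrib_left
      algebra_simps)

text \<open>Convergence is delivered as closedness: a bound on \<open>X n - X m\<close> for all
  large m passes to the limit. In this form an estimate uniform over many indices stays uniform when
  limits are taken index by index.\<close>

lemma complete_opn:
  fixes X :: "nat \<Rightarrow> cmat2"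
  assumes "\<And>e. 0 < e \<Longrightarrow> \<exists>N. \<forall>m\<ge>N. \<forall>n\<ge>N. opn (X m - X n) < e"
  obtains M where "\<And>N n e. (\<And>m. m \<ge> N \<Longrightarrow> opn (X n - X m) \<le> e) \<Longrightarrow> opn (X n - M) \<le> e"
proof -
  have "\<exists>l. (\<lambda>n. X n $ i $ j) \<longlonglongrightarrow> l" for i j
  proof -
    have "Cauchy (\<lambda>n. X n $ i $ j)"
    proof (rule metric_CauchyI)
      fix e :: real assume "0 < e"
      then obtain N where N: "\<And>m n. m \<ge> N \<Longrightarrow> n \<ge> N \<Longrightarrow> opn (X m - X n) < e" using assms by blast
      have "dist (X m $ i $ j) (X n $ i $ j) < e" if "m \<ge> N" "n \<ge> N" for m n
        using N[OF that] entry_le_opn[of "X m - X n" i j] by (simp add: dist_norm)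
      then show "\<exists>M. \<forall>m\<ge>M. \<forall>n\<ge>M. dist (X m $ i $ j) (X n $ i $ j) < e" by blast
    qed
    then show ?thesis using Cauchy_convergent convergent_def by blast
  qed
  then obtain l where l: "\<And>i j. (\<lambda>n. X n $ i $ j) \<longlonglongrightarrow> l i j" by metis
  define M :: cmat2 where "M = (\<chi> i j. l i j)"
  have limv: "(\<lambda>m. (X n - X m) *v v) \<longlonglongrightarrow> (X n - M) *v v" for n v
  proof (rule vec_tendstoI)
    fix i
    show "(\<lambda>m. ((X n - X m) *v v) $ i) \<longlonglongrightarrow> ((X n - M) *v v) $ i"
      unfolding matrix_vector_mult_def
      by (simp add: M_def) (intro tendsto_sum tendsto_mult tendsto_diff tendsto_const l)
  qed
  have "opn (X n - M) \<le> e" if le: "\<And>m. m \<ge> N \<Longrightarrow> opn (X n - X m) \<le> e" for N n e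
  proof (rule opn_le)
    fix v
    show "norm ((X n - M) *v v) \<le> e * norm v"
    proof (rule Lim_bounded[OF tendsto_norm[OF limv]], intro allI impI)
      fix m assume "m \<ge> N"
      then have "opn (X n - X m) * norm v \<le> e * norm v" using le by (intro mult_right_mono) auto
      then show "norm ((X n - X m) *v v) \<le> e * norm v" using opn_ge[of "X n - X m" v] by linarith
    qed
  qed
  then show thesis by (rule that)
qed

section \<open>Projections onto lines that become orthogonal\<close>

definition rank1 :: "(2 \<Rightarrow> real) \<Rightarrow> cmat2" where
  "rank1 v = (\<chi> i j. of_real (v i * v j))"

lemma rank1_mult: "rank1 v ** rank1 w = (\<chi> i j. of_real ((v 1 * w 1 + v 2 * w 2) * (v i * w j)))"
  by (simp add: rank1_def matrix_matrix_mult_def Finite_Cartesian_Product.vec_eq_iff sum_2 algebra_simps)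

lemma madj_rank1 [simp]: "madj (rank1 v) = rank1 v"
  by (simp add: rank1_def madj_def Finite_Cartesian_Product.vec_eq_iff mult.commute)

lemma rank1_idem: "v 1 * v 1 + v 2 * v 2 = 1 \<Longrightarrow> rank1 v ** rank1 v = rank1 v"
  by (simp add: rank1_mult) (simp add: rank1_def Finite_Cartesian_Product.vec_eq_iff)

lemma rank1_orth: "v 1 * w 1 + v 2 * w 2 = 0 \<Longrightarrow> rank1 v ** rank1 w = 0"
  by (simp add: rank1_mult Finite_Cartesian_Product.vec_eq_iff)

lemma opn_rank1:
  assumes v: "v 1 * v 1 + v 2 * v 2 = 1"
  shows "opn (rank1 v) = 1"
proof -
  have "(opn (rank1 v))\<^sup>2 = opn (rank1 v)"
    by (metis madj_rank1 opn_star_mult rank1_idem[OF v])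
  moreover have "opn (rank1 v) \<noteq> 0"
  proof
    assume "opn (rank1 v) = 0"
    then have "rank1 v $ i $ i = 0" for i by (simp add: opn_eq_0)
    then have "complex_of_real (v i * v i) = 0" for i unfolding rank1_def by simp
    then have "v i * v i = 0" for i by (metis of_real_eq_0_iff)
    then have "v 1 * v 1 = 0" "v 2 * v 2 = 0" by blast+
    then show False using v by linarith
  qed
  ultimately show ?thesis by (simp add: power2_eq_square)
qed

text \<open>The cosine of the angle between the ranges of \<open>pE\<close> and \<open>pQ n\<close>.
  What matters is that the values are positive, pairwise distinct and tend to 0.\<close>

definition sn :: "nat \<Rightarrow> real" where "sn n = 1 / (real n + 2)"
definition cs :: "nat \<Rightarrow> real" where "cs n = sqrt (1 - (sn n)\<^sup>2)"

lemma sn_bounds: "0 < sn n" "sn n \<le> 1"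
  by (simp_all add: sn_def)

lemma sn_cs: "sn n * sn n + cs n * cs n = 1"
proof -
  have "(sn n)\<^sup>2 \<le> 1" using sn_bounds[of n] by (simp add: power_le_one)
  then show ?thesis by (simp add: cs_def power2_eq_square)
qed

lemma cs_abs: "\<bar>cs n\<bar> \<le> 1"
proof -
  have "(cs n)\<^sup>2 \<le> 1\<^sup>2" using sn_cs[of n] by (simp add: power2_eq_square) (smt (verit) mult_nonneg_nonneg sn_bounds(1))
  then show ?thesis by (simp add: abs_square_le_1)
qed

lemma sn_mult_le: "sn n * sn n \<le> sn n" "sn n * \<bar>cs n\<bar> \<le> sn n" "0 \<le> sn n * sn n"
  using sn_bounds[of n] cs_abs[of n] by (simp_all add: mult_left_le)

lemma sn_tendsto: "sn \<longlonglongrightarrow> 0"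
  unfolding sn_def by real_asymp

lemma sn_inj: "inj sn"
  by (auto simp: inj_def sn_def)

text \<open>\<open>pE\<close> projects onto the first axis, \<open>pQ n\<close> onto a line tending
  to the second axis, and \<open>pR n\<close> onto the orthogonal complement of that line, which
  tends to the first axis.\<close>

definition pE :: cmat2 where "pE = rank1 (\<lambda>i. if i = 1 then 1 else 0)"
definition pQ :: "nat \<Rightarrow> cmat2" where "pQ n = rank1 (\<lambda>i. if i = 1 then sn n else cs n)"
definition pR :: "nat \<Rightarrow> cmat2" where "pR n = rank1 (\<lambda>i. if i = 1 then cs n else - sn n)"

lemma proj_simps:
  "pE ** pE = pE" "pQ n ** pQ n = pQ n" "pR n ** pR n = pR n" "pQ n ** pR n = 0" "pR n ** pQ n = 0"
  "madj pE = pE" "madj (pQ n) = pQ n" "madj (pR n) = pR n" "opn pE = 1" "opn (pQ n) = 1" "opn (pR n) = 1"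
  using sn_cs[of n]
  by (auto simp: pE_def pQ_def pR_def algebra_simps intro!: rank1_idem rank1_orth opn_rank1)

text \<open>The compression carries the squared cosine of the angle. Its values are distinct for
  distinct n, and this is what makes two of the projections generate an infinite-dimensional
  algebra.\<close>

lemma EQE: "pE ** pQ n ** pE = msc (of_real ((sn n)\<^sup>2)) pE"
  by (simp add: pE_def pQ_def rank1_def msc_def matrix_matrix_mult_def Finite_Cartesian_Product.vec_eq_iff sum_2 power2_eq_square forall_2)

lemma opn_EQ: "opn (pE ** pQ n) \<le> 2 * sn n"
proof -
  have "opn (pE ** pQ n) \<le> (\<Sum>i\<in>UNIV. \<Sum>j\<in>UNIV. cmod ((pE ** pQ n) $ i $ j))" by (rule opn_le_entries)
  also have "\<dots> = sn n * sn n + sn n * \<bar>cs n\<bar>"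
    using sn_bounds[of n]
    by (simp add: pE_def pQ_def rank1_mult sum_2 abs_mult flip: of_real_mult)
  also have "\<dots> \<le> 2 * sn n"
    using sn_mult_le[of n] by linarith
  finally show ?thesis .
qed

lemma opn_QE: "opn (pQ n ** pE) \<le> 2 * sn n"
  using opn_EQ[of n] opn_madj[of "pE ** pQ n"] by (simp add: cmat_simps proj_simps)

lemma opn_R_minus_E: "opn (pR n - pE) \<le> 4 * sn n"
proof -
  have "opn (pR n - pE) \<le> (\<Sum>i\<in>UNIV. \<Sum>j\<in>UNIV. cmod ((pR n - pE) $ i $ j))" by (rule opn_le_entries)
  also have "\<dots> = \<bar>cs n * cs n - 1\<bar> + 2 * (sn n * \<bar>cs n\<bar>) + sn n * sn n"
  proof -
    have "cmod (complex_of_real (cs n) * complex_of_real (cs n) - 1) = \<bar>cs n * cs n - 1\<bar>"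
      by (metis norm_of_real of_real_1 of_real_diff of_real_mult)
    then show ?thesis
      using sn_bounds[of n] by (simp add: pE_def pR_def rank1_def sum_2 norm_mult)
  qed
  also have "cs n * cs n - 1 = - (sn n * sn n)" using sn_cs[of n] by simp
  also have "\<bar>- (sn n * sn n)\<bar> + 2 * (sn n * \<bar>cs n\<bar>) + sn n * sn n \<le> 4 * sn n"
    using sn_mult_le[of n] by linarith
  finally show ?thesis .
qed

section \<open>An LF algebra that is not AF\<close>

type_synonym 'k idx = "'k \<times> 'k \<times> nat"

text \<open>The combination of the \<open>p\<^sub>\<xi>\<close> with coefficients
  \<open>l \<xi>\<close>: an index (x, y, n) meets only the projections of x and of y, the first
  through \<open>pE\<close> and the second through \<open>pQ n\<close>.\<close>

definition mdl :: "('k \<Rightarrow> complex) \<Rightarrow> 'k idx \<Rightarrow> cmat2" where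
  "mdl l = (\<lambda>(x, y, n). if x = y then 0 else msc (l x) pE + msc (l y) (pQ n))"

text \<open>The functions that are, up to \<open>c\<^sub>0\<close>, a \<open>c\<^sub>0\<close>-combination of the projections \<open>p\<^sub>\<xi>\<close>, where
  \<open>p\<^sub>\<xi>\<close> takes the value \<open>pE\<close> at \<open>(\<xi>, \<eta>, n)\<close>, the value \<open>pQ n\<close> at \<open>(\<eta>, \<xi>, n)\<close> and \<open>0\<close> elsewhere.
  Distinct \<open>p\<^sub>\<xi>\<close>, \<open>p\<^sub>\<eta>\<close> are asymptotically orthogonal, but together they generate an
  infinite-dimensional algebra.\<close>

definition twist_carrier :: "('k idx \<Rightarrow> cmat2) set" where
  "twist_carrier = {a. \<forall>e>0. \<exists>l L. finite {x. l x \<noteq> 0} \<and> finite L \<and> (\<forall>i. i \<notin> L \<longrightarrow> opn (a i - mdl l i) \<le> e)}"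

definition twist :: "('k idx \<Rightarrow> cmat2) cstar_struct" where
  "twist = \<lparr>carrier = twist_carrier, zer = (\<lambda>_. 0), add = (\<lambda>a b i. a i + b i), smul = (\<lambda>c a i. msc c (a i)),
     mul = (\<lambda>a b i. a i ** b i), star = (\<lambda>a i. madj (a i)), nrm = (\<lambda>a. SUP i. opn (a i))\<rparr>"

lemma twist_sel [simp]:
  "carrier twist = twist_carrier" "zer twist = (\<lambda>_. 0)" "add twist a b = (\<lambda>i. a i + b i)"
  "smul twist c a = (\<lambda>i. msc c (a i))" "mul twist a b = (\<lambda>i. a i ** b i)" "star twist a = (\<lambda>i. madj (a i))"
  "nrm twist a = (SUP i. opn (a i))"
  by (simp_all add: twist_def)

lemma twist_carrierD:
  assumes "a \<in> twist_carrier" "0 < e"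
  obtains l L where "finite {x. l x \<noteq> 0}" "finite L" "\<And>i. i \<notin> L \<Longrightarrow> opn (a i - mdl l i) \<le> e"
  using assms unfolding twist_carrier_def by blast

lemma twist_carrierI:
  assumes "\<And>e. 0 < e \<Longrightarrow> \<exists>l L. finite {x. l x \<noteq> 0} \<and> finite L \<and> (\<forall>i. i \<notin> L \<longrightarrow> opn (a i - mdl l i) \<le> e)"
  shows "a \<in> twist_carrier"
  using assms unfolding twist_carrier_def by blast

lemma finite_support_bounded:
  assumes "finite {x. l x \<noteq> (0 :: complex)}"
  obtains b where "0 \<le> b" "\<And>x. cmod (l x) \<le> b"
proof -
  have "cmod (l x) \<le> (\<Sum>x\<in>{x. l x \<noteq> 0}. cmod (l x))" for x
  proof (cases "l x = 0")
    case False
    then show ?thesis using assms by (intro member_le_sum) auto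
  qed (auto intro: sum_nonneg)
  then show thesis by (intro that[of "\<Sum>x\<in>{x. l x \<noteq> 0}. cmod (l x)"]) (auto intro: sum_nonneg)
qed

lemma opn_mdl_le: "(\<And>x. cmod (l x) \<le> b) \<Longrightarrow> opn (mdl l i) \<le> 2 * b"
proof -
  assume l: "\<And>x. cmod (l x) \<le> b"
  obtain x y n where i: "i = (x, y, n)" by (cases i)
  have "0 \<le> b" using l[of x] norm_ge_zero order_trans by blast
  then show ?thesis
    using opn_triangle[of "msc (l x) pE" "msc (l y) (pQ n)"] l[of x] l[of y]
    by (auto simp: i mdl_def opn_msc proj_simps)
qed

lemma twist_bounded:
  assumes "a \<in> twist_carrier"
  obtains b where "0 \<le> b" "\<And>i. opn (a i) \<le> b"
proof -
  obtain l L where l: "finite {x. l x \<noteq> 0}" and L: "finite L" "\<And>i. i \<notin> L \<Longrightarrow> opn (a i - mdl l i) \<le> 1"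
    using twist_carrierD[OF assms, of 1] by auto
  obtain c where c: "0 \<le> c" "\<And>x. cmod (l x) \<le> c" using finite_support_bounded[OF l] by blast
  define s where "s = (\<Sum>i\<in>L. opn (a i))"
  have s: "0 \<le> s" by (auto simp: s_def intro: sum_nonneg)
  have "opn (a i) \<le> s + 1 + 2 * c" for i
  proof (cases "i \<in> L")
    case True
    then have "opn (a i) \<le> s" unfolding s_def using L(1) by (intro member_le_sum) auto
    then show ?thesis using c(1) by linarith
  next
    case False
    have "opn (a i) \<le> opn (a i - mdl l i) + opn (mdl l i)" using opn_triangle[of "a i - mdl l i" "mdl l i"] by simp
    then show ?thesis using L(2)[OF False] opn_mdl_le[of l c i, OF c(2)] s by linarith
  qed
  then show thesis using that[of "s + 1 + 2 * c"] s c(1) by auto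
qed

lemma twist_bdd: "a \<in> twist_carrier \<Longrightarrow> bdd_above (range (\<lambda>i. opn (a i)))"
  by (metis twist_bounded bdd_aboveI2)

lemma opn_le_nrm: "a \<in> twist_carrier \<Longrightarrow> opn (a i) \<le> nrm twist a"
  unfolding twist_sel by (rule cSUP_upper[OF UNIV_I twist_bdd])

lemma mdl_add: "mdl (\<lambda>x. l x + m x) i = mdl l i + mdl m i"
  by (cases i) (simp add: mdl_def cmat_simps)

lemma mdl_scale: "mdl (\<lambda>x. c * l x) i = msc c (mdl l i)"
  by (cases i) (simp add: mdl_def cmat_simps)

lemma mdl_cnj: "mdl (\<lambda>x. cnj (l x)) i = madj (mdl l i)"
  by (cases i) (simp add: mdl_def cmat_simps proj_simps)

lemma mdl_zero: "mdl (\<lambda>x. 0) i = 0"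
  by (cases i) (simp add: mdl_def cmat_simps)

lemma sn_small:
  assumes "0 < e"
  obtains N where "\<And>n. n \<ge> N \<Longrightarrow> b * sn n \<le> e"
proof -
  have "(\<lambda>n. b * sn n) \<longlonglongrightarrow> b * 0" by (intro tendsto_mult tendsto_const sn_tendsto)
  then have "\<forall>\<^sub>F n in sequentially. b * sn n < e" using assms by (intro order_tendstoD) simp
  then obtain N where "\<And>n. n \<ge> N \<Longrightarrow> b * sn n < e" by (auto simp: eventually_sequentially)
  then show thesis by (intro that[of N]) (auto intro: less_imp_le)
qed

text \<open>Combinations multiply coefficientwise up to the mixed products of \<open>pE\<close> and
  \<open>pQ n\<close>, of norm at most \<open>2 * sn n\<close>. These are small for
  \<open>n \<ge> N\<close>; for smaller n they vanish unless x and y both lie in the union of the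
  supports, which leaves finitely many indices.\<close>

lemma mdl_mult:
  assumes l: "finite {x. l x \<noteq> 0}" and m: "finite {x. m x \<noteq> 0}" and e: "0 < e"
  obtains L where "finite L" "\<And>i. i \<notin> L \<Longrightarrow> opn (mdl l i ** mdl m i - mdl (\<lambda>x. l x * m x) i) \<le> e"
proof -
  obtain b where b: "0 \<le> b" "\<And>x. cmod (l x) \<le> b" using finite_support_bounded[OF l] by blast
  obtain c where c: "0 \<le> c" "\<And>x. cmod (m x) \<le> c" using finite_support_bounded[OF m] by blast
  obtain N where N: "\<And>n. n \<ge> N \<Longrightarrow> 4 * (b * c) * sn n \<le> e" using sn_small[OF e] by blast
  let ?K = "{x. l x \<noteq> 0} \<union> {x. m x \<noteq> 0}"
  show thesis
  proof (rule that[of "?K \<times> ?K \<times> {..<N}"])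
    show "finite (?K \<times> ?K \<times> {..<N})" using l m by simp
    fix i assume i: "i \<notin> ?K \<times> ?K \<times> {..<N}"
    obtain x y n where xyn: "i = (x, y, n)" by (cases i)
    show "opn (mdl l i ** mdl m i - mdl (\<lambda>x. l x * m x) i) \<le> e"
    proof (cases "x = y")
      case True
      then show ?thesis using e by (simp add: xyn mdl_def)
    next
      case False
      have eq: "mdl l i ** mdl m i - mdl (\<lambda>x. l x * m x) i =
          msc (l x * m y) (pE ** pQ n) + msc (l y * m x) (pQ n ** pE)"
        using False by (simp add: xyn mdl_def cmat_simps proj_simps mult_ac)
      show ?thesis
      proof (cases "n < N")
        case True
        then have "(l x = 0 \<and> m x = 0) \<or> (l y = 0 \<and> m y = 0)" using i by (auto simp: xyn)
        then show ?thesis using e unfolding eq by (auto simp: cmat_simps)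
      next
        case False
        have s: "0 \<le> sn n" using sn_bounds[of n] by simp
        have "opn (mdl l i ** mdl m i - mdl (\<lambda>x. l x * m x) i) \<le>
            cmod (l x) * cmod (m y) * opn (pE ** pQ n) + cmod (l y) * cmod (m x) * opn (pQ n ** pE)"
          unfolding eq using opn_triangle[of "msc (l x * m y) (pE ** pQ n)" "msc (l y * m x) (pQ n ** pE)"]
          by (simp add: opn_msc norm_mult)
        also have "\<dots> \<le> b * c * (2 * sn n) + b * c * (2 * sn n)"
          using b c s by (intro add_mono mult_mono opn_EQ opn_QE) auto
        also have "\<dots> \<le> e" using N[of n] False by (simp add: algebra_simps)
        finally show ?thesis .
      qed
    qed
  qed
qed

lemma twist_carrier_zero: "(\<lambda>_. 0) \<in> twist_carrier"
proof (rule twist_carrierI)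
  fix e :: real assume e: "0 < e"
  show "\<exists>l L. finite {x. l x \<noteq> 0} \<and> finite L \<and> (\<forall>i. i \<notin> L \<longrightarrow> opn (0 - mdl l i) \<le> e)"
    by (rule exI[of _ "\<lambda>_. 0"], rule exI[of _ "{}"]) (use e in \<open>simp add: mdl_zero\<close>)
qed

lemma twist_carrier_add:
  assumes "a \<in> twist_carrier" "b \<in> twist_carrier"
  shows "(\<lambda>i. a i + b i) \<in> twist_carrier"
proof (rule twist_carrierI)
  fix e :: real assume "0 < e"
  then have e: "0 < e / 2" by simp
  obtain l L where l: "finite {x. l x \<noteq> 0}" "finite L" "\<And>i. i \<notin> L \<Longrightarrow> opn (a i - mdl l i) \<le> e / 2"
    using twist_carrierD[OF assms(1) e] by blast
  obtain m M where m: "finite {x. m x \<noteq> 0}" "finite M" "\<And>i. i \<notin> M \<Longrightarrow> opn (b i - mdl m i) \<le> e / 2"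
    using twist_carrierD[OF assms(2) e] by blast
  have "opn (a i + b i - mdl (\<lambda>x. l x + m x) i) \<le> e" if "i \<notin> L \<union> M" for i
    using l(3)[of i] m(3)[of i] that opn_triangle[of "a i - mdl l i" "b i - mdl m i"]
    by (simp add: mdl_add algebra_simps)
  moreover have "finite {x. l x + m x \<noteq> 0}"
    by (rule finite_subset[of _ "{x. l x \<noteq> 0} \<union> {x. m x \<noteq> 0}"]) (use l m in auto)
  ultimately show "\<exists>l L. finite {x. l x \<noteq> 0} \<and> finite L \<and> (\<forall>i. i \<notin> L \<longrightarrow> opn (a i + b i - mdl l i) \<le> e)"
    using l(2) m(2) by (intro exI[of _ "\<lambda>x. l x + m x"] exI[of _ "L \<union> M"]) auto
qed

lemma twist_carrier_scale:
  assumes "a \<in> twist_carrier"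
  shows "(\<lambda>i. msc c (a i)) \<in> twist_carrier"
proof (rule twist_carrierI)
  fix e :: real assume "0 < e"
  then have e: "0 < e / (cmod c + 1)" by (simp add: add_nonneg_pos)
  obtain l L where l: "finite {x. l x \<noteq> 0}" "finite L" "\<And>i. i \<notin> L \<Longrightarrow> opn (a i - mdl l i) \<le> e / (cmod c + 1)"
    using twist_carrierD[OF assms e] by blast
  have "opn (msc c (a i) - mdl (\<lambda>x. c * l x) i) \<le> e" if "i \<notin> L" for i
  proof -
    have "opn (msc c (a i) - mdl (\<lambda>x. c * l x) i) = cmod c * opn (a i - mdl l i)"
      by (simp add: mdl_scale opn_msc flip: cmat_simps(7))
    also have "\<dots> \<le> (cmod c + 1) * (e / (cmod c + 1))"
      using l(3)[OF that] by (intro mult_mono) auto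
    also have "\<dots> = e"
    proof -
      have "cmod c + 1 \<noteq> 0" using norm_ge_zero[of c] by linarith
      then show ?thesis by simp
    qed
    finally show ?thesis .
  qed
  moreover have "finite {x. c * l x \<noteq> 0}" by (rule finite_subset[OF _ l(1)]) auto
  ultimately show "\<exists>l L. finite {x. l x \<noteq> 0} \<and> finite L \<and> (\<forall>i. i \<notin> L \<longrightarrow> opn (msc c (a i) - mdl l i) \<le> e)"
    using l(2) by (intro exI[of _ "\<lambda>x. c * l x"] exI[of _ L]) auto
qed

lemma twist_carrier_star:
  assumes "a \<in> twist_carrier"
  shows "(\<lambda>i. madj (a i)) \<in> twist_carrier"
proof (rule twist_carrierI)
  fix e :: real assume e: "0 < e"
  obtain l L where l: "finite {x. l x \<noteq> 0}" "finite L" "\<And>i. i \<notin> L \<Longrightarrow> opn (a i - mdl l i) \<le> e"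
    using twist_carrierD[OF assms e] by blast
  have md: "madj M - madj N = madj (M - N)" for M N
    by (simp add: madj_def Finite_Cartesian_Product.vec_eq_iff)
  have "opn (madj (a i) - mdl (\<lambda>x. cnj (l x)) i) \<le> e" if "i \<notin> L" for i
    using l(3)[OF that] by (simp add: mdl_cnj md opn_madj)
  then show "\<exists>l L. finite {x. l x \<noteq> 0} \<and> finite L \<and> (\<forall>i. i \<notin> L \<longrightarrow> opn (madj (a i) - mdl l i) \<le> e)"
    using l(1,2) by (intro exI[of _ "\<lambda>x. cnj (l x)"] exI[of _ L]) auto
qed

lemma twist_carrier_mult:
  assumes "a \<in> twist_carrier" "b \<in> twist_carrier"
  shows "(\<lambda>i. a i ** b i) \<in> twist_carrier"
proof (rule twist_carrierI)
  fix e :: real assume e: "0 < e"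
  have third: "x \<noteq> 0 \<Longrightarrow> e / (3 * x) * x = e / 3" for x :: real by simp
  obtain B where B: "0 \<le> B" "\<And>i. opn (b i) \<le> B" using twist_bounded[OF assms(2)] by blast
  \<comment> \<open>The added 1, here and in \<open>2 * c + 1\<close>, keeps denominators positive;
    \<open>2 * c\<close> bounds the norm of \<open>mdl l\<close>, which is fixed before b is
    approximated.\<close>
  have e1: "0 < e / (3 * (B + 1))" using e B(1) by simp
  obtain l L where l: "finite {x. l x \<noteq> 0}" "finite L" "\<And>i. i \<notin> L \<Longrightarrow> opn (a i - mdl l i) \<le> e / (3 * (B + 1))"
    using twist_carrierD[OF assms(1) e1] by blast
  obtain c where c: "0 \<le> c" "\<And>x. cmod (l x) \<le> c" using finite_support_bounded[OF l(1)] by blast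
  have e2: "0 < e / (3 * (2 * c + 1))" using e c(1) by simp
  obtain m M where m: "finite {x. m x \<noteq> 0}" "finite M" "\<And>i. i \<notin> M \<Longrightarrow> opn (b i - mdl m i) \<le> e / (3 * (2 * c + 1))"
    using twist_carrierD[OF assms(2) e2] by blast
  have e3: "0 < e / 3" using e by simp
  obtain R where R: "finite R" "\<And>i. i \<notin> R \<Longrightarrow> opn (mdl l i ** mdl m i - mdl (\<lambda>x. l x * m x) i) \<le> e / 3"
    using mdl_mult[OF l(1) m(1) e3] by blast
  have "opn (a i ** b i - mdl (\<lambda>x. l x * m x) i) \<le> e" if i: "i \<notin> L \<union> M \<union> R" for i
  proof -
    have 1: "opn ((a i - mdl l i) ** b i) \<le> e / 3"
    proof -
      have "opn ((a i - mdl l i) ** b i) \<le> e / (3 * (B + 1)) * (B + 1)"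
        by (rule order_trans[OF opn_mult]) (use l(3)[of i] i B e1 in \<open>intro mult_mono; simp add: add_increasing2\<close>)
      also have "e / (3 * (B + 1)) * (B + 1) = e / 3" by (rule third) (use B(1) in simp)
      finally show ?thesis .
    qed
    have 2: "opn (mdl l i ** (b i - mdl m i)) \<le> e / 3"
    proof -
      have "opn (mdl l i) \<le> 2 * c + 1" using opn_mdl_le[of l c i] c(2) by simp
      then have "opn (mdl l i ** (b i - mdl m i)) \<le> (2 * c + 1) * (e / (3 * (2 * c + 1)))"
        by (intro order_trans[OF opn_mult] mult_mono) (use m(3)[of i] i c in auto)
      also have "\<dots> = e / 3" by (subst mult.commute, rule third) (use c(1) in simp)
      finally show ?thesis .
    qed
    have "a i ** b i - mdl (\<lambda>x. l x * m x) i = ((a i - mdl l i) ** b i + mdl l i ** (b i - mdl m i))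
        + (mdl l i ** mdl m i - mdl (\<lambda>x. l x * m x) i)"
      by (simp add: cmat_simps)
    also have "opn \<dots> \<le> opn ((a i - mdl l i) ** b i) + opn (mdl l i ** (b i - mdl m i))
        + opn (mdl l i ** mdl m i - mdl (\<lambda>x. l x * m x) i)"
      by (meson add_mono opn_triangle order_refl order_trans)
    also have "\<dots> \<le> e" using 1 2 R(2)[of i] i by simp
    finally show ?thesis .
  qed
  moreover have "finite {x. l x * m x \<noteq> 0}" by (rule finite_subset[OF _ l(1)]) auto
  ultimately show "\<exists>l L. finite {x. l x \<noteq> 0} \<and> finite L \<and> (\<forall>i. i \<notin> L \<longrightarrow> opn (a i ** b i - mdl l i) \<le> e)"
    using l(2) m(2) R(1) by (intro exI[of _ "\<lambda>x. l x * m x"] exI[of _ "L \<union> M \<union> R"]) auto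
qed

lemma cdist_twist: "cdist twist a b = (SUP i. opn (a i - b i))"
  by (simp add: cdist_def msc_minus_one)

lemma twist_carrier_diff:
  assumes "a \<in> twist_carrier" "b \<in> twist_carrier"
  shows "(\<lambda>i. a i - b i) \<in> twist_carrier"
  using twist_carrier_add[OF assms(1) twist_carrier_scale[OF assms(2), of "-1"]] by (simp add: msc_minus_one)

lemma opn_le_cdist: "a \<in> twist_carrier \<Longrightarrow> b \<in> twist_carrier \<Longrightarrow> opn (a i - b i) \<le> cdist twist a b"
  using opn_le_nrm[OF twist_carrier_diff] by (simp add: cdist_twist)

lemma cdist_le: "(\<And>i. opn (a i - b i) \<le> e) \<Longrightarrow> cdist twist a b \<le> e"
  by (auto simp: cdist_twist intro: cSUP_least)

lemma twist_complete:
  fixes f :: "nat \<Rightarrow> 'k idx \<Rightarrow> cmat2"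
  assumes f: "\<And>n. f n \<in> twist_carrier" and C: "\<And>e. 0 < e \<Longrightarrow> \<exists>N. \<forall>m\<ge>N. \<forall>n\<ge>N. cdist twist (f m) (f n) < e"
  shows "\<exists>a\<in>twist_carrier. \<forall>e>0. \<exists>N. \<forall>n\<ge>N. cdist twist (f n) a < e"
proof -
  have "\<exists>M. \<forall>N n e. (\<forall>m\<ge>N. opn (f n i - f m i) \<le> e) \<longrightarrow> opn (f n i - M) \<le> e" for i
  proof -
    have "\<exists>N. \<forall>m\<ge>N. \<forall>n\<ge>N. opn (f m i - f n i) < e" if "0 < e" for e
      using C[OF that] opn_le_cdist[OF f f] by (meson le_less_trans)
    from complete_opn[OF this] show ?thesis by metis
  qed
  then obtain a where a: "\<And>i N n e. (\<And>m. m \<ge> N \<Longrightarrow> opn (f n i - f m i) \<le> e) \<Longrightarrow> opn (f n i - a i) \<le> e"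
    by metis
  have near: "\<exists>N. \<forall>n\<ge>N. \<forall>i. opn (f n i - a i) \<le> e" if e: "0 < e" for e
  proof -
    obtain N where N: "\<And>m n. m \<ge> N \<Longrightarrow> n \<ge> N \<Longrightarrow> cdist twist (f m) (f n) < e" using C[OF e] by blast
    have "opn (f n i - a i) \<le> e" if "n \<ge> N" for n i
    proof (rule a[of N])
      fix m assume "m \<ge> N"
      then show "opn (f n i - f m i) \<le> e" using N[OF that] opn_le_cdist[OF f f, of n i m] by (meson less_imp_le order_trans)
    qed
    then show ?thesis by blast
  qed
  have "a \<in> twist_carrier"
  proof (rule twist_carrierI)
    fix e :: real assume "0 < e"
    then have e: "0 < e / 2" by simp
    obtain n where n: "\<And>i. opn (f n i - a i) \<le> e / 2" using near[OF e] by blast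
    obtain l L where l: "finite {x. l x \<noteq> 0}" "finite L" "\<And>i. i \<notin> L \<Longrightarrow> opn (f n i - mdl l i) \<le> e / 2"
      using twist_carrierD[OF f[of n] e] by blast
    have "opn (a i - mdl l i) \<le> e" if "i \<notin> L" for i
      using opn_diff_triangle[of "a i" "mdl l i" "f n i"] n[of i] l(3)[OF that] opn_diff_commute[of "a i" "f n i"] by simp
    then show "\<exists>l L. finite {x. l x \<noteq> 0} \<and> finite L \<and> (\<forall>i. i \<notin> L \<longrightarrow> opn (a i - mdl l i) \<le> e)"
      using l(1,2) by blast
  qed
  moreover have "\<exists>N. \<forall>n\<ge>N. cdist twist (f n) a < e" if "0 < e" for e
  proof -
    have "0 < e / 2" using that by simp
    then obtain N where N: "\<And>n i. n \<ge> N \<Longrightarrow> opn (f n i - a i) \<le> e / 2" using near by blast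
    have "cdist twist (f n) a < e" if "n \<ge> N" for n
      using cdist_le[of "f n" a "e / 2"] N[OF that] \<open>0 < e\<close> by fastforce
    then show ?thesis by blast
  qed
  ultimately show ?thesis by blast
qed

lemma cstar_algebra_twist: "cstar_algebra (twist :: ('k idx \<Rightarrow> cmat2) cstar_struct)"
proof -
  have n0: "(SUP i. opn (a i)) = 0 \<longleftrightarrow> a = (\<lambda>_. 0)" if "a \<in> twist_carrier" for a :: "'k idx \<Rightarrow> cmat2"
  proof
    assume "(SUP i. opn (a i)) = 0"
    then have "opn (a i) \<le> 0" for i using opn_le_nrm[OF that, of i] by simp
    then have "opn (a i) = 0" for i by (meson antisym opn_nonneg)
    then show "a = (\<lambda>_. 0)" by (auto simp: opn_eq_0)
  qed simp
  have n1: "(SUP i. opn (a i + b i)) \<le> (SUP i. opn (a i)) + (SUP i. opn (b i))"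
    if "a \<in> twist_carrier" "b \<in> twist_carrier" for a b :: "'k idx \<Rightarrow> cmat2"
  proof (rule cSUP_least)
    fix i
    show "opn (a i + b i) \<le> (SUP i. opn (a i)) + (SUP i. opn (b i))"
      using opn_triangle[of "a i" "b i"] opn_le_nrm[OF that(1), of i] opn_le_nrm[OF that(2), of i] by simp
  qed simp
  have n2: "(SUP i. opn (msc c (a i))) = cmod c * (SUP i. opn (a i))" if "a \<in> twist_carrier" for c and a :: "'k idx \<Rightarrow> cmat2"
  proof (rule antisym)
    show "(SUP i. opn (msc c (a i))) \<le> cmod c * (SUP i. opn (a i))"
      using opn_le_nrm[OF that] by (intro cSUP_least) (auto simp: opn_msc mult_left_mono)
    show "cmod c * (SUP i. opn (a i)) \<le> (SUP i. opn (msc c (a i)))"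
    proof (cases "c = 0")
      case False
      have "opn (a i) \<le> (SUP i. opn (msc c (a i))) / cmod c" for i
        using opn_le_nrm[OF twist_carrier_scale[OF that], of c i] False by (simp add: opn_msc field_simps)
      then have "(SUP i. opn (a i)) \<le> (SUP i. opn (msc c (a i))) / cmod c" by (intro cSUP_least) auto
      then show ?thesis using False by (simp add: field_simps)
    qed (simp add: cmat_simps)
  qed
  have nn: "0 \<le> (SUP i. opn (a i))" if "a \<in> twist_carrier" for a :: "'k idx \<Rightarrow> cmat2"
    using order_trans[OF opn_nonneg opn_le_nrm[OF that, of undefined]] by simp
  have n3: "(SUP i. opn (a i ** b i)) \<le> (SUP i. opn (a i)) * (SUP i. opn (b i))"
    if "a \<in> twist_carrier" "b \<in> twist_carrier" for a b :: "'k idx \<Rightarrow> cmat2"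
  proof (rule cSUP_least)
    fix i
    show "opn (a i ** b i) \<le> (SUP i. opn (a i)) * (SUP i. opn (b i))"
      using opn_le_nrm[OF that(1), of i] opn_le_nrm[OF that(2), of i] nn[OF that(1)]
      by (intro order_trans[OF opn_mult] mult_mono) auto
  qed simp
  have n4: "(SUP i. opn (madj (a i) ** a i)) = (SUP i. opn (a i))\<^sup>2" if "a \<in> twist_carrier" for a :: "'k idx \<Rightarrow> cmat2"
  proof (rule antisym)
    show "(SUP i. opn (madj (a i) ** a i)) \<le> (SUP i. opn (a i))\<^sup>2"
      using opn_le_nrm[OF that] by (intro cSUP_least) (auto simp: opn_star_mult intro!: power_mono)
    have "opn (a i) \<le> sqrt (SUP i. opn (madj (a i) ** a i))" for i
      using opn_le_nrm[OF twist_carrier_mult[OF twist_carrier_star[OF that] that], of i]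
      by (simp add: opn_star_mult real_le_rsqrt)
    then have "(SUP i. opn (a i)) \<le> sqrt (SUP i. opn (madj (a i) ** a i))" by (intro cSUP_least) auto
    then have "(SUP i. opn (a i))\<^sup>2 \<le> (sqrt (SUP i. opn (madj (a i) ** a i)))\<^sup>2" using nn[OF that] by (rule power_mono)
    then show "(SUP i. opn (a i))\<^sup>2 \<le> (SUP i. opn (madj (a i) ** a i))"
      using nn[OF twist_carrier_mult[OF twist_carrier_star[OF that] that]] by simp
  qed
  show ?thesis
    unfolding cstar_algebra_def twist_sel
    using twist_carrier_zero twist_carrier_add twist_carrier_mult twist_carrier_scale twist_carrier_star
    by (intro conjI ballI allI impI)
       (simp_all add: cmat_simps madj_madj matrix_mul_assoc msc_minus_one n0 n1 n2 n3 n4 twist_complete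
         algebra_simps)
qed

text \<open>For \<open>\<xi>\<close>, \<open>\<eta>\<close> in a finite set \<open>K\<close>, replacing \<open>pE\<close> by the complement \<open>pR n\<close> of \<open>pQ n\<close> makes the
  projections \<open>p\<^sub>\<xi>\<close> exactly orthogonal, at the cost of a perturbation that vanishes as \<open>n\<close> grows.\<close>

definition mdlK :: "'k set \<Rightarrow> ('k \<Rightarrow> complex) \<Rightarrow> 'k idx \<Rightarrow> cmat2" where
  "mdlK K l = (\<lambda>(x, y, n). if x = y then 0 else if x \<in> K \<and> y \<in> K then msc (l x) (pR n) + msc (l y) (pQ n)
     else msc (l x) pE + msc (l y) (pQ n))"

text \<open>Arbitrary matrices at the finitely many points of L, and off L only the coefficients on
  K. This is an algebra because \<open>mdlK K\<close> is multiplicative on coefficients supported in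
  K.\<close>

definition twist_fd :: "'k set \<Rightarrow> 'k idx set \<Rightarrow> ('k idx \<Rightarrow> cmat2) set" where
  "twist_fd K L = {a. \<exists>l. (\<forall>x. x \<notin> K \<longrightarrow> l x = 0) \<and> (\<forall>i. i \<notin> L \<longrightarrow> a i = mdlK K l i)}"

lemma mdlK_add: "mdlK K (\<lambda>x. l x + m x) i = mdlK K l i + mdlK K m i"
  by (cases i) (simp add: mdlK_def cmat_simps)

lemma mdlK_scale: "mdlK K (\<lambda>x. c * l x) i = msc c (mdlK K l i)"
  by (cases i) (simp add: mdlK_def cmat_simps)

lemma mdlK_cnj: "mdlK K (\<lambda>x. cnj (l x)) i = madj (mdlK K l i)"
  by (cases i) (simp add: mdlK_def cmat_simps proj_simps)

lemma mdlK_zero: "mdlK K (\<lambda>x. 0) i = 0"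
  by (cases i) (simp add: mdlK_def cmat_simps)

text \<open>Over K the two projections at an index are orthogonal; if x or y is outside K, its
  coefficient is 0 and only one projection is left. Either way no mixed product survives.\<close>

lemma mdlK_mult:
  assumes "\<And>x. x \<notin> K \<Longrightarrow> l x = 0" "\<And>x. x \<notin> K \<Longrightarrow> m x = 0"
  shows "mdlK K (\<lambda>x. l x * m x) i = mdlK K l i ** mdlK K m i"
proof -
  obtain x y n where i: "i = (x, y, n)" by (cases i)
  consider "x = y" | "x \<noteq> y" "x \<in> K" "y \<in> K" | "x \<noteq> y" "x \<notin> K" | "x \<noteq> y" "y \<notin> K" by blast
  then show ?thesis
    by cases (use assms in \<open>simp_all add: i mdlK_def cmat_simps proj_simps mult_ac\<close>)
qed

lemma mdlK_sum:
  assumes K: "finite K" "\<And>x. x \<notin> K \<Longrightarrow> l x = 0"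
  shows "mdlK K l i = (\<Sum>x\<in>K. msc (l x) (mdlK K (\<lambda>z. if z = x then 1 else 0) i))"
proof -
  have sum: "mdlK K (\<lambda>z. \<Sum>x\<in>X. l x * (if z = x then 1 else 0)) i
      = (\<Sum>x\<in>X. msc (l x) (mdlK K (\<lambda>z. if z = x then 1 else 0) i))" if "finite X" for X
    using that by (induction X) (simp_all add: mdlK_zero mdlK_add mdlK_scale)
  have eq: "(\<lambda>z. \<Sum>x\<in>K. l x * (if z = x then 1 else 0)) = l"
  proof
    fix z
    have "(\<Sum>x\<in>K. l x * (if z = x then 1 else 0)) = (\<Sum>x\<in>K. if x = z then l x else 0)"
      by (intro sum.cong) auto
    also have "\<dots> = l z" using K by (cases "z \<in> K") simp_all
    finally show "(\<Sum>x\<in>K. l x * (if z = x then 1 else 0)) = l z" .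
  qed
  show ?thesis using sum[OF K(1)] unfolding eq .
qed

lemma mdlK_near:
  assumes l: "\<And>x. cmod (l x) \<le> b" and N: "\<And>n. n \<ge> N \<Longrightarrow> 4 * b * sn n \<le> e" and e: "0 < e"
    and i: "i \<notin> K \<times> K \<times> {..<N}"
  shows "opn (mdlK K l i - mdl l i) \<le> e"
proof -
  obtain x y n where xyn: "i = (x, y, n)" by (cases i)
  show ?thesis
  proof (cases "x \<noteq> y \<and> x \<in> K \<and> y \<in> K")
    case True
    then have n: "n \<ge> N" using i by (auto simp: xyn)
    have eq: "mdlK K l i - mdl l i = msc (l x) (pR n - pE)"
      using True by (simp add: xyn mdlK_def mdl_def cmat_simps)
    have "opn (mdlK K l i - mdl l i) \<le> b * (4 * sn n)"
      unfolding eq opn_msc using l[of x] sn_bounds[of n] opn_R_minus_E[of n]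
      by (intro mult_mono) (auto intro: order_trans[OF norm_ge_zero])
    then show ?thesis using N[OF n] by simp
  next
    case False
    then have "mdlK K l i = mdl l i" by (auto simp: xyn mdlK_def mdl_def)
    then show ?thesis using e by simp
  qed
qed

lemma twist_fd_carrier:
  assumes K: "finite K" and L: "finite L"
  shows "twist_fd K L \<subseteq> twist_carrier"
proof
  fix a assume "a \<in> twist_fd K L"
  then obtain l where l: "\<And>x. x \<notin> K \<Longrightarrow> l x = 0" "\<And>i. i \<notin> L \<Longrightarrow> a i = mdlK K l i" by (auto simp: twist_fd_def)
  have fin: "finite {x. l x \<noteq> 0}" by (rule finite_subset[OF _ K]) (use l(1) in blast)
  obtain b where b: "\<And>x. cmod (l x) \<le> b" using finite_support_bounded[OF fin] by blast
  show "a \<in> twist_carrier"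
  proof (rule twist_carrierI)
    fix e :: real assume e: "0 < e"
    obtain N where N: "\<And>n. n \<ge> N \<Longrightarrow> 4 * b * sn n \<le> e" using sn_small[OF e] by blast
    have "opn (a i - mdl l i) \<le> e" if "i \<notin> L \<union> K \<times> K \<times> {..<N}" for i
      using mdlK_near[where i=i and K=K, OF b N e] l(2)[of i] that by auto
    then show "\<exists>l L. finite {x. l x \<noteq> 0} \<and> finite L \<and> (\<forall>i. i \<notin> L \<longrightarrow> opn (a i - mdl l i) \<le> e)"
      using fin K L by (intro exI[of _ l] exI[of _ "L \<union> K \<times> K \<times> {..<N}"]) auto
  qed
qed

lemma lin_span_twist_sum:
  assumes "\<And>x. x \<in> X \<Longrightarrow> g x \<in> lin_span twist B"
  shows "(\<lambda>i. \<Sum>x\<in>X. msc (f x) (g x i)) \<in> lin_span twist B"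
  using assms
proof (induction X rule: infinite_finite_induct)
  case (insert x X)
  have "smul twist (f x) (g x) \<in> lin_span twist B" using insert by (intro lin_span.span_smul) auto
  moreover have "(\<lambda>i. \<Sum>x\<in>X. msc (f x) (g x i)) \<in> lin_span twist B" using insert by auto
  ultimately have "add twist (smul twist (f x) (g x)) (\<lambda>i. \<Sum>x\<in>X. msc (f x) (g x i)) \<in> lin_span twist B"
    by (rule lin_span.span_add)
  then show ?case using insert.hyps by simp
qed (use lin_span.span_zero[of twist B] in simp_all)

lemma fd_subalgebra_twist_fd:
  fixes K :: "'k set"
  assumes K: "finite K" and L: "finite L"
  shows "fd_subalgebra twist (twist_fd K L)"
proof -
  \<comment> \<open>The spanning set: matrix units at the points of L, and for each x in K its
    modified projection, cut to 0 on L so that the two families do not interfere.\<close>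
  define u :: "'k idx \<times> 2 \<times> 2 \<Rightarrow> 'k idx \<Rightarrow> cmat2" where
    "u = (\<lambda>(l, p, q) i. if i = l then (\<chi> r s. if r = p \<and> s = q then 1 else 0) else 0)"
  define v :: "'k \<Rightarrow> 'k idx \<Rightarrow> cmat2" where
    "v x = (\<lambda>i. if i \<in> L then 0 else mdlK K (\<lambda>z. if z = x then 1 else 0) i)" for x
  let ?B = "v ` K \<union> u ` (L \<times> UNIV)"
  have "?B \<subseteq> twist_fd K L"
  proof -
    have "v x \<in> twist_fd K L" if "x \<in> K" for x
      unfolding twist_fd_def using that by (auto simp: v_def intro!: exI[of _ "\<lambda>z. if z = x then 1 else 0"])
    moreover have "u w \<in> twist_fd K L" if "w \<in> L \<times> UNIV" for w
      unfolding twist_fd_def using that by (auto simp: u_def mdlK_zero intro!: exI[of _ "\<lambda>_. 0"])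
    ultimately show ?thesis by blast
  qed
  moreover have "finite ?B" using K L by simp
  moreover have "twist_fd K L \<subseteq> lin_span twist ?B"
  proof
    fix a assume "a \<in> twist_fd K L"
    then obtain l where l: "\<And>x. x \<notin> K \<Longrightarrow> l x = 0" "\<And>i. i \<notin> L \<Longrightarrow> a i = mdlK K l i" by (auto simp: twist_fd_def)
    have 1: "(\<lambda>i. \<Sum>x\<in>K. msc (l x) (v x i)) \<in> lin_span twist ?B"
      by (rule lin_span_twist_sum) (auto intro: lin_span.span_base)
    have 2: "(\<lambda>i. \<Sum>w\<in>L \<times> UNIV. msc (a (fst w) $ fst (snd w) $ snd (snd w)) (u w i)) \<in> lin_span twist ?B"
      by (rule lin_span_twist_sum) (auto intro: lin_span.span_base)
    have s1: "(\<Sum>x\<in>K. msc (l x) (v x i)) = (if i \<in> L then 0 else a i)" for i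
      using mdlK_sum[of K l i] K l by (auto simp: v_def cmat_simps)
    have s2: "(\<Sum>w\<in>L \<times> UNIV. msc (a (fst w) $ fst (snd w) $ snd (snd w)) (u w i)) = (if i \<in> L then a i else 0)" for i
    proof -
      have "(\<Sum>w\<in>L \<times> UNIV. msc (a (fst w) $ fst (snd w) $ snd (snd w)) (u w i))
          = (\<Sum>j\<in>L. \<Sum>pq\<in>UNIV. msc (a j $ fst pq $ snd pq) (u (j, pq) i))"
        by (simp add: sum.cartesian_product case_prod_unfold)
      also have "\<dots> = (\<Sum>j\<in>L. if j = i then \<Sum>pq\<in>UNIV. msc (a j $ fst pq $ snd pq) (u (j, pq) j) else 0)"
        by (intro sum.cong refl) (auto simp: u_def cmat_simps split_beta)
      also have "\<dots> = (if i \<in> L then \<Sum>pq\<in>UNIV. msc (a i $ fst pq $ snd pq) (u (i, pq) i) else 0)"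
        using L by simp
      also have "(\<Sum>pq\<in>UNIV. msc (a i $ fst pq $ snd pq) (u (i, pq) i)) = a i"
      proof -
        have "(\<Sum>pq\<in>UNIV. msc (a i $ fst pq $ snd pq) (u (i, pq) i))
            = (\<Sum>p\<in>UNIV. \<Sum>q\<in>UNIV. msc (a i $ p $ q) (u (i, p, q) i))"
          unfolding UNIV_Times_UNIV[symmetric] by (simp add: sum.cartesian_product case_prod_unfold)
        also have "\<dots> = a i"
          by (simp add: sum_2 u_def msc_def Finite_Cartesian_Product.vec_eq_iff forall_2)
        finally show ?thesis .
      qed
      finally show ?thesis .
    qed
    have "add twist (\<lambda>i. \<Sum>x\<in>K. msc (l x) (v x i)) (\<lambda>i. \<Sum>w\<in>L \<times> UNIV. msc (a (fst w) $ fst (snd w) $ snd (snd w)) (u w i)) = a"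
      unfolding twist_sel s1 s2 by auto
    then show "a \<in> lin_span twist ?B" using lin_span.span_add[OF 1 2] by simp
  qed
  ultimately have span: "\<exists>B. finite B \<and> B \<subseteq> twist_fd K L \<and> twist_fd K L \<subseteq> lin_span twist B" by blast
  have zero: "(\<lambda>_. 0) \<in> twist_fd K L"
    unfolding twist_fd_def by (auto simp: mdlK_zero intro!: exI[of _ "\<lambda>_. 0"])
  have add: "(\<lambda>i. a i + b i) \<in> twist_fd K L" "(\<lambda>i. a i ** b i) \<in> twist_fd K L"
    if ab: "a \<in> twist_fd K L" "b \<in> twist_fd K L" for a b
  proof -
    obtain l m where lm: "\<And>x. x \<notin> K \<Longrightarrow> l x = 0" "\<And>i. i \<notin> L \<Longrightarrow> a i = mdlK K l i"
        "\<And>x. x \<notin> K \<Longrightarrow> m x = 0" "\<And>i. i \<notin> L \<Longrightarrow> b i = mdlK K m i"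
      using ab unfolding twist_fd_def mem_Collect_eq by metis
    show "(\<lambda>i. a i + b i) \<in> twist_fd K L"
      unfolding twist_fd_def using lm by (auto simp: mdlK_add intro!: exI[of _ "\<lambda>x. l x + m x"])
    show "(\<lambda>i. a i ** b i) \<in> twist_fd K L"
      unfolding twist_fd_def using lm by (auto simp: mdlK_mult[OF lm(1,3)] intro!: exI[of _ "\<lambda>x. l x * m x"])
  qed
  have scale: "(\<lambda>i. msc c (a i)) \<in> twist_fd K L" "(\<lambda>i. madj (a i)) \<in> twist_fd K L" if aD: "a \<in> twist_fd K L" for a c
  proof -
    obtain l where l: "\<And>x. x \<notin> K \<Longrightarrow> l x = 0" "\<And>i. i \<notin> L \<Longrightarrow> a i = mdlK K l i"
      using aD unfolding twist_fd_def mem_Collect_eq by metis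
    show "(\<lambda>i. msc c (a i)) \<in> twist_fd K L"
      unfolding twist_fd_def using l by (auto simp: mdlK_scale intro!: exI[of _ "\<lambda>x. c * l x"])
    show "(\<lambda>i. madj (a i)) \<in> twist_fd K L"
      unfolding twist_fd_def using l by (auto simp: mdlK_cnj intro!: exI[of _ "\<lambda>x. cnj (l x)"])
  qed
  show ?thesis
    unfolding fd_subalgebra_def twist_sel
    by (intro conjI ballI allI span zero add scale twist_fd_carrier[OF K L])
qed

lemma is_LF_twist: "is_LF (twist :: ('k idx \<Rightarrow> cmat2) cstar_struct)"
  unfolding is_LF_def twist_sel
proof (intro allI impI, elim conjE)
  fix F :: "('k idx \<Rightarrow> cmat2) set" and e :: real
  assume F: "finite F" "F \<subseteq> twist_carrier" and "0 < e"
  then have e: "0 < e / 3" by simp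
  have "\<forall>a\<in>F. \<exists>l L. finite {x. l x \<noteq> 0} \<and> finite L \<and> (\<forall>i. i \<notin> L \<longrightarrow> opn (a i - mdl l i) \<le> e / 3)"
    using F(2) e unfolding twist_carrier_def by blast
  then obtain l L where l: "\<And>a. a \<in> F \<Longrightarrow> finite {x. l a x \<noteq> 0}" "\<And>a. a \<in> F \<Longrightarrow> finite (L a)"
      "\<And>a i. a \<in> F \<Longrightarrow> i \<notin> L a \<Longrightarrow> opn (a i - mdl (l a) i) \<le> e / 3" by metis
  have "\<exists>b. 0 \<le> b \<and> (\<forall>x. cmod (l a x) \<le> b)" if "a \<in> F" for a
    using finite_support_bounded[OF l(1)[OF that]] by metis
  then obtain b where b: "\<And>a. a \<in> F \<Longrightarrow> 0 \<le> b a" "\<And>a x. a \<in> F \<Longrightarrow> cmod (l a x) \<le> b a" by metis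
  define b' where "b' = (\<Sum>a\<in>F. b a)"
  have b': "cmod (l a x) \<le> b'" if "a \<in> F" for a x
    using b(2)[OF that, of x] member_le_sum[of a F b] that b(1) F(1) unfolding b'_def by force
  obtain N where N: "\<And>n. n \<ge> N \<Longrightarrow> 4 * b' * sn n \<le> e / 3" using sn_small[OF e] by blast
  define K where "K = (\<Union>a\<in>F. {x. l a x \<noteq> 0})"
  \<comment> \<open>L' also absorbs the indices over K with \<open>n < N\<close>, where
    \<open>pR n\<close> may be far from \<open>pE\<close>; there the approximant copies a, as values
    on L' are free.\<close>
  define L' where "L' = (\<Union>a\<in>F. L a) \<union> K \<times> K \<times> {..<N}"
  have fin: "finite K" "finite L'" using F(1) l(1,2) by (auto simp: K_def L'_def)
  have "\<exists>y\<in>twist_fd K L'. cdist twist a y < e" if a: "a \<in> F" for a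
  proof -
    define y where "y i = (if i \<in> L' then a i else mdlK K (l a) i)" for i
    have "y \<in> twist_fd K L'"
      unfolding twist_fd_def using a by (auto simp: y_def K_def intro!: exI[of _ "l a"])
    moreover have "opn (a i - y i) \<le> 2 * (e / 3)" for i
    proof (cases "i \<in> L'")
      case True
      then show ?thesis using e by (simp add: y_def)
    next
      case False
      have "opn (mdlK K (l a) i - mdl (l a) i) \<le> e / 3"
        by (rule mdlK_near[where b=b' and N=N]) (use b' a N e False in \<open>auto simp: L'_def\<close>)
      moreover have "opn (a i - mdl (l a) i) \<le> e / 3" using l(3)[OF a, of i] False a by (auto simp: L'_def)
      ultimately show ?thesis
        using opn_diff_triangle[of "a i" "y i" "mdl (l a) i"] False
          opn_diff_commute[of "mdl (l a) i" "mdlK K (l a) i"] by (simp add: y_def)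
    qed
    then have "cdist twist a y \<le> 2 * (e / 3)" by (rule cdist_le)
    then have "cdist twist a y < e" using \<open>0 < e\<close> by simp
    ultimately show ?thesis by blast
  qed
  then show "\<exists>D. fd_subalgebra twist D \<and> approx_subset twist e F D"
    using fd_subalgebra_twist_fd[OF fin] unfolding approx_subset_def by blast
qed

section \<open>Countable supports and the failure of AF\<close>

lemma multiple_of_projection:
  fixes X P :: "nat \<Rightarrow> cmat2"
  assumes P: "\<And>n. opn (P n) = 1" and near: "\<And>e. 0 < e \<Longrightarrow> \<exists>c. \<forall>n. opn (X n - msc c (P n)) \<le> e"
  shows "\<exists>c. \<forall>n. X n = msc c (P n)"
proof -
  have "\<forall>k. \<exists>c. \<forall>n. opn (X n - msc c (P n)) \<le> 1 / real (Suc k)" using near by simp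
  then obtain c where c: "\<And>k n. opn (X n - msc (c k) (P n)) \<le> 1 / real (Suc k)" by metis
  \<comment> \<open>Since \<open>P 0\<close> has norm 1, the constants can be compared at the single
    index 0; this makes them a Cauchy sequence.\<close>
  have diff: "cmod (c k - c j) \<le> 1 / real (Suc k) + 1 / real (Suc j)" for k j
  proof -
    have "cmod (c k - c j) = opn (msc (c k) (P 0) - msc (c j) (P 0))"
      by (simp add: opn_msc P flip: cmat_simps(8))
    also have "\<dots> \<le> opn (msc (c k) (P 0) - X 0) + opn (X 0 - msc (c j) (P 0))" by (rule opn_diff_triangle)
    also have "\<dots> \<le> 1 / real (Suc k) + 1 / real (Suc j)"
      using c[of 0 k] c[of 0 j] opn_diff_commute[of "X 0" "msc (c k) (P 0)"] by simp
    finally show ?thesis .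
  qed
  have inv: "\<exists>K. \<forall>k\<ge>K. 1 / real (Suc k) < e" if e: "0 < e" for e
  proof -
    obtain K where K: "1 / real (Suc K) < e" using nat_approx_posE[OF e] by blast
    have "1 / real (Suc k) < e" if "k \<ge> K" for k
    proof -
      have "1 / real (Suc k) \<le> 1 / real (Suc K)" using that by (intro divide_left_mono) auto
      then show ?thesis using K by linarith
    qed
    then show ?thesis by blast
  qed
  have "Cauchy c"
  proof (rule metric_CauchyI)
    fix e :: real assume "0 < e"
    then have "0 < e / 2" by simp
    then obtain K where K: "\<And>k. k \<ge> K \<Longrightarrow> 1 / real (Suc k) < e / 2" using inv by blast
    have "dist (c m) (c n) < e" if "m \<ge> K" "n \<ge> K" for m n
      using diff[of m n] K[OF that(1)] K[OF that(2)] by (simp add: dist_norm)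
    then show "\<exists>M. \<forall>m\<ge>M. \<forall>n\<ge>M. dist (c m) (c n) < e" by blast
  qed
  then obtain d where d: "c \<longlonglongrightarrow> d" using Cauchy_convergent convergent_def by blast
  have "opn (X n - msc d (P n)) \<le> e" if e: "0 < e" for n e
  proof -
    have e2: "0 < e / 2" using e by simp
    obtain K where K: "\<And>k. k \<ge> K \<Longrightarrow> 1 / real (Suc k) < e / 2" using inv[OF e2] by blast
    obtain K' where K': "\<And>k. k \<ge> K' \<Longrightarrow> dist (c k) d < e / 2" using metric_LIMSEQ_D[OF d e2] by blast
    let ?k = "max K K'"
    have "opn (msc (c ?k) (P n) - msc d (P n)) = dist (c ?k) d"
      by (simp add: opn_msc P dist_norm flip: cmat_simps(8))
    then show ?thesis
      using opn_diff_triangle[of "X n" "msc d (P n)" "msc (c ?k) (P n)"] c[of n ?k] K[of ?k] K'[of ?k] by simp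
  qed
  then have "opn (X n - msc d (P n)) \<le> 0" for n by (rule field_le_epsilon) simp
  then have "opn (X n - msc d (P n)) = 0" for n by (meson antisym opn_nonneg)
  then show ?thesis by (auto simp: opn_eq_0)
qed

text \<open>C collects every coordinate that occurs in the support or in an exceptional index of an
  approximation of order 1 / (k + 1). If y avoids C, all these approximations are multiples of
  \<open>pE\<close> at (x, y, n), with factors independent of n, and such sequences are closed under
  uniform limits; likewise for x and \<open>pQ n\<close>.\<close>

lemma twist_countable_support:
  fixes a :: "'k idx \<Rightarrow> cmat2"
  assumes a: "a \<in> twist_carrier"
  obtains C where "countable C" "\<And>x y. x \<noteq> y \<Longrightarrow> y \<notin> C \<Longrightarrow> \<exists>c. \<forall>n. a (x, y, n) = msc c pE"
    "\<And>x y. x \<noteq> y \<Longrightarrow> x \<notin> C \<Longrightarrow> \<exists>c. \<forall>n. a (x, y, n) = msc c (pQ n)"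
proof -
  have "\<forall>k. \<exists>l L. finite {x. l x \<noteq> 0} \<and> finite L \<and> (\<forall>i. i \<notin> L \<longrightarrow> opn (a i - mdl l i) \<le> 1 / real (Suc k))"
    using a unfolding twist_carrier_def by simp
  then obtain l L where l: "\<And>k. finite {x. l k x \<noteq> 0}" "\<And>k. finite (L k)"
      "\<And>k i. i \<notin> L k \<Longrightarrow> opn (a i - mdl (l k) i) \<le> 1 / real (Suc k)" by metis
  define C where "C = (\<Union>k. {x. l k x \<noteq> 0} \<union> fst ` L k \<union> (fst \<circ> snd) ` L k)"
  have small: "\<exists>k. 1 / real (Suc k) \<le> e" if "0 < e" for e
    using nat_approx_posE[OF that] by (metis less_imp_le)
  show thesis
  proof (rule that[of C])
    show "countable C" unfolding C_def using l(1,2) by (intro countable_UN) (simp_all add: countable_finite)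
  next
    fix x y assume xy: "x \<noteq> y" "y \<notin> C"
    show "\<exists>c. \<forall>n. a (x, y, n) = msc c pE"
    proof (rule multiple_of_projection)
      fix e :: real assume "0 < e"
      then obtain k where k: "1 / real (Suc k) \<le> e" using small by blast
      have "opn (a (x, y, n) - msc (l k x) pE) \<le> e" for n
      proof -
        have "l k y = 0" using xy(2) by (auto simp: C_def)
        then have "mdl (l k) (x, y, n) = msc (l k x) pE" using xy(1) by (simp add: mdl_def cmat_simps)
        moreover have "(x, y, n) \<notin> L k" using xy(2) by (force simp: C_def)
        ultimately show ?thesis using l(3)[of "(x, y, n)" k] k by simp
      qed
      then show "\<exists>c. \<forall>n. opn (a (x, y, n) - msc c pE) \<le> e" by blast
    qed (simp add: proj_simps)
  next
    fix x y assume xy: "x \<noteq> y" "x \<notin> C"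
    show "\<exists>c. \<forall>n. a (x, y, n) = msc c (pQ n)"
    proof (rule multiple_of_projection)
      fix e :: real assume "0 < e"
      then obtain k where k: "1 / real (Suc k) \<le> e" using small by blast
      have "opn (a (x, y, n) - msc (l k y) (pQ n)) \<le> e" for n
      proof -
        have "l k x = 0" using xy(2) by (auto simp: C_def)
        then have "mdl (l k) (x, y, n) = msc (l k y) (pQ n)" using xy(1) by (simp add: mdl_def cmat_simps)
        moreover have "(x, y, n) \<notin> L k" using xy(2) by (force simp: C_def)
        ultimately show ?thesis using l(3)[of "(x, y, n)" k] k by simp
      qed
      then show "\<exists>c. \<forall>n. opn (a (x, y, n) - msc c (pQ n)) \<le> e" by blast
    qed (simp add: proj_simps)
  qed
qed

text \<open>A free pair for a set mapping with countable values. Take aleph 1 many candidates x.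
  They and their images do not exhaust the type, so some y lies outside, and the countable set f y
  cannot contain all candidates. Inserting x into f x ensures that y is not itself a
  candidate.\<close>

lemma free_pair:
  fixes f :: "'k \<Rightarrow> 'k set"
  assumes big: "(aleph1, card_of (UNIV :: 'k set)) \<in> ordLess" and f: "\<And>x. countable (f x)"
  obtains x y where "x \<noteq> y" "x \<notin> f y" "y \<notin> f x"
proof -
  have co: "Card_order aleph1" by (rule cardSuc_Card_order[OF natLeq_Card_order])
  have inf: "\<not> finite (Field aleph1)"
    using cardSuc_finite[OF natLeq_Card_order] by (simp add: Field_natLeq)
  have "(card_of (Field aleph1), card_of (UNIV :: 'k set)) \<in> ordLeq"
    using big card_of_Field_ordIso[OF co] ordIso_ordLess_trans ordLess_imp_ordLeq by blast
  then obtain g :: "nat set \<Rightarrow> 'k" where g: "inj_on g (Field aleph1)"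
    using card_of_ordLeq[of "Field aleph1" "UNIV :: 'k set"] by blast
  define X where "X = g ` Field aleph1"
  have Xiso: "(card_of X, aleph1) \<in> ordIso"
  proof -
    have "bij_betw g (Field aleph1) X" using g by (simp add: X_def bij_betw_def)
    then have "(card_of X, card_of (Field aleph1)) \<in> ordIso"
      using card_of_ordIso ordIso_symmetric by blast
    then show ?thesis using card_of_Field_ordIso[OF co] ordIso_transitive by blast
  qed
  have cnt: "(card_of Y, aleph1) \<in> ordLess" if "countable Y" for Y :: "'k set"
  proof -
    have "(card_of Y, natLeq) \<in> ordLeq"
      using that by (metis card_of_nat countable_def card_of_ordLeq ordLeq_ordIso_trans subset_UNIV)
    then show ?thesis using cardSuc_greater[OF natLeq_Card_order] ordLeq_ordLess_trans by blast
  qed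
  have "(card_of (\<Union>x\<in>X. insert x (f x)), aleph1) \<in> ordLeq"
  proof (rule card_of_UNION_ordLeq_infinite_Field[OF inf co])
    show "(card_of X, aleph1) \<in> ordLeq" using Xiso by (rule ordIso_imp_ordLeq)
    show "\<forall>x\<in>X. (card_of (insert x (f x)), aleph1) \<in> ordLeq"
      using cnt f ordLess_imp_ordLeq by blast
  qed
  then have "(card_of (\<Union>x\<in>X. insert x (f x)), card_of (UNIV :: 'k set)) \<in> ordLess"
    using big ordLeq_ordLess_trans by blast
  then have "(\<Union>x\<in>X. insert x (f x)) \<noteq> UNIV" using ordLess_irreflexive by metis
  then obtain y where y: "y \<notin> (\<Union>x\<in>X. insert x (f x))" by blast
  have "\<not> X \<subseteq> f y"
  proof
    assume "X \<subseteq> f y"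
    then have "(card_of X, aleph1) \<in> ordLess" using cnt f countable_subset by blast
    then show False using Xiso not_ordLess_ordIso by blast
  qed
  then obtain x where "x \<in> X" "x \<notin> f y" by blast
  then show thesis using y by (intro that[of x y]) auto
qed

definition delta :: "'k \<Rightarrow> 'k \<Rightarrow> complex" where
  "delta x z = (if z = x then 1 else 0)"

lemma mdl_carrier:
  assumes "finite {x. l x \<noteq> 0}"
  shows "mdl l \<in> twist_carrier"
  by (rule twist_carrierI) (use assms in \<open>auto intro!: exI[of _ l] exI[of _ "{}"]\<close>)

lemma delta_carrier: "mdl (delta x) \<in> twist_carrier"
  by (rule mdl_carrier) (simp add: delta_def)

text \<open>Power series serve as a ready-made vector space of complex sequences; the scalar action
  is multiplication by constant series.\<close>

interpretation fv: vector_space "\<lambda>(c :: complex) f. fps_const c * f"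
  by unfold_locales (simp_all add: algebra_simps flip: fps_const_add fps_const_mult)

text \<open>A linear relation among the powers is a polynomial with infinitely many roots z n.
  Exponents start at 1, since the algebra in question need not have a unit.\<close>

lemma not_finite_dimensional_powers:
  fixes z :: "nat \<Rightarrow> complex"
  assumes z: "inj z" and B: "finite B" and sub: "\<And>k. Abs_fps (\<lambda>n. z n ^ Suc k) \<in> fv.span B"
  shows False
proof -
  have root: "p = 0" if "\<And>n. poly p (z n) = 0" for p
  proof (rule ccontr)
    assume "p \<noteq> 0"
    then have "finite {x. poly p x = 0}" by (rule poly_roots_finite)
    moreover have "range z \<subseteq> {x. poly p x = 0}" using that by auto
    ultimately show False using z finite_subset range_inj_infinite by blast
  qed
  define g where "g k = Abs_fps (\<lambda>n. z n ^ Suc k)" for k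
  have inj: "inj g"
  proof
    fix k j assume "g k = g j"
    then have "z n ^ Suc k = z n ^ Suc j" for n by (metis g_def fps_nth_Abs_fps)
    then have "monom 1 (Suc k) - monom 1 (Suc j) = (0 :: complex poly)"
      by (intro root) (simp add: poly_monom)
    then show "k = j" by (metis Suc_inject eq_iff_diff_eq_0 degree_monom_eq zero_neq_one)
  qed
  have "fv.independent (range g)"
  proof
    assume "fv.dependent (range g)"
    then obtain t u where t: "finite t" "t \<subseteq> range g" "(\<Sum>v\<in>t. fps_const (u v) * v) = 0" "\<exists>v\<in>t. u v \<noteq> 0"
      unfolding fv.dependent_explicit by blast
    define J where "J = g -` t"
    have tJ: "t = g ` J" using t(2) by (auto simp: J_def)
    have finJ: "finite J" unfolding J_def using t(1) inj by (intro finite_vimageI)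
    define p where "p = (\<Sum>k\<in>J. monom (u (g k)) (Suc k))"
    have sum0: "(\<Sum>k\<in>J. fps_const (u (g k)) * g k) = 0"
      using t(3) inj unfolding tJ by (subst (asm) sum.reindex) (auto simp: inj_def inj_on_def)
    have "poly p (z n) = 0" for n
    proof -
      have "poly p (z n) = (\<Sum>k\<in>J. u (g k) * z n ^ Suc k)" by (simp add: p_def poly_sum poly_monom)
      also have "\<dots> = fps_nth (\<Sum>k\<in>J. fps_const (u (g k)) * g k) n"
        by (simp add: fps_sum_nth g_def)
      also have "\<dots> = 0" using sum0 by simp
      finally show ?thesis .
    qed
    then have "p = 0" by (rule root)
    then have "coeff p (Suc k) = 0" for k by simp
    moreover have "coeff p (Suc k) = u (g k)" if "k \<in> J" for k
    proof -
      have "coeff p (Suc k) = (\<Sum>j\<in>J. if j = k then u (g j) else 0)"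
        unfolding p_def coeff_sum by (intro sum.cong) auto
      then show ?thesis using that finJ by simp
    qed
    ultimately have "\<forall>v\<in>t. u v = 0" unfolding tJ by auto
    then show False using t(4) by blast
  qed
  moreover have "range g \<subseteq> fv.span B" using sub by (auto simp: g_def)
  ultimately have "finite (range g)" using fv.independent_span_bound[OF B] by blast
  then show False using inj range_inj_infinite by blast
qed

text \<open>Along the indices (x, y, n) of a free pair, d x and d y are n-independent nonzero
  multiples of \<open>pE\<close> and \<open>pQ n\<close>. So the product of d x, d y, d x is there a
  multiple of \<open>pE\<close> by infinitely many different numbers, its powers are linearly
  independent, and no finite-dimensional member of the family contains both d x and d y.\<close>

lemma not_is_AF_twist:
  assumes big: "(aleph1, card_of (UNIV :: 'k set)) \<in> ordLess"
  shows "\<not> is_AF (twist :: ('k idx \<Rightarrow> cmat2) cstar_struct)"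
proof
  assume "is_AF (twist :: ('k idx \<Rightarrow> cmat2) cstar_struct)"
  then obtain \<D> :: "('k idx \<Rightarrow> cmat2) set set" where fd: "\<And>D. D \<in> \<D> \<Longrightarrow> fd_subalgebra twist D"
      and dir: "\<And>D1 D2. D1 \<in> \<D> \<Longrightarrow> D2 \<in> \<D> \<Longrightarrow> \<exists>D3\<in>\<D>. D1 \<union> D2 \<subseteq> D3" and dense: "dense_in twist (\<Union>\<D>)"
    unfolding is_AF_def by metis
  \<comment> \<open>A distance below 1 prevents the factors \<mu> and \<nu> from vanishing, because
    the projections have norm 1.\<close>
  have "\<exists>D d. D \<in> \<D> \<and> d \<in> D \<and> cdist twist (mdl (delta x)) d < 1/2" for x :: 'k
  proof -
    have "\<forall>e>0. \<exists>d\<in>\<Union>\<D>. cdist twist (mdl (delta x)) d < e"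
      using dense delta_carrier[of x] unfolding dense_in_def twist_sel by blast
    moreover have "(0 :: real) < 1/2" by simp
    ultimately have "\<exists>d\<in>\<Union>\<D>. cdist twist (mdl (delta x)) d < 1/2" by blast
    then show ?thesis by blast
  qed
  then obtain D d where D: "\<And>x. D x \<in> \<D>" and d: "\<And>x. d x \<in> D x"
      and near: "\<And>x :: 'k. cdist twist (mdl (delta x)) (d x) < 1/2" by metis
  have dc: "d x \<in> twist_carrier" for x using fd[OF D[of x]] d[of x] by (auto simp: fd_subalgebra_def)
  have "\<exists>C. countable C \<and> (\<forall>x y. x \<noteq> y \<longrightarrow> y \<notin> C \<longrightarrow> (\<exists>c. \<forall>n. d w (x, y, n) = msc c pE)) \<and>
      (\<forall>x y. x \<noteq> y \<longrightarrow> x \<notin> C \<longrightarrow> (\<exists>c. \<forall>n. d w (x, y, n) = msc c (pQ n)))" for w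
    using twist_countable_support[OF dc[of w]] by metis
  then obtain C where C: "\<And>w. countable (C w)"
      "\<And>w x y. x \<noteq> y \<Longrightarrow> y \<notin> C w \<Longrightarrow> \<exists>c. \<forall>n. d w (x, y, n) = msc c pE"
      "\<And>w x y. x \<noteq> y \<Longrightarrow> x \<notin> C w \<Longrightarrow> \<exists>c. \<forall>n. d w (x, y, n) = msc c (pQ n)" by metis
  obtain x y where xy: "x \<noteq> y" "x \<notin> C y" "y \<notin> C x" by (rule free_pair[OF big C(1)])
  obtain \<mu> where \<mu>: "\<And>n. d x (x, y, n) = msc \<mu> pE" using C(2)[OF xy(1,3)] by blast
  obtain \<nu> where \<nu>: "\<And>n. d y (x, y, n) = msc \<nu> (pQ n)" using C(3)[OF xy(1,2)] by blast
  have "\<mu> \<noteq> 0"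
  proof
    assume "\<mu> = 0"
    moreover have "mdl (delta x) (x, y, 0) = pE" using xy(1) by (simp add: mdl_def delta_def cmat_simps)
    ultimately have "opn (mdl (delta x) (x, y, 0) - d x (x, y, 0)) = 1" using \<mu>[of 0] by (simp add: cmat_simps proj_simps)
    then show False using opn_le_cdist[OF delta_carrier dc, of x "(x, y, 0)" x] near[of x] by simp
  qed
  have "\<nu> \<noteq> 0"
  proof
    assume "\<nu> = 0"
    moreover have "mdl (delta y) (x, y, 0) = pQ 0" using xy(1) by (simp add: mdl_def delta_def cmat_simps)
    ultimately have "opn (mdl (delta y) (x, y, 0) - d y (x, y, 0)) = 1" using \<nu>[of 0] by (simp add: cmat_simps proj_simps)
    then show False using opn_le_cdist[OF delta_carrier dc, of y "(x, y, 0)" y] near[of y] by simp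
  qed
  obtain D3 where D3: "D3 \<in> \<D>" "D x \<union> D y \<subseteq> D3" using dir[OF D D] by blast
  have mul: "(\<lambda>i. a i ** b i) \<in> D3" if "a \<in> D3" "b \<in> D3" for a b
    using fd[OF D3(1)] that unfolding fd_subalgebra_def twist_sel by blast
  obtain B where B: "finite B" "D3 \<subseteq> lin_span twist B" using fd[OF D3(1)] unfolding fd_subalgebra_def by blast
  define z where "z n = \<mu> * \<nu> * \<mu> * of_real ((sn n)\<^sup>2)" for n
  have "inj z"
  proof
    fix m n assume "z m = z n"
    then have "(sn m)\<^sup>2 = (sn n)\<^sup>2" using \<open>\<mu> \<noteq> 0\<close> \<open>\<nu> \<noteq> 0\<close> by (simp add: z_def flip: of_real_power)
    then have "sn m = sn n" using sn_bounds(1)[of m] sn_bounds(1)[of n] by (simp add: power2_eq_iff_nonneg)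
    then show "m = n" using sn_inj by (simp add: inj_def)
  qed
  define w where "w = (\<lambda>i. d x i ** d y i ** d x i)"
  have wD: "w \<in> D3" unfolding w_def using mul[OF mul] d D3(2) by blast
  have w: "w (x, y, n) = msc (z n) pE" for n
  proof -
    have "w (x, y, n) = msc (\<mu> * \<nu> * \<mu>) (pE ** pQ n ** pE)"
      by (simp add: w_def \<mu> \<nu> cmat_simps mult_ac)
    then show ?thesis by (simp add: EQE cmat_simps z_def)
  qed
  define pw where "pw = rec_nat w (\<lambda>_ a i. a i ** w i)"
  have pw0: "pw 0 = w" and pwS: "pw (Suc k) = (\<lambda>i. pw k i ** w i)" for k by (simp_all add: pw_def)
  have pwD: "pw k \<in> D3" for k by (induction k) (auto simp: pw0 pwS wD intro: mul)
  have pw: "pw k (x, y, n) = msc (z n ^ Suc k) pE" for k n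
    by (induction k) (simp_all add: pw0 pwS w cmat_simps proj_simps mult_ac)
  have E11: "pE $ 1 $ 1 = 1" by (simp add: pE_def rank1_def)
  \<comment> \<open>Reading the upper left entry along n is linear and turns a multiple of
    \<open>pE\<close> into its factor.\<close>
  define \<phi> where "\<phi> a = Abs_fps (\<lambda>n. a (x, y, n) $ 1 $ 1)" for a :: "'k idx \<Rightarrow> cmat2"
  have span: "\<phi> a \<in> fv.span (\<phi> ` B)" if "a \<in> lin_span twist B" for a
    using that
  proof induction
    case span_zero
    have "\<phi> (zer twist) = 0" by (simp add: \<phi>_def fps_eq_iff)
    then show ?case by (simp add: fv.span_zero)
  next
    case (span_base a)
    then show ?case by (intro fv.span_base) auto
  next
    case (span_add a b)
    have "\<phi> (add twist a b) = \<phi> a + \<phi> b" by (simp add: \<phi>_def fps_eq_iff)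
    then show ?case using span_add fv.span_add by simp
  next
    case (span_smul a c)
    have "\<phi> (smul twist c a) = fps_const c * \<phi> a" by (simp add: \<phi>_def fps_eq_iff msc_def)
    then show ?case using span_smul fv.span_scale by simp
  qed
  have "Abs_fps (\<lambda>n. z n ^ Suc k) \<in> fv.span (\<phi> ` B)" for k
  proof -
    have "\<phi> (pw k) = Abs_fps (\<lambda>n. z n ^ Suc k)" by (simp add: \<phi>_def pw msc_def E11)
    moreover have "\<phi> (pw k) \<in> fv.span (\<phi> ` B)" using span pwD B(2) by blast
    ultimately show ?thesis by simp
  qed
  then show False using not_finite_dimensional_powers[OF \<open>inj z\<close>, of "\<phi> ` B"] B(1) by simp
qed

section \<open>Density character of the counterexample\<close>

lemma card_of_lists_ordLeq:
  fixes X :: "'b set"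
  assumes inf: "infinite (UNIV :: 'k set)" and X: "(card_of X, card_of (UNIV :: 'k set)) \<in> ordLeq"
  shows "(card_of (lists X), card_of (UNIV :: 'k set)) \<in> ordLeq"
proof -
  let ?k = "card_of (UNIV :: 'k set)"
  have infF: "infinite (Field ?k)" using inf by (simp add: Field_card_of)
  have len: "(card_of {xs \<in> lists X. length xs = n}, ?k) \<in> ordLeq" for n
  proof (induction n)
    case 0
    have "{xs \<in> lists X. length xs = 0} = {[]}" by auto
    then show ?case using card_of_singl_ordLeq[of "UNIV :: 'k set" "[] :: 'b list"] by simp
  next
    case (Suc n)
    have "(card_of (X \<times> {xs \<in> lists X. length xs = n}), ?k) \<in> ordLeq"
      by (rule card_of_Times_ordLeq_infinite_Field[OF infF X Suc card_of_Card_order])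
    moreover have eq: "{xs \<in> lists X. length xs = Suc n} = (\<lambda>(x, xs). x # xs) ` (X \<times> {xs \<in> lists X. length xs = n})"
      by (auto simp: length_Suc_conv image_iff)
    ultimately show ?case unfolding eq using ordLeq_transitive[OF card_of_image] by blast
  qed
  have "lists X = (\<Union>n. {xs \<in> lists X. length xs = n})" by auto
  moreover have "(card_of (\<Union>n. {xs \<in> lists X. length xs = n}), ?k) \<in> ordLeq"
  proof (rule card_of_UNION_ordLeq_infinite_Field[OF infF card_of_Card_order])
    show "(card_of (UNIV :: nat set), ?k) \<in> ordLeq" using inf infinite_iff_card_of_nat by blast
  qed (use len in blast)
  ultimately show ?thesis by simp
qed

lemma card_of_countable_ordLeq:
  assumes "infinite (UNIV :: 'k set)" "countable C"
  shows "(card_of C, card_of (UNIV :: 'k set)) \<in> ordLeq"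
proof -
  have "(card_of C, card_of (UNIV :: nat set)) \<in> ordLeq"
    using assms(2) card_of_ordLeq[of C "UNIV :: nat set"] by (auto simp: countable_def)
  then show ?thesis using assms(1) infinite_iff_card_of_nat ordLeq_transitive by blast
qed

lemma card_of_Times_ordLeq:
  assumes "infinite (UNIV :: 'k set)" "(card_of X, card_of (UNIV :: 'k set)) \<in> ordLeq"
    "(card_of Y, card_of (UNIV :: 'k set)) \<in> ordLeq"
  shows "(card_of (X \<times> Y), card_of (UNIV :: 'k set)) \<in> ordLeq"
  by (rule card_of_Times_ordLeq_infinite_Field[OF _ assms(2,3) card_of_Card_order])
     (use assms(1) in \<open>simp add: Field_card_of\<close>)

text \<open>An approximant is coded by two finite lists, one of coefficients from a countable dense
  set and one of values at exceptional indices. Over an infinite type there are no more such lists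
  than elements of \<open>'k\<close>.\<close>

lemma density_twist_upper:
  assumes inf: "infinite (UNIV :: 'k set)"
  obtains S :: "('k idx \<Rightarrow> cmat2) set" where "dense_in twist S" "(card_of S, card_of (UNIV :: 'k set)) \<in> ordLeq"
proof -
  let ?k = "card_of (UNIV :: 'k set)"
  obtain Q :: "complex set" where Q: "countable Q" "\<And>U. open U \<Longrightarrow> U \<noteq> {} \<Longrightarrow> \<exists>d\<in>Q. d \<in> U"
    using countable_dense_exists by metis
  obtain R :: "cmat2 set" where R: "countable R" "\<And>U. open U \<Longrightarrow> U \<noteq> {} \<Longrightarrow> \<exists>d\<in>R. d \<in> U"
    using countable_dense_exists by metis
  define lf :: "('k \<times> complex) list \<Rightarrow> 'k \<Rightarrow> complex" where
    "lf xs x = (case map_of xs x of None \<Rightarrow> 0 | Some c \<Rightarrow> c)" for xs x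
  define dec :: "('k \<times> complex) list \<times> ('k idx \<times> cmat2) list \<Rightarrow> 'k idx \<Rightarrow> cmat2" where
    "dec = (\<lambda>(xs, ys) i. case map_of ys i of None \<Rightarrow> mdl (lf xs) i | Some r \<Rightarrow> r)"
  define S where "S = dec ` (lists (UNIV \<times> Q) \<times> lists (UNIV \<times> R))"
  have idx: "(card_of (UNIV :: 'k idx set), ?k) \<in> ordLeq"
    using card_of_Times_ordLeq[OF inf ordLeq_refl[OF card_of_Card_order]
        card_of_Times_ordLeq[OF inf ordLeq_refl[OF card_of_Card_order] card_of_countable_ordLeq[OF inf, of "UNIV :: nat set"]]]
    by simp
  have QQ: "(card_of ((UNIV :: 'k set) \<times> Q), ?k) \<in> ordLeq"
    by (rule card_of_Times_ordLeq[OF inf ordLeq_refl[OF card_of_Card_order] card_of_countable_ordLeq[OF inf Q(1)]])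
  have RR: "(card_of ((UNIV :: 'k idx set) \<times> R), ?k) \<in> ordLeq"
    by (rule card_of_Times_ordLeq[OF inf idx card_of_countable_ordLeq[OF inf R(1)]])
  have "(card_of (lists ((UNIV :: 'k set) \<times> Q) \<times> lists ((UNIV :: 'k idx set) \<times> R)), ?k) \<in> ordLeq"
    by (rule card_of_Times_ordLeq[OF inf card_of_lists_ordLeq[OF inf QQ] card_of_lists_ordLeq[OF inf RR]])
  then have "(card_of S, ?k) \<in> ordLeq" unfolding S_def using card_of_image ordLeq_transitive by blast
  moreover have "dense_in twist S"
    unfolding dense_in_def twist_sel
  proof (intro conjI ballI allI impI)
    show "S \<subseteq> twist_carrier"
    proof
      fix a assume "a \<in> S"
      then obtain xs ys where a: "a = dec (xs, ys)" by (auto simp: S_def)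
      have "finite {x. lf xs x \<noteq> 0}"
        by (rule finite_subset[OF _ finite_dom_map_of[of xs]]) (auto simp: lf_def split: option.splits)
      moreover have "finite (dom (map_of ys))" by (rule finite_dom_map_of)
      moreover have "a i = mdl (lf xs) i" if "i \<notin> dom (map_of ys)" for i
        using that by (auto simp: a dec_def dom_def)
      ultimately show "a \<in> twist_carrier"
        by (intro twist_carrierI exI[of _ "lf xs"] exI[of _ "dom (map_of ys)"]) auto
    qed
    fix a :: "'k idx \<Rightarrow> cmat2" and e :: real assume a: "a \<in> twist_carrier" and e: "0 < e"
    have e4: "0 < e / 4" and e8: "0 < e / 8" using e by auto
    obtain l L where l: "finite {x. l x \<noteq> 0}" "finite L" "\<And>i. i \<notin> L \<Longrightarrow> opn (a i - mdl l i) \<le> e / 4"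
      using twist_carrierD[OF a e4] by blast
    have "\<exists>q\<in>Q. q \<in> ball (l x) (e / 8)" for x using Q(2)[of "ball (l x) (e / 8)"] e8 by auto
    then obtain q where q: "\<And>x. q x \<in> Q" "\<And>x. cmod (l x - q x) < e / 8" by (simp add: dist_norm) metis
    \<comment> \<open>The factor 4 between \<open>opn\<close> and the Euclidean norm of the entries
      turns e / 8 into e / 2.\<close>
    have "\<exists>r\<in>R. r \<in> ball (a i) (e / 8)" for i using R(2)[of "ball (a i) (e / 8)"] e8 by auto
    then obtain r where r: "\<And>i. r i \<in> R" "\<And>i. norm (a i - r i) < e / 8" by (simp add: dist_norm) metis
    obtain X where X: "set X = {x. l x \<noteq> 0}" using finite_list[OF l(1)] by blast
    obtain Y where Y: "set Y = L" using finite_list[OF l(2)] by blast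
    define xs where "xs = map (\<lambda>x. (x, q x)) X"
    define ys where "ys = map (\<lambda>i. (i, r i)) Y"
    have lfx: "lf xs x = (if l x \<noteq> 0 then q x else 0)" for x
      by (simp add: lf_def xs_def map_of_map_restrict restrict_map_def X)
    have "dec (xs, ys) \<in> S"
      unfolding S_def using q(1) r(1) by (intro imageI) (auto simp: xs_def ys_def)
    moreover have "opn (a i - dec (xs, ys) i) \<le> e / 2" for i
    proof (cases "i \<in> L")
      case True
      then have "dec (xs, ys) i = r i" by (simp add: dec_def ys_def map_of_map_restrict restrict_map_def Y)
      then show ?thesis using opn_le_norm[of "a i - r i"] r(2)[of i] by simp
    next
      case False
      then have dec: "dec (xs, ys) i = mdl (lf xs) i" by (simp add: dec_def ys_def map_of_map_restrict restrict_map_def Y)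
      have "cmod (l x + (-1) * lf xs x) \<le> e / 8" for x using q(2)[of x] e8 by (simp add: lfx)
      then have "opn (mdl (\<lambda>x. l x + (-1) * lf xs x) i) \<le> 2 * (e / 8)" by (rule opn_mdl_le)
      then have "opn (mdl l i - mdl (lf xs) i) \<le> e / 4"
        unfolding mdl_add mdl_scale msc_minus_one by simp
      then show ?thesis
        using opn_diff_triangle[of "a i" "mdl (lf xs) i" "mdl l i"] l(3)[OF False] unfolding dec by simp
    qed
    then have "cdist twist a (dec (xs, ys)) \<le> e / 2" by (rule cdist_le)
    then have "cdist twist a (dec (xs, ys)) < e" using e by simp
    ultimately show "\<exists>y\<in>S. cdist twist a y < e" by blast
  qed
  ultimately show thesis by (intro that[of S])
qed

text \<open>The projections \<open>p\<^sub>\<xi>\<close> have mutual distance at least 1, so points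
  of S within 1/2 of them are pairwise distinct.\<close>

lemma density_twist_lower:
  fixes S :: "('k idx \<Rightarrow> cmat2) set"
  assumes inf: "infinite (UNIV :: 'k set)" and S: "dense_in twist S"
  shows "(card_of (UNIV :: 'k set), card_of S) \<in> ordLeq"
proof -
  have Sc: "S \<subseteq> twist_carrier" using S by (simp add: dense_in_def)
  have half: "(0 :: real) < 1/2" by simp
  have "\<exists>s\<in>S. cdist twist (mdl (delta x)) s < 1/2" for x :: 'k
    using S delta_carrier[of x] half unfolding dense_in_def twist_sel by blast
  then obtain s where s: "\<And>x. s x \<in> S" "\<And>x :: 'k. cdist twist (mdl (delta x)) (s x) < 1/2" by metis
  have "inj s"
  proof
    fix x y assume eq: "s x = s y"
    show "x = y"
    proof (rule ccontr)
      assume "x \<noteq> y"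
      \<comment> \<open>A third coordinate separates the two: at (x, w, 0) the projection of y
        vanishes and that of x is \<open>pE\<close>.\<close>
      obtain w where w: "w \<notin> {x, y}" using inf ex_new_if_finite[of "{x, y}"] by blast
      have v: "mdl (delta x) (x, w, 0) = pE" "mdl (delta y) (x, w, 0) = 0"
        using w \<open>x \<noteq> y\<close> by (auto simp: mdl_def delta_def cmat_simps)
      have "opn (mdl (delta x) (x, w, 0) - mdl (delta y) (x, w, 0))
          \<le> opn (mdl (delta x) (x, w, 0) - s x (x, w, 0)) + opn (s x (x, w, 0) - mdl (delta y) (x, w, 0))"
        by (rule opn_diff_triangle)
      moreover have "opn (mdl (delta x) (x, w, 0) - s x (x, w, 0)) < 1/2"
        using opn_le_cdist[OF delta_carrier, of "s x" x "(x, w, 0)"] s[of x] Sc by fastforce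
      moreover have "opn (mdl (delta y) (x, w, 0) - s x (x, w, 0)) < 1/2"
        using opn_le_cdist[OF delta_carrier, of "s y" y "(x, w, 0)"] s[of y] Sc eq by fastforce
      ultimately show False
        using opn_diff_commute[of "s x (x, w, 0)" "mdl (delta y) (x, w, 0)"] by (simp add: v proj_simps)
    qed
  qed
  then show ?thesis using s(1) card_of_ordLeq[of "UNIV :: 'k set" S] by blast
qed

lemma density_eq_twist:
  assumes inf: "infinite (UNIV :: 'k set)"
  shows "density_eq (twist :: ('k idx \<Rightarrow> cmat2) cstar_struct) (card_of (UNIV :: 'k set))"
proof -
  obtain S :: "('k idx \<Rightarrow> cmat2) set" where S: "dense_in twist S" "(card_of S, card_of (UNIV :: 'k set)) \<in> ordLeq"
    using density_twist_upper[OF inf] by blast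
  then have "(card_of S, card_of (UNIV :: 'k set)) \<in> ordIso"
    using density_twist_lower[OF inf S(1)] by (simp add: ordIso_iff_ordLeq)
  then show ?thesis unfolding density_eq_def using S(1) density_twist_lower[OF inf] by blast
qed

section \<open>Transport along an injection\<close>

text \<open>The algebra lives on functions on \<open>'k idx\<close>, whereas the statement asks for
  one on \<open>'k set\<close>; all notions involved are moved along an injection between these
  types.\<close>

definition transport :: "('a \<Rightarrow> 'b) \<Rightarrow> 'a cstar_struct \<Rightarrow> 'b cstar_struct" where
  "transport J A = \<lparr>carrier = J ` carrier A, zer = J (zer A), add = (\<lambda>x y. J (add A (inv_into UNIV J x) (inv_into UNIV J y))),
     smul = (\<lambda>c x. J (smul A c (inv_into UNIV J x))), mul = (\<lambda>x y. J (mul A (inv_into UNIV J x) (inv_into UNIV J y))),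
     star = (\<lambda>x. J (star A (inv_into UNIV J x))), nrm = (\<lambda>x. nrm A (inv_into UNIV J x))\<rparr>"

locale transported =
  fixes J :: "'a \<Rightarrow> 'b" and A :: "'a cstar_struct"
  assumes inj: "inj J"
begin

abbreviation T :: "'b cstar_struct" where "T \<equiv> transport J A"

lemma sel:
  "carrier T = J ` carrier A" "zer T = J (zer A)" "add T (J x) (J y) = J (add A x y)"
  "smul T c (J x) = J (smul A c x)" "mul T (J x) (J y) = J (mul A x y)" "star T (J x) = J (star A x)"
  "nrm T (J x) = nrm A x" "cdist T (J x) (J y) = cdist A x y"
  by (simp_all add: transport_def cdist_def inv_f_f[OF inj])

lemma cstar_algebra_transport:
  assumes "cstar_algebra A"
  shows "cstar_algebra T"
proof -
  interpret c: cstar A by unfold_locales (rule assms)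
  have complete: "\<exists>x\<in>J ` carrier A. \<forall>e>0. \<exists>N. \<forall>n\<ge>N. cdist T (f n) x < e"
    if f: "\<forall>n. f n \<in> J ` carrier A" and C: "\<forall>e>0. \<exists>N. \<forall>m\<ge>N. \<forall>n\<ge>N. cdist T (f m) (f n) < e" for f :: "nat \<Rightarrow> 'b"
  proof -
    have "\<forall>n. \<exists>x\<in>carrier A. f n = J x" using f by blast
    then obtain g where g: "\<And>n. g n \<in> carrier A" "\<And>n. f n = J (g n)" by metis
    have "\<exists>x\<in>carrier A. \<forall>e>0. \<exists>N. \<forall>n\<ge>N. cdist A (g n) x < e"
      using c.complete[of g] g(1) C by (simp add: g(2) sel)
    then show ?thesis by (auto simp: g(2) sel)
  qed
  show ?thesis
    \<comment> \<open>Quantifiers over the image become quantifiers over the carrier of A;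
      injectivity of J then reduces each clause to the corresponding axiom in quantified
      form.\<close>
    unfolding cstar_algebra_def sel(1,2) ball_simps(9) sel(3-7) inj_eq[OF inj] inj_image_mem_iff[OF inj]
    by (intro conjI c.cstar_axioms_ball(1-26) allI impI complete) blast+
qed

lemma lin_span_transport: "lin_span T (J ` B) = J ` lin_span A B"
proof
  show "lin_span T (J ` B) \<subseteq> J ` lin_span A B"
  proof
    fix x assume "x \<in> lin_span T (J ` B)"
    then show "x \<in> J ` lin_span A B"
    proof induction
      case span_zero
      then show ?case by (auto simp: sel intro: lin_span.span_zero)
    next
      case (span_base x)
      then show ?case by (auto intro: lin_span.span_base)
    next
      case (span_add x y)
      then obtain a b where ab: "a \<in> lin_span A B" "b \<in> lin_span A B" "x = J a" "y = J b" by blast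
      then show ?case using lin_span.span_add[OF ab(1,2)] by (simp add: sel)
    next
      case (span_smul x c)
      then obtain a where a: "a \<in> lin_span A B" "x = J a" by blast
      then show ?case using lin_span.span_smul[OF a(1)] by (simp add: sel)
    qed
  qed
  have "J x \<in> lin_span T (J ` B)" if "x \<in> lin_span A B" for x
    using that
  proof induction
    case span_zero
    then show ?case using lin_span.span_zero[of T] by (simp add: sel)
  next
    case (span_base x)
    then show ?case by (intro lin_span.span_base) blast
  next
    case (span_add x y)
    then show ?case using lin_span.span_add[of "J x" T "J ` B" "J y"] by (simp add: sel)
  next
    case (span_smul x c)
    then show ?case using lin_span.span_smul[of "J x" T "J ` B" c] by (simp add: sel)
  qed
  then show "J ` lin_span A B \<subseteq> lin_span T (J ` B)" by blast
qed

lemma fd_subalgebra_transport: "fd_subalgebra T (J ` D) \<longleftrightarrow> fd_subalgebra A D"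
proof -
  have "(\<exists>B. finite B \<and> B \<subseteq> J ` D \<and> J ` D \<subseteq> lin_span T B) \<longleftrightarrow> (\<exists>B. finite B \<and> B \<subseteq> D \<and> D \<subseteq> lin_span A B)"
  proof
    assume "\<exists>B. finite B \<and> B \<subseteq> J ` D \<and> J ` D \<subseteq> lin_span T B"
    then obtain B where B: "finite B" "B \<subseteq> J ` D" "J ` D \<subseteq> lin_span T B" by blast
    then obtain B' where B': "B' \<subseteq> D" "finite B'" "B = J ` B'" using finite_subset_image[OF B(1,2)] by blast
    then have "J ` D \<subseteq> J ` lin_span A B'" using B(3) by (simp add: lin_span_transport)
    then have "D \<subseteq> lin_span A B'" by (simp add: inj_image_subset_iff[OF inj])
    then show "\<exists>B. finite B \<and> B \<subseteq> D \<and> D \<subseteq> lin_span A B" using B' by blast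
  next
    assume "\<exists>B. finite B \<and> B \<subseteq> D \<and> D \<subseteq> lin_span A B"
    then obtain B where B: "finite B" "B \<subseteq> D" "D \<subseteq> lin_span A B" by blast
    then have "J ` D \<subseteq> lin_span T (J ` B)" by (simp add: lin_span_transport image_mono)
    then show "\<exists>B. finite B \<and> B \<subseteq> J ` D \<and> J ` D \<subseteq> lin_span T B"
      using B(1,2) by (intro exI[of _ "J ` B"] conjI finite_imageI image_mono)
  qed
  then show ?thesis
    unfolding fd_subalgebra_def
    by (simp add: sel inj_image_subset_iff[OF inj] inj_image_mem_iff[OF inj])
qed

lemma is_LF_transport:
  assumes "is_LF A"
  shows "is_LF T"
  unfolding is_LF_def
proof (intro allI impI, elim conjE)
  fix F e assume F: "finite F" "F \<subseteq> carrier T" and e: "(0 :: real) < e"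
  then obtain F' where F': "F' \<subseteq> carrier A" "finite F'" "F = J ` F'"
    using finite_subset_image[of F J "carrier A"] by (auto simp: sel)
  then have "finite F' \<and> F' \<subseteq> carrier A \<and> 0 < e" using e by simp
  then obtain D where D: "fd_subalgebra A D" "approx_subset A e F' D"
    using assms unfolding is_LF_def by meson
  have "approx_subset T e F (J ` D)"
    using D(2) by (auto simp: approx_subset_def F'(3) sel)
  moreover have "fd_subalgebra T (J ` D)"
    using D(1) by (simp only: fd_subalgebra_transport)
  ultimately show "\<exists>D. fd_subalgebra T D \<and> approx_subset T e F D"
    by (intro exI[of _ "J ` D"] conjI)
qed

lemma dense_in_transport: "dense_in T (J ` S) \<longleftrightarrow> dense_in A S"
  unfolding dense_in_def by (simp add: sel inj_image_subset_iff[OF inj])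

lemma subset_carrier_transport: "S \<subseteq> carrier T \<Longrightarrow> S = J ` (J -` S)"
  by (auto simp: sel)

text \<open>Used in contraposed form, to carry the failure of AF to the image. Each member of the
  family lies in the range of J and is recovered from its preimage.\<close>

lemma is_AF_of_transport:
  assumes "is_AF T"
  shows "is_AF A"
proof -
  obtain \<D> where D: "\<D> \<noteq> {}" "\<forall>D\<in>\<D>. fd_subalgebra T D" "\<forall>D1\<in>\<D>. \<forall>D2\<in>\<D>. \<exists>D3\<in>\<D>. D1 \<union> D2 \<subseteq> D3" "dense_in T (\<Union>\<D>)"
    using assms unfolding is_AF_def by metis
  define \<E> where "\<E> = (-`) J ` \<D>"
  have "\<E> \<noteq> {}" using D(1) by (simp add: \<E>_def)
  moreover have "\<forall>E\<in>\<E>. fd_subalgebra A E"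
  proof
    fix E assume "E \<in> \<E>"
    then obtain D where DD: "D \<in> \<D>" "E = J -` D" by (auto simp: \<E>_def)
    then have fd: "fd_subalgebra T D" using D(2) by blast
    then have "D = J ` E" using subset_carrier_transport DD(2) by (simp add: fd_subalgebra_def)
    then show "fd_subalgebra A E" using fd fd_subalgebra_transport by simp
  qed
  moreover have "\<forall>E1\<in>\<E>. \<forall>E2\<in>\<E>. \<exists>E3\<in>\<E>. E1 \<union> E2 \<subseteq> E3"
  proof (intro ballI)
    fix E1 E2 assume "E1 \<in> \<E>" "E2 \<in> \<E>"
    then obtain D1 D2 where D12: "D1 \<in> \<D>" "D2 \<in> \<D>" "E1 = J -` D1" "E2 = J -` D2" by (auto simp: \<E>_def)
    then obtain D3 where "D3 \<in> \<D>" "D1 \<union> D2 \<subseteq> D3" using D(3) by meson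
    then show "\<exists>E3\<in>\<E>. E1 \<union> E2 \<subseteq> E3" using D12(3,4) by (intro bexI[of _ "J -` D3"]) (auto simp: \<E>_def)
  qed
  moreover have "dense_in A (\<Union>\<E>)"
  proof -
    have "\<Union>\<D> = J ` (J -` \<Union>\<D>)" using D(4) by (intro subset_carrier_transport) (simp add: dense_in_def)
    then have "dense_in A (J -` \<Union>\<D>)" using D(4) dense_in_transport by metis
    moreover have "J -` \<Union>\<D> = \<Union>\<E>" by (auto simp: \<E>_def)
    ultimately show ?thesis by simp
  qed
  ultimately show ?thesis unfolding is_AF_def by (intro exI[of _ \<E>] conjI)
qed

lemma density_eq_transport:
  assumes "density_eq A r"
  shows "density_eq T r"
proof -
  obtain S where S: "dense_in A S" "(card_of S, r) \<in> ordIso" and low: "\<And>S. dense_in A S \<Longrightarrow> (r, card_of S) \<in> ordLeq"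
    using assms unfolding density_eq_def by blast
  have iso: "(card_of (J ` S), card_of S) \<in> ordIso" for S
  proof -
    have "bij_betw J S (J ` S)" by (simp add: bij_betw_def inj_on_subset[OF inj])
    then show ?thesis using card_of_ordIso ordIso_symmetric by blast
  qed
  have "dense_in T (J ` S)" "(card_of (J ` S), r) \<in> ordIso"
    using S dense_in_transport iso ordIso_transitive by blast+
  moreover have "(r, card_of S') \<in> ordLeq" if "dense_in T S'" for S'
  proof -
    have eq: "S' = J ` (J -` S')" using that by (intro subset_carrier_transport) (simp add: dense_in_def)
    then have "dense_in A (J -` S')" using that dense_in_transport by metis
    then have "(r, card_of (J -` S')) \<in> ordLeq" by (rule low)
    then show ?thesis using iso[of "J -` S'"] eq ordIso_symmetric ordLeq_ordIso_trans by metis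
  qed
  ultimately show ?thesis unfolding density_eq_def by blast
qed

end

text \<open>A function is coded by the pairs of an index and the number of a basic open set
  containing its value there. A countable basis separates matrices, and for infinite
  \<open>'k\<close> the pairs embed into \<open>'k\<close>.\<close>

lemma inj_functions_into_sets:
  assumes inf: "infinite (UNIV :: 'k set)"
  obtains J :: "('k idx \<Rightarrow> cmat2) \<Rightarrow> 'k set" where "inj J"
proof -
  have kk: "(card_of (UNIV :: 'k set), card_of (UNIV :: 'k set)) \<in> ordLeq"
    by (rule ordLeq_refl[OF card_of_Card_order])
  have nn: "(card_of (UNIV :: nat set), card_of (UNIV :: 'k set)) \<in> ordLeq"
    by (rule card_of_countable_ordLeq[OF inf]) simp
  have "(card_of (((UNIV :: 'k set) \<times> (UNIV :: 'k set) \<times> (UNIV :: nat set)) \<times> (UNIV :: nat set)), card_of (UNIV :: 'k set)) \<in> ordLeq"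
    by (intro card_of_Times_ordLeq[OF inf] kk nn)
  then obtain h :: "'k idx \<times> nat \<Rightarrow> 'k" where h: "inj h"
    using card_of_ordLeq[of "((UNIV :: 'k set) \<times> (UNIV :: 'k set) \<times> (UNIV :: nat set)) \<times> (UNIV :: nat set)" "UNIV :: 'k set"]
    by auto
  obtain B :: "cmat2 set set" where B: "countable B" "topological_basis B" using ex_countable_basis by blast
  define J :: "('k idx \<Rightarrow> cmat2) \<Rightarrow> 'k set" where "J f = h ` {(i, n). f i \<in> from_nat_into B n}" for f
  have "inj J"
  proof
    fix f g assume "J f = J g"
    then have "{(i, n). f i \<in> from_nat_into B n} = {(i, n). g i \<in> from_nat_into B n}"
      unfolding J_def by (simp add: inj_image_eq_iff[OF h])
    then have eq: "f i \<in> from_nat_into B n \<longleftrightarrow> g i \<in> from_nat_into B n" for i n by blast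
    show "f = g"
    proof (rule ext, rule ccontr)
      fix i assume "f i \<noteq> g i"
      then obtain U where U: "open U" "f i \<in> U" "g i \<notin> U" using t1_space by blast
      obtain V where V: "V \<in> B" "f i \<in> V" "V \<subseteq> U" using topological_basisE[OF B(2) U(1,2)] by blast
      obtain n where "V = from_nat_into B n" using from_nat_into_surj[OF B(1) V(1)] by metis
      then show False using eq[of i n] V U(3) by blast
    qed
  qed
  then show thesis by (rule that)
qed

text \<open>An arbitrary cardinal above aleph 1 enters as the cardinality of the type
  \<open>'k\<close>.\<close>

theorem LF_not_AF_exists:
  assumes big: "(aleph1, card_of (UNIV :: 'k set)) \<in> ordLess"
  shows "\<exists>A :: 'k set cstar_struct. cstar_algebra A \<and> is_LF A \<and> \<not> is_AF A \<and> density_eq A (card_of (UNIV :: 'k set))"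
proof -
  have inf: "infinite (UNIV :: 'k set)"
  proof
    assume "finite (UNIV :: 'k set)"
    then have "(card_of (UNIV :: 'k set), natLeq) \<in> ordLess" using finite_iff_ordLess_natLeq by blast
    then have "(card_of (UNIV :: 'k set), aleph1) \<in> ordLess"
      using cardSuc_greater[OF natLeq_Card_order] ordLess_transitive by blast
    then show False using big ordLess_transitive ordLess_irreflexive by blast
  qed
  obtain J :: "('k idx \<Rightarrow> cmat2) \<Rightarrow> 'k set" where "inj J" using inj_functions_into_sets[OF inf] by blast
  then interpret t: transported J twist by unfold_locales
  show ?thesis
    using t.cstar_algebra_transport[OF cstar_algebra_twist] t.is_LF_transport[OF is_LF_twist]
      t.is_AF_of_transport not_is_AF_twist[OF big] t.density_eq_transport[OF density_eq_twist[OF inf]] by blast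
qed

theorem theorem1p5:
  shows "(\<forall>A :: 'a cstar_struct. cstar_algebra A \<and> density_le A aleph1 \<longrightarrow> (is_AF A \<longleftrightarrow> is_LF A)) \<and>
         ((aleph1, card_of (UNIV :: 'k set)) \<in> ordLess \<longrightarrow>
            (\<exists>A :: 'k set cstar_struct. cstar_algebra A \<and> is_LF A \<and> \<not> is_AF A \<and>
                density_eq A (card_of (UNIV :: 'k set))))"
  using is_AF_iff_is_LF LF_not_AF_exists by blast

end
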